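(* Let $H$ be a Hopf algebra over a field $k$ with invertible antipode. For every partial $H$-module $M$, the assignment $$\Xi_M:\overline M\to\{A_{par},M\},\qquad \Xi_M\Big(\sum_i h_i\rightharpoonup\varphi(m_i)\Big)(a\otimes l)=a\cdot\sum_i(lh_i\bullet m_i)\qquad(a\in A_{par},\ l\in H),$$ defines a natural transformation $\Xi:D\Rightarrow\{A_{par},-\}$ of functors ${}_H\mathsf{PMod}\to{}_H\mathsf{Mod}$, whose components $\Xi_M$ are injective.
   Context: Notation: $H$ has antipode $S$ and comultiplication $\Delta(h)=h_{(1)}\otimes h_{(2)}$ (Sweedler notation). A (global) $H$-module is a left $H$-module; ${}_H\mathsf{Mod}$ is their category. $\otimes=\otimes_k$. A partial representation of $H$ in a $k$-algebra $B$ is a $k$-linear map $\pi:H\to B$ such that $\pi(1_H)=1_B$; $\pi(h)\pi(l_{(1)})\pi(S(l_{(2)}))=\pi(hl_{(1)})\pi(S(l_{(2)}))$; and $\pi(h_{(1)})\pi(S(h_{(2)}))\pi(l)=\pi(h_{(1)})\pi(S(h_{(2)})l)$ for all $h,l\in H$. A partial $H$-module is a $k$-vector space $M$ with a partial representation $\pi:H\to\mathrm{End}_k(M)$; one writes $h\bullet m=\pi(h)(m)$. Morphisms are $k$-linear maps commuting with $\bullet$; the category is ${}_H\mathsf{PMod}$. $H_{par}$ is the quotient of the tensor algebra of $H$ by the relations making the canonical map $[-]:H\to H_{par}$ a partial representation; it is universal, so partial $H$-modules are the same as left $H_{par}$-modules via $[h]m=h\bullet m$. Put $\varepsilon_h=[h_{(1)}][S(h_{(2)})]$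 and let $A_{par}\subseteq H_{par}$ be the subalgebra generated by all $\varepsilon_h$. $A_{par}$ is a partial $H$-module via $h\bullet a=[h_{(1)}]a[S(h_{(2)})]$. On a partial $H$-module $M$, $a\cdot m$ denotes the restriction of the $H_{par}$-action to $A_{par}$, so $\varepsilon_h\cdot m=h_{(1)}\bullet(S(h_{(2)})\bullet m)$. $\{A_{par},M\}=\mathrm{Hom}_{{}_H\mathsf{PMod}}(A_{par}\otimes H,M)$, where $h\bullet(a\otimes l)=h_{(1)}\bullet a\otimes h_{(2)}l$; it is an $H$-module by $(h'\rightharpoonup f)(a\otimes h)=f(a\otimes hh')$ and functorial in $M$ by post-composition. Standard dilation: $\mathrm{Hom}_k(H,M)$ is an $H$-module by $(h\rightharpoonup f)(l)=f(lh)$; $\varphi=\varphi_M:M\to\mathrm{Hom}_k(H,M)$, $\varphi(m)(h)=h\bullet m$, is injective; $\overline M=H\rightharpoonup\varphi(M)$ is the $H$-submodule generated by $\varphi(M)$. The dilation functor $D:{}_H\mathsf{PMod}\to{}_H\mathsf{Mod}$ is $D(M)=\overline M$, $D(f)(\sum_i h_i\rightharpoonup\varphi_M(m_i))=\sum_i h_i\rightharpoonup\varphi_N(f(m_i))$ for $f:M\to N$. *)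

theory Defs
  imports "HOL-Algebra.Module" "HOL-Algebra.QuotRing"
begin

text \<open>
  Vector spaces, algebras and (partial) modules are carrier-based. A vector space over the field
  \<open>k\<close> is a \<^locale>\<open>module\<close> over \<open>k\<close>; as usual for this record, the fields \<open>mult\<close> and \<open>one\<close>
  are irrelevant unless the module is an algebra, and are left unspecified below.
  Linear maps that are elements of Hom-spaces are extensional functions, so that equality of
  linear maps is equality of functions.
\<close>

section \<open>Linear maps and algebras\<close>

definition lin_map ::
  "('k, 'y) ring_scheme \<Rightarrow> ('k, 'v, 'a) module_scheme \<Rightarrow> ('k, 'w, 'b) module_scheme \<Rightarrow> ('v \<Rightarrow> 'w) \<Rightarrow> bool"
  where "lin_map k V W f \<longleftrightarrow>
    f \<in> carrier V \<rightarrow> carrier W \<and>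
    (\<forall>x\<in>carrier V. \<forall>y\<in>carrier V. f (x \<oplus>\<^bsub>V\<^esub> y) = f x \<oplus>\<^bsub>W\<^esub> f y) \<and>
    (\<forall>c\<in>carrier k. \<forall>x\<in>carrier V. f (c \<odot>\<^bsub>V\<^esub> x) = c \<odot>\<^bsub>W\<^esub> f x)"

definition Lin ::
  "('k, 'y) ring_scheme \<Rightarrow> ('k, 'v, 'a) module_scheme \<Rightarrow> ('k, 'w, 'b) module_scheme \<Rightarrow> ('v \<Rightarrow> 'w) set"
  where "Lin k V W = {f \<in> extensional (carrier V). lin_map k V W f}"

definition Hom_module ::
  "('k, 'y) ring_scheme \<Rightarrow> ('k, 'v, 'a) module_scheme \<Rightarrow> ('k, 'w, 'b) module_scheme \<Rightarrow> ('k, 'v \<Rightarrow> 'w) module"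
  where "Hom_module k V W =
    \<lparr>carrier = Lin k V W, mult = undefined, one = undefined,
     zero = (\<lambda>x\<in>carrier V. \<zero>\<^bsub>W\<^esub>),
     add = (\<lambda>f g. \<lambda>x\<in>carrier V. f x \<oplus>\<^bsub>W\<^esub> g x),
     smult = (\<lambda>c f. \<lambda>x\<in>carrier V. c \<odot>\<^bsub>W\<^esub> f x)\<rparr>"

definition End_algebra ::
  "('k, 'y) ring_scheme \<Rightarrow> ('k, 'v, 'a) module_scheme \<Rightarrow> ('k, 'v \<Rightarrow> 'v) module"
  where "End_algebra k V =
    (Hom_module k V V)\<lparr>mult := compose (carrier V), one := (\<lambda>x\<in>carrier V. x)\<rparr>"

text \<open>The library locale \<^locale>\<open>algebra\<close> is restricted to commutative algebras.\<close>

locale k_algebra = field k + module k A + ring A for k (structure) and A (structure) +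
  assumes smult_mult_left:
      "\<lbrakk>c \<in> carrier k; x \<in> carrier A; y \<in> carrier A\<rbrakk> \<Longrightarrow>
        (c \<odot>\<^bsub>A\<^esub> x) \<otimes>\<^bsub>A\<^esub> y = c \<odot>\<^bsub>A\<^esub> (x \<otimes>\<^bsub>A\<^esub> y)"
    and smult_mult_right:
      "\<lbrakk>c \<in> carrier k; x \<in> carrier A; y \<in> carrier A\<rbrakk> \<Longrightarrow>
        x \<otimes>\<^bsub>A\<^esub> (c \<odot>\<^bsub>A\<^esub> y) = c \<odot>\<^bsub>A\<^esub> (x \<otimes>\<^bsub>A\<^esub> y)"

definition alg_hom ::
  "('k, 'y) ring_scheme \<Rightarrow> ('k, 'v, 'a) module_scheme \<Rightarrow> ('k, 'w, 'b) module_scheme \<Rightarrow> ('v \<Rightarrow> 'w) set"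
  where "alg_hom k A B = Lin k A B \<inter> ring_hom A B"

inductive_set alg_generated ::
  "('k, 'y) ring_scheme \<Rightarrow> ('k, 'v, 'a) module_scheme \<Rightarrow> 'v set \<Rightarrow> 'v set"
  for k and A and X
  where
    one: "\<one>\<^bsub>A\<^esub> \<in> alg_generated k A X"
  | incl: "x \<in> X \<Longrightarrow> x \<in> alg_generated k A X"
  | add: "x \<in> alg_generated k A X \<Longrightarrow> y \<in> alg_generated k A X \<Longrightarrow> x \<oplus>\<^bsub>A\<^esub> y \<in> alg_generated k A X"
  | smult: "c \<in> carrier k \<Longrightarrow> x \<in> alg_generated k A X \<Longrightarrow> c \<odot>\<^bsub>A\<^esub> x \<in> alg_generated k A X"
  | mult: "x \<in> alg_generated k A X \<Longrightarrow> y \<in> alg_generated k A X \<Longrightarrow> x \<otimes>\<^bsub>A\<^esub> y \<in> alg_generated k A X"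

text \<open>
  Quotient of a module by a submodule, or of an algebra by a two-sided ideal: the library's
  \<open>F Quot U\<close> together with the induced scalar multiplication.
\<close>

definition quotient ::
  "('k, 'v, 'a) module_scheme \<Rightarrow> 'v set \<Rightarrow> ('k, 'v set) module"
  where "quotient F U =
    \<lparr>carrier = carrier (F Quot U), mult = mult (F Quot U), one = one (F Quot U),
     zero = zero (F Quot U), add = add (F Quot U),
     smult = (\<lambda>c X. \<Union>x\<in>X. U +>\<^bsub>F\<^esub> (c \<odot>\<^bsub>F\<^esub> x))\<rparr>"

definition submodule_generated ::
  "('k, 'y) ring_scheme \<Rightarrow> ('k, 'v, 'a) module_scheme \<Rightarrow> 'v set \<Rightarrow> 'v set"
  where "submodule_generated k F X = \<Inter>{U. submodule U k F \<and> X \<subseteq> U}"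


section \<open>Tensor products of vector spaces\<close>

text \<open>The free module on \<open>X\<close> consists of the finitely supported functions on \<open>X\<close>, extended by zero.\<close>

definition free_module :: "('k, 'y) ring_scheme \<Rightarrow> 'x set \<Rightarrow> ('k, 'x \<Rightarrow> 'k) module"
  where "free_module k X =
    \<lparr>carrier = {f. (\<forall>x\<in>X. f x \<in> carrier k) \<and> (\<forall>x. x \<notin> X \<longrightarrow> f x = \<zero>\<^bsub>k\<^esub>) \<and> finite {x. f x \<noteq> \<zero>\<^bsub>k\<^esub>}},
     mult = undefined, one = undefined,
     zero = (\<lambda>_. \<zero>\<^bsub>k\<^esub>),
     add = (\<lambda>f g x. f x \<oplus>\<^bsub>k\<^esub> g x),
     smult = (\<lambda>c f x. c \<otimes>\<^bsub>k\<^esub> f x)\<rparr>"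

definition free_gen :: "('k, 'y) ring_scheme \<Rightarrow> 'x \<Rightarrow> 'x \<Rightarrow> 'k"
  where "free_gen k x = (\<lambda>y. if y = x then \<one>\<^bsub>k\<^esub> else \<zero>\<^bsub>k\<^esub>)"

definition tensor_relations ::
  "('k, 'y) ring_scheme \<Rightarrow> ('k, 'v, 'a) module_scheme \<Rightarrow> ('k, 'w, 'b) module_scheme \<Rightarrow> ('v \<times> 'w \<Rightarrow> 'k) set"
  where "tensor_relations k V W =
    (let F = free_module k (carrier V \<times> carrier W); e = (\<lambda>v w. free_gen k (v, w)) in
      {e (v \<oplus>\<^bsub>V\<^esub> v') w \<ominus>\<^bsub>F\<^esub> (e v w \<oplus>\<^bsub>F\<^esub> e v' w) | v v' w.
          v \<in> carrier V \<and> v' \<in> carrier V \<and> w \<in> carrier W} \<union>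
      {e v (w \<oplus>\<^bsub>W\<^esub> w') \<ominus>\<^bsub>F\<^esub> (e v w \<oplus>\<^bsub>F\<^esub> e v w') | v w w'.
          v \<in> carrier V \<and> w \<in> carrier W \<and> w' \<in> carrier W} \<union>
      {e (c \<odot>\<^bsub>V\<^esub> v) w \<ominus>\<^bsub>F\<^esub> c \<odot>\<^bsub>F\<^esub> e v w | c v w.
          c \<in> carrier k \<and> v \<in> carrier V \<and> w \<in> carrier W} \<union>
      {e v (c \<odot>\<^bsub>W\<^esub> w) \<ominus>\<^bsub>F\<^esub> c \<odot>\<^bsub>F\<^esub> e v w | c v w.
          c \<in> carrier k \<and> v \<in> carrier V \<and> w \<in> carrier W})"

definition tensor ::
  "('k, 'y) ring_scheme \<Rightarrow> ('k, 'v, 'a) module_scheme \<Rightarrow> ('k, 'w, 'b) module_scheme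
    \<Rightarrow> ('k, ('v \<times> 'w \<Rightarrow> 'k) set) module"
  where "tensor k V W =
    (let F = free_module k (carrier V \<times> carrier W)
     in quotient F (submodule_generated k F (tensor_relations k V W)))"

text \<open>The pure tensor of \<open>v\<close> and \<open>w\<close>, as an element of the tensor product of \<open>V\<close> and \<open>W\<close>.\<close>

definition tens ::
  "('k, 'y) ring_scheme \<Rightarrow> ('k, 'v, 'a) module_scheme \<Rightarrow> ('k, 'w, 'b) module_scheme
    \<Rightarrow> 'v \<Rightarrow> 'w \<Rightarrow> ('v \<times> 'w \<Rightarrow> 'k) set"
  where "tens k V W v w =
    (let F = free_module k (carrier V \<times> carrier W)
     in submodule_generated k F (tensor_relations k V W) +>\<^bsub>F\<^esub> free_gen k (v, w))"

text \<open>The linear map on the tensor product induced by a bilinear map \<open>f\<close> into \<open>N\<close>.\<close>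

definition tensor_lift ::
  "('k, 'y) ring_scheme \<Rightarrow> ('k, 'v, 'a) module_scheme \<Rightarrow> ('k, 'w, 'b) module_scheme
    \<Rightarrow> ('k, 'n, 'c) module_scheme \<Rightarrow> ('v \<Rightarrow> 'w \<Rightarrow> 'n) \<Rightarrow> ('v \<times> 'w \<Rightarrow> 'k) set \<Rightarrow> 'n"
  where "tensor_lift k V W N f =
    (THE g. g \<in> Lin k (tensor k V W) N \<and>
      (\<forall>v\<in>carrier V. \<forall>w\<in>carrier W. g (tens k V W v w) = f v w))"


section \<open>Hopf algebras\<close>

record ('k, 'h) hopf = "('k, 'h) module" +
  comult :: "'h \<Rightarrow> ('h \<times> 'h \<Rightarrow> 'k) set"
  counit :: "'h \<Rightarrow> 'k"
  antipode :: "'h \<Rightarrow> 'h"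

text \<open>
  Sweedler notation: \<open>sweedler k H N (\<lambda>x y. t x y) h\<close> is the element written
  \<open>t h\<^sub>1 h\<^sub>2\<close> of \<open>N\<close>, where \<open>t\<close> is bilinear on \<open>H\<close> with values in \<open>N\<close>.
\<close>

definition sweedler ::
  "('k, 'y) ring_scheme \<Rightarrow> ('k, 'h, 'z) hopf_scheme \<Rightarrow> ('k, 'n, 'c) module_scheme
    \<Rightarrow> ('h \<Rightarrow> 'h \<Rightarrow> 'n) \<Rightarrow> 'h \<Rightarrow> 'n"
  where "sweedler k H N t h = tensor_lift k H H N t (comult H h)"

locale hopf_algebra = k_algebra k H for k (structure) and H (structure) +
  assumes comult_linear: "lin_map k H (tensor k H H) (comult H)"
    and comult_one: "comult H \<one>\<^bsub>H\<^esub> = tens k H H \<one>\<^bsub>H\<^esub> \<one>\<^bsub>H\<^esub>"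
    and comult_mult: "\<lbrakk>h \<in> carrier H; l \<in> carrier H\<rbrakk> \<Longrightarrow>
      comult H (h \<otimes>\<^bsub>H\<^esub> l) =
      sweedler k H (tensor k H H) (\<lambda>h1 h2. sweedler k H (tensor k H H) (\<lambda>l1 l2.
        tens k H H (h1 \<otimes>\<^bsub>H\<^esub> l1) (h2 \<otimes>\<^bsub>H\<^esub> l2)) l) h"
    and coassoc: "h \<in> carrier H \<Longrightarrow>
      sweedler k H (tensor k H (tensor k H H)) (\<lambda>x y. sweedler k H (tensor k H (tensor k H H)) (\<lambda>x1 x2.
        tens k H (tensor k H H) x1 (tens k H H x2 y)) x) h =
      sweedler k H (tensor k H (tensor k H H)) (\<lambda>x y. tens k H (tensor k H H) x (comult H y)) h"
    and counit_hom: "counit H \<in> ring_hom H k"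
    and counit_smult: "\<lbrakk>c \<in> carrier k; h \<in> carrier H\<rbrakk> \<Longrightarrow> counit H (c \<odot>\<^bsub>H\<^esub> h) = c \<otimes>\<^bsub>k\<^esub> counit H h"
    and counit_left: "h \<in> carrier H \<Longrightarrow> sweedler k H H (\<lambda>x y. counit H x \<odot>\<^bsub>H\<^esub> y) h = h"
    and counit_right: "h \<in> carrier H \<Longrightarrow> sweedler k H H (\<lambda>x y. counit H y \<odot>\<^bsub>H\<^esub> x) h = h"
    and antipode_linear: "lin_map k H H (antipode H)"
    and antipode_left: "h \<in> carrier H \<Longrightarrow>
      sweedler k H H (\<lambda>x y. antipode H x \<otimes>\<^bsub>H\<^esub> y) h = counit H h \<odot>\<^bsub>H\<^esub> \<one>\<^bsub>H\<^esub>"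
    and antipode_right: "h \<in> carrier H \<Longrightarrow>
      sweedler k H H (\<lambda>x y. x \<otimes>\<^bsub>H\<^esub> antipode H y) h = counit H h \<odot>\<^bsub>H\<^esub> \<one>\<^bsub>H\<^esub>"


section \<open>Global and partial modules\<close>

text \<open>A vector space with an action of the elements of \<open>H\<close>; used for global and for partial modules.\<close>

record ('k, 'h, 'm) hmod = "('k, 'm) module" +
  act :: "'h \<Rightarrow> 'm \<Rightarrow> 'm"

definition with_action ::
  "('k, 'm, 'a) module_scheme \<Rightarrow> ('h \<Rightarrow> 'm \<Rightarrow> 'm) \<Rightarrow> ('k, 'h, 'm) hmod"
  where "with_action M \<alpha> =
    \<lparr>carrier = carrier M, mult = mult M, one = one M, zero = zero M, add = add M,
     smult = smult M, act = \<alpha>\<rparr>"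

definition global_module ::
  "('k, 'y) ring_scheme \<Rightarrow> ('k, 'h, 'z) hopf_scheme \<Rightarrow> ('k, 'h, 'm) hmod \<Rightarrow> bool"
  where "global_module k H M \<longleftrightarrow> module k M \<and>
    (\<lambda>h\<in>carrier H. \<lambda>m\<in>carrier M. act M h m) \<in> alg_hom k H (End_algebra k M)"

definition partial_rep ::
  "('k, 'y) ring_scheme \<Rightarrow> ('k, 'h, 'z) hopf_scheme \<Rightarrow> ('k, 'b, 'a) module_scheme \<Rightarrow> ('h \<Rightarrow> 'b) \<Rightarrow> bool"
  where "partial_rep k H B \<pi> \<longleftrightarrow> lin_map k H B \<pi> \<and>
    \<pi> \<one>\<^bsub>H\<^esub> = \<one>\<^bsub>B\<^esub> \<and>
    (\<forall>h\<in>carrier H. \<forall>l\<in>carrier H.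
      sweedler k H B (\<lambda>l1 l2. \<pi> h \<otimes>\<^bsub>B\<^esub> \<pi> l1 \<otimes>\<^bsub>B\<^esub> \<pi> (antipode H l2)) l =
      sweedler k H B (\<lambda>l1 l2. \<pi> (h \<otimes>\<^bsub>H\<^esub> l1) \<otimes>\<^bsub>B\<^esub> \<pi> (antipode H l2)) l) \<and>
    (\<forall>h\<in>carrier H. \<forall>l\<in>carrier H.
      sweedler k H B (\<lambda>h1 h2. \<pi> h1 \<otimes>\<^bsub>B\<^esub> \<pi> (antipode H h2) \<otimes>\<^bsub>B\<^esub> \<pi> l) h =
      sweedler k H B (\<lambda>h1 h2. \<pi> h1 \<otimes>\<^bsub>B\<^esub> \<pi> (antipode H h2 \<otimes>\<^bsub>H\<^esub> l)) h)"

definition partial_module ::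
  "('k, 'y) ring_scheme \<Rightarrow> ('k, 'h, 'z) hopf_scheme \<Rightarrow> ('k, 'h, 'm) hmod \<Rightarrow> bool"
  where "partial_module k H M \<longleftrightarrow> module k M \<and>
    partial_rep k H (End_algebra k M) (\<lambda>h. \<lambda>m\<in>carrier M. act M h m)"

text \<open>Morphisms of partial modules, and likewise of global modules.\<close>

definition act_hom ::
  "('k, 'y) ring_scheme \<Rightarrow> ('k, 'h, 'z) hopf_scheme \<Rightarrow> ('k, 'h, 'm) hmod \<Rightarrow> ('k, 'h, 'n) hmod \<Rightarrow> ('m \<Rightarrow> 'n) set"
  where "act_hom k H M N =
    {f \<in> Lin k M N. \<forall>h\<in>carrier H. \<forall>m\<in>carrier M. f (act M h m) = act N h (f m)}"


section \<open>The algebras \<open>H\<^sub>p\<^sub>a\<^sub>r\<close> and \<open>A\<^sub>p\<^sub>a\<^sub>r\<close>\<close>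

text \<open>
  The free algebra on \<open>X\<close>: the free module on the words over \<open>X\<close>, multiplied by
  concatenation of words (\<open>i\<close> runs over the positions at which a word can be cut in two).
\<close>

definition free_algebra :: "('k, 'y) ring_scheme \<Rightarrow> 'x set \<Rightarrow> ('k, 'x list \<Rightarrow> 'k) module"
  where "free_algebra k X =
    (free_module k (lists X))
      \<lparr>mult := (\<lambda>f g w. \<Oplus>\<^bsub>k\<^esub>i\<in>{..length w}. f (take i w) \<otimes>\<^bsub>k\<^esub> g (drop i w)),
       one := free_gen k []\<rparr>"

text \<open>
  The tensor algebra of a vector space \<open>V\<close>: in the free algebra on the elements of \<open>V\<close>, the ideal
  generated by the linearity relations in the generators is spanned by the multilinearity
  relations between words of the same length, so the quotient is the direct sum of the
  tensor powers of \<open>V\<close>.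
\<close>

definition tensor_algebra_ideal ::
  "('k, 'y) ring_scheme \<Rightarrow> ('k, 'v, 'a) module_scheme \<Rightarrow> ('v list \<Rightarrow> 'k) set"
  where "tensor_algebra_ideal k V =
    (let F = free_algebra k (carrier V); e = (\<lambda>v. free_gen k [v]) in
     Idl\<^bsub>F\<^esub> ({e (v \<oplus>\<^bsub>V\<^esub> w) \<ominus>\<^bsub>F\<^esub> (e v \<oplus>\<^bsub>F\<^esub> e w) | v w. v \<in> carrier V \<and> w \<in> carrier V} \<union>
            {e (c \<odot>\<^bsub>V\<^esub> v) \<ominus>\<^bsub>F\<^esub> c \<odot>\<^bsub>F\<^esub> e v | c v. c \<in> carrier k \<and> v \<in> carrier V}))"

definition tensor_algebra ::
  "('k, 'y) ring_scheme \<Rightarrow> ('k, 'v, 'a) module_scheme \<Rightarrow> ('k, ('v list \<Rightarrow> 'k) set) module"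
  where "tensor_algebra k V = quotient (free_algebra k (carrier V)) (tensor_algebra_ideal k V)"

definition tensor_algebra_incl ::
  "('k, 'y) ring_scheme \<Rightarrow> ('k, 'v, 'a) module_scheme \<Rightarrow> 'v \<Rightarrow> ('v list \<Rightarrow> 'k) set"
  where "tensor_algebra_incl k V v =
    tensor_algebra_ideal k V +>\<^bsub>free_algebra k (carrier V)\<^esub> free_gen k [v]"

definition Hpar_ideal ::
  "('k, 'y) ring_scheme \<Rightarrow> ('k, 'h, 'z) hopf_scheme \<Rightarrow> ('h list \<Rightarrow> 'k) set set"
  where "Hpar_ideal k H =
    (let T = tensor_algebra k H; \<iota> = tensor_algebra_incl k H; S = antipode H in
     Idl\<^bsub>T\<^esub> ({\<iota> \<one>\<^bsub>H\<^esub> \<ominus>\<^bsub>T\<^esub> \<one>\<^bsub>T\<^esub>} \<union>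
       {sweedler k H T (\<lambda>l1 l2. \<iota> h \<otimes>\<^bsub>T\<^esub> \<iota> l1 \<otimes>\<^bsub>T\<^esub> \<iota> (S l2)) l
          \<ominus>\<^bsub>T\<^esub> sweedler k H T (\<lambda>l1 l2. \<iota> (h \<otimes>\<^bsub>H\<^esub> l1) \<otimes>\<^bsub>T\<^esub> \<iota> (S l2)) l
          | h l. h \<in> carrier H \<and> l \<in> carrier H} \<union>
       {sweedler k H T (\<lambda>h1 h2. \<iota> h1 \<otimes>\<^bsub>T\<^esub> \<iota> (S h2) \<otimes>\<^bsub>T\<^esub> \<iota> l) h
          \<ominus>\<^bsub>T\<^esub> sweedler k H T (\<lambda>h1 h2. \<iota> h1 \<otimes>\<^bsub>T\<^esub> \<iota> (S h2 \<otimes>\<^bsub>H\<^esub> l)) h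
          | h l. h \<in> carrier H \<and> l \<in> carrier H}))"

definition Hpar ::
  "('k, 'y) ring_scheme \<Rightarrow> ('k, 'h, 'z) hopf_scheme \<Rightarrow> ('k, ('h list \<Rightarrow> 'k) set set) module"
  where "Hpar k H = quotient (tensor_algebra k H) (Hpar_ideal k H)"

text \<open>The canonical map \<open>h \<mapsto> [h]\<close>.\<close>

definition br ::
  "('k, 'y) ring_scheme \<Rightarrow> ('k, 'h, 'z) hopf_scheme \<Rightarrow> 'h \<Rightarrow> ('h list \<Rightarrow> 'k) set set"
  where "br k H h = Hpar_ideal k H +>\<^bsub>tensor_algebra k H\<^esub> tensor_algebra_incl k H h"

definition Hpar_eps ::
  "('k, 'y) ring_scheme \<Rightarrow> ('k, 'h, 'z) hopf_scheme \<Rightarrow> 'h \<Rightarrow> ('h list \<Rightarrow> 'k) set set"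
  where "Hpar_eps k H h =
    sweedler k H (Hpar k H) (\<lambda>h1 h2. br k H h1 \<otimes>\<^bsub>Hpar k H\<^esub> br k H (antipode H h2)) h"

definition Apar ::
  "('k, 'y) ring_scheme \<Rightarrow> ('k, 'h, 'z) hopf_scheme \<Rightarrow> ('k, 'h, ('h list \<Rightarrow> 'k) set set) hmod"
  where "Apar k H =
    with_action ((Hpar k H)\<lparr>carrier := alg_generated k (Hpar k H) (Hpar_eps k H ` carrier H)\<rparr>)
      (\<lambda>h a. sweedler k H (Hpar k H) (\<lambda>h1 h2.
         br k H h1 \<otimes>\<^bsub>Hpar k H\<^esub> a \<otimes>\<^bsub>Hpar k H\<^esub> br k H (antipode H h2)) h)"

text \<open>
  The action of \<open>H\<^sub>p\<^sub>a\<^sub>r\<close> on a partial module: the algebra map obtained from the universal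
  property of \<open>H\<^sub>p\<^sub>a\<^sub>r\<close>. Applied to elements of \<open>A\<^sub>p\<^sub>a\<^sub>r\<close> it is the action written \<open>a \<cdot> m\<close>.
\<close>

definition Hpar_action ::
  "('k, 'y) ring_scheme \<Rightarrow> ('k, 'h, 'z) hopf_scheme \<Rightarrow> ('k, 'h, 'm) hmod
    \<Rightarrow> ('h list \<Rightarrow> 'k) set set \<Rightarrow> 'm \<Rightarrow> 'm"
  where "Hpar_action k H M =
    (THE \<Phi>. \<Phi> \<in> alg_hom k (Hpar k H) (End_algebra k M) \<and>
      (\<forall>h\<in>carrier H. \<Phi> (br k H h) = (\<lambda>m\<in>carrier M. act M h m)))"


section \<open>The functor \<open>{A\<^sub>p\<^sub>a\<^sub>r, -}\<close>\<close>

definition Apar_tensor_H ::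
  "('k, 'y) ring_scheme \<Rightarrow> ('k, 'h, 'z) hopf_scheme
    \<Rightarrow> ('k, 'h, (('h list \<Rightarrow> 'k) set set \<times> 'h \<Rightarrow> 'k) set) hmod"
  where "Apar_tensor_H k H =
    (let T = tensor k (Apar k H) H in
     with_action T
      (\<lambda>h. tensor_lift k (Apar k H) H T (\<lambda>a l. sweedler k H T (\<lambda>h1 h2.
         tens k (Apar k H) H (act (Apar k H) h1 a) (h2 \<otimes>\<^bsub>H\<^esub> l)) h)))"

definition AHom ::
  "('k, 'y) ring_scheme \<Rightarrow> ('k, 'h, 'z) hopf_scheme \<Rightarrow> ('k, 'h, 'm) hmod
    \<Rightarrow> ('k, 'h, (('h list \<Rightarrow> 'k) set set \<times> 'h \<Rightarrow> 'k) set \<Rightarrow> 'm) hmod"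
  where "AHom k H M =
    with_action
      ((Hom_module k (Apar_tensor_H k H) M)\<lparr>carrier := act_hom k H (Apar_tensor_H k H) M\<rparr>)
      (\<lambda>h' f. tensor_lift k (Apar k H) H M
         (\<lambda>a h. f (tens k (Apar k H) H a (h \<otimes>\<^bsub>H\<^esub> h'))))"

definition AHom_map ::
  "('k, 'y) ring_scheme \<Rightarrow> ('k, 'h, 'z) hopf_scheme \<Rightarrow> ('k, 'h, 'm) hmod \<Rightarrow> ('k, 'h, 'n) hmod
    \<Rightarrow> ('m \<Rightarrow> 'n)
    \<Rightarrow> ((('h list \<Rightarrow> 'k) set set \<times> 'h \<Rightarrow> 'k) set \<Rightarrow> 'm) \<Rightarrow> (('h list \<Rightarrow> 'k) set set \<times> 'h \<Rightarrow> 'k) set \<Rightarrow> 'n"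
  where "AHom_map k H M N f =
    (\<lambda>g\<in>carrier (AHom k H M). compose (carrier (Apar_tensor_H k H)) f g)"


section \<open>The standard dilation\<close>

definition Hom_H ::
  "('k, 'y) ring_scheme \<Rightarrow> ('k, 'h, 'z) hopf_scheme \<Rightarrow> ('k, 'h, 'm) hmod \<Rightarrow> ('k, 'h, 'h \<Rightarrow> 'm) hmod"
  where "Hom_H k H M =
    with_action (Hom_module k H M) (\<lambda>h f. \<lambda>l\<in>carrier H. f (l \<otimes>\<^bsub>H\<^esub> h))"

definition dil_phi ::
  "('k, 'h, 'z) hopf_scheme \<Rightarrow> ('k, 'h, 'm) hmod \<Rightarrow> 'm \<Rightarrow> 'h \<Rightarrow> 'm"
  where "dil_phi H M m = (\<lambda>h\<in>carrier H. act M h m)"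

text \<open>The element \<open>\<Sum>\<^sub>i h\<^sub>i \<rightharpoonup> \<phi>\<^sub>M(m\<^sub>i)\<close>, where \<open>i < n\<close>.\<close>

definition dil_sum ::
  "('k, 'y) ring_scheme \<Rightarrow> ('k, 'h, 'z) hopf_scheme \<Rightarrow> ('k, 'h, 'm) hmod
    \<Rightarrow> nat \<Rightarrow> (nat \<Rightarrow> 'h) \<Rightarrow> (nat \<Rightarrow> 'm) \<Rightarrow> 'h \<Rightarrow> 'm"
  where "dil_sum k H M n h m =
    (\<Oplus>\<^bsub>Hom_H k H M\<^esub>i\<in>{..<n}. act (Hom_H k H M) (h i) (dil_phi H M (m i)))"

text \<open>
  The submodule \<open>H \<rightharpoonup> \<phi>\<^sub>M(M)\<close> generated by the image of \<open>\<phi>\<^sub>M\<close>: the sums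
  \<open>\<Sum>\<^sub>i h\<^sub>i \<rightharpoonup> \<phi>\<^sub>M(m\<^sub>i)\<close> are closed under the action of \<open>H\<close> and, as \<open>\<phi>\<^sub>M\<close> is linear, under
  scalar multiplication.
\<close>

definition dilation ::
  "('k, 'y) ring_scheme \<Rightarrow> ('k, 'h, 'z) hopf_scheme \<Rightarrow> ('k, 'h, 'm) hmod \<Rightarrow> ('k, 'h, 'h \<Rightarrow> 'm) hmod"
  where "dilation k H M =
    (Hom_H k H M)
      \<lparr>carrier := {dil_sum k H M n h m | n h m. h \<in> {..<n} \<rightarrow> carrier H \<and> m \<in> {..<n} \<rightarrow> carrier M}\<rparr>"

text \<open>
  The image of \<open>x = \<Sum>\<^sub>i h\<^sub>i \<rightharpoonup> \<phi>\<^sub>M(m\<^sub>i)\<close> is \<open>\<Sum>\<^sub>i h\<^sub>i \<rightharpoonup> \<phi>\<^sub>N(f(m\<^sub>i))\<close>; it does not depend on the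
  representation of \<open>x\<close>, so the description is definite for every morphism \<open>f\<close>.
\<close>

definition dilation_map ::
  "('k, 'y) ring_scheme \<Rightarrow> ('k, 'h, 'z) hopf_scheme \<Rightarrow> ('k, 'h, 'm) hmod \<Rightarrow> ('k, 'h, 'n) hmod
    \<Rightarrow> ('m \<Rightarrow> 'n) \<Rightarrow> ('h \<Rightarrow> 'm) \<Rightarrow> 'h \<Rightarrow> 'n"
  where "dilation_map k H M N f =
    (\<lambda>x\<in>carrier (dilation k H M). THE y.
       \<exists>n. \<exists>h\<in>{..<n} \<rightarrow> carrier H. \<exists>m\<in>{..<n} \<rightarrow> carrier M.
         x = dil_sum k H M n h m \<and> y = dil_sum k H N n h (\<lambda>i. f (m i)))"


section \<open>Functors from partial to global modules\<close>

text \<open>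
  The objects of the source category are the partial modules with carrier in the type \<open>'m\<close>, which
  is arbitrary; the type of the carriers of the values depends on the functor.
\<close>

definition functor_PMod_Mod ::
  "('k, 'y) ring_scheme \<Rightarrow> ('k, 'h, 'z) hopf_scheme
    \<Rightarrow> (('k, 'h, 'm) hmod \<Rightarrow> ('k, 'h, 'a) hmod)
    \<Rightarrow> (('k, 'h, 'm) hmod \<Rightarrow> ('k, 'h, 'm) hmod \<Rightarrow> ('m \<Rightarrow> 'm) \<Rightarrow> ('a \<Rightarrow> 'a)) \<Rightarrow> bool"
  where "functor_PMod_Mod k H F Fmap \<longleftrightarrow>
    (\<forall>M. partial_module k H M \<longrightarrow> global_module k H (F M)) \<and>
    (\<forall>M N. partial_module k H M \<longrightarrow> partial_module k H N \<longrightarrow>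
      (\<forall>f\<in>act_hom k H M N. Fmap M N f \<in> act_hom k H (F M) (F N))) \<and>
    (\<forall>M. partial_module k H M \<longrightarrow>
      Fmap M M (\<lambda>m\<in>carrier M. m) = (\<lambda>x\<in>carrier (F M). x)) \<and>
    (\<forall>M N P. partial_module k H M \<longrightarrow> partial_module k H N \<longrightarrow> partial_module k H P \<longrightarrow>
      (\<forall>f\<in>act_hom k H M N. \<forall>g\<in>act_hom k H N P.
        Fmap M P (compose (carrier M) g f) = compose (carrier (F M)) (Fmap N P g) (Fmap M N f)))"

definition natural_transformation ::
  "('k, 'y) ring_scheme \<Rightarrow> ('k, 'h, 'z) hopf_scheme
    \<Rightarrow> (('k, 'h, 'm) hmod \<Rightarrow> ('k, 'h, 'a) hmod)
    \<Rightarrow> (('k, 'h, 'm) hmod \<Rightarrow> ('k, 'h, 'm) hmod \<Rightarrow> ('m \<Rightarrow> 'm) \<Rightarrow> ('a \<Rightarrow> 'a))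
    \<Rightarrow> (('k, 'h, 'm) hmod \<Rightarrow> ('k, 'h, 'b) hmod)
    \<Rightarrow> (('k, 'h, 'm) hmod \<Rightarrow> ('k, 'h, 'm) hmod \<Rightarrow> ('m \<Rightarrow> 'm) \<Rightarrow> ('b \<Rightarrow> 'b))
    \<Rightarrow> (('k, 'h, 'm) hmod \<Rightarrow> 'a \<Rightarrow> 'b) \<Rightarrow> bool"
  where "natural_transformation k H F Fmap G Gmap \<tau> \<longleftrightarrow>
    functor_PMod_Mod k H F Fmap \<and> functor_PMod_Mod k H G Gmap \<and>
    (\<forall>M. partial_module k H M \<longrightarrow> \<tau> M \<in> act_hom k H (F M) (G M)) \<and>
    (\<forall>M N. partial_module k H M \<longrightarrow> partial_module k H N \<longrightarrow>
      (\<forall>f\<in>act_hom k H M N.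
        compose (carrier (F M)) (\<tau> N) (Fmap M N f) = compose (carrier (F M)) (Gmap M N f) (\<tau> M)))"

end

theory Submission
  imports Defs
begin

text \<open>
  For \<open>x = \<Sum>\<^sub>i h\<^sub>i \<rightharpoonup> \<phi>(m\<^sub>i)\<close> the defining formula reads \<open>\<Xi>\<^sub>M(x)(a \<otimes> l) = a \<cdot> x(l)\<close>, so it does not depend
  on the chosen representation, and \<open>a = 1\<close> recovers \<open>x\<close>, which gives injectivity. Likewise \<open>D(f)(x) = f \<circ> x\<close>,
  so naturality says that morphisms of partial modules commute with the action of \<open>H\<^sub>p\<^sub>a\<^sub>r\<close>.

  The point is that \<open>\<Xi>\<^sub>M(x)\<close> is a morphism of partial modules. This comes down to the identity
  \<open>(h\<^sub>1 \<bullet> a) [h\<^sub>2 l] = [h] a [l]\<close> in \<open>H\<^sub>p\<^sub>a\<^sub>r\<close>. From \<open>[h] \<epsilon>\<^sub>l = \<epsilon>\<^bsub>h\<^sub>1 l\<^esub> [h\<^sub>2]\<close> one obtains by induction, for every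
  \<open>a \<in> A\<^sub>p\<^sub>a\<^sub>r\<close>, a linear map \<open>f : H \<rightarrow> A\<^sub>p\<^sub>a\<^sub>r\<close> with \<open>[h] a = f(h\<^sub>1) [h\<^sub>2]\<close>. Then \<open>h \<bullet> a = f(h\<^sub>1) \<epsilon>\<^bsub>h\<^sub>2\<^esub>\<close>, which lies
  in \<open>A\<^sub>p\<^sub>a\<^sub>r\<close>, and the identity follows from \<open>\<epsilon>\<^bsub>h\<^sub>1\<^esub> [h\<^sub>2 l] = [h] [l]\<close>.
\<close>


section \<open>Linear maps\<close>

text \<open>The commutation rule for \<open>[h]\<close> and \<open>eps l\<close> rests on one
  computation in \<open>H\<close>: S(h1 l) h2 = counit(h) S(l), obtained by inserting l2 S(l3) and
  contracting the coproduct of h l1. The axioms of a partial representation enter at opposite ends: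
  the second turns eps(h1 l) [h2] into [h1 l1] [S(h2 l2) h3], the first turns [h l1] [S(l2)] into
  [h] eps(l). For l = 1 the key identity says that the action of \<open>H\<close> on
  \<open>a\<close> is itself a map f of the required kind. The induction still has to build its own
  f, because membership of that action in \<open>Apar\<close> only follows from some f with values
  in \<open>Apar\<close>. The formal obstacle is that a Sweedler sum is a definite description: a
  linear map on \<open>H\<close> \<otimes> \<open>H\<close> evaluated at a coproduct. Each
  manipulation is the image of a Hopf axiom under the linear map induced by a multilinear
  expression, and multilinearity is a side condition of every step. The action of
  \<open>Hpar\<close> is a description too, so universal properties of all the quotients must come
  before any evaluation.\<close>

lemma lin_mapI:
  assumes "\<And>x. x \<in> carrier V \<Longrightarrow> f x \<in> carrier W"
    and "\<And>x y. x \<in> carrier V \<Longrightarrow> y \<in> carrier V \<Longrightarrow> f (x \<oplus>\<^bsub>V\<^esub> y) = f x \<oplus>\<^bsub>W\<^esub> f y"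
    and "\<And>c x. c \<in> carrier k \<Longrightarrow> x \<in> carrier V \<Longrightarrow> f (c \<odot>\<^bsub>V\<^esub> x) = c \<odot>\<^bsub>W\<^esub> f x"
  shows "lin_map k V W f"
  using assms by (auto simp: lin_map_def)

lemma lin_map_closed: "lin_map k V W f \<Longrightarrow> x \<in> carrier V \<Longrightarrow> f x \<in> carrier W"
  by (auto simp: lin_map_def)

lemma lin_map_add:
  "lin_map k V W f \<Longrightarrow> x \<in> carrier V \<Longrightarrow> y \<in> carrier V \<Longrightarrow> f (x \<oplus>\<^bsub>V\<^esub> y) = f x \<oplus>\<^bsub>W\<^esub> f y"
  by (auto simp: lin_map_def)

lemma lin_map_smult:
  "lin_map k V W f \<Longrightarrow> c \<in> carrier k \<Longrightarrow> x \<in> carrier V \<Longrightarrow> f (c \<odot>\<^bsub>V\<^esub> x) = c \<odot>\<^bsub>W\<^esub> f x"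
  by (auto simp: lin_map_def)

lemma module_add_closed:
  "module k M \<Longrightarrow> x \<in> carrier M \<Longrightarrow> y \<in> carrier M \<Longrightarrow> x \<oplus>\<^bsub>M\<^esub> y \<in> carrier M"
  by (simp add: module.axioms(2) abelian_groupE(1))

lemma module_zero_closed: "module k M \<Longrightarrow> \<zero>\<^bsub>M\<^esub> \<in> carrier M"
  by (simp add: module.axioms(2) abelian_groupE(2))

lemmas module_closed = module_add_closed module_zero_closed module.smult_closed

text \<open>Linearity concerns only values on the carrier, which is closed under the operations; so
  a map and its restriction, the form stored in \<open>Lin\<close>, are linear together.\<close>

lemma lin_map_cong:
  assumes "module k V" "\<And>x. x \<in> carrier V \<Longrightarrow> f x = g x"
  shows "lin_map k V W f \<longleftrightarrow> lin_map k V W g"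
  using assms module_closed[OF assms(1)] unfolding lin_map_def Pi_def by auto

lemma lin_map_id: "lin_map k V V (\<lambda>x. x)"
  by (simp add: lin_map_def)

lemma lin_map_comp:
  "lin_map k V W f \<Longrightarrow> lin_map k W N g \<Longrightarrow> lin_map k V N (\<lambda>x. g (f x))"
  by (auto simp: lin_map_def Pi_def)

lemma LinI: "f \<in> extensional (carrier V) \<Longrightarrow> lin_map k V W f \<Longrightarrow> f \<in> Lin k V W"
  by (simp add: Lin_def)

lemma Lin_lin_map: "f \<in> Lin k V W \<Longrightarrow> lin_map k V W f"
  by (simp add: Lin_def)

lemma Lin_restrict:
  assumes "module k V" "lin_map k V W f" shows "restrict f (carrier V) \<in> Lin k V W"
  using assms lin_map_cong[of k V "restrict f (carrier V)" f W] by (simp add: Lin_def)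

lemma Lin_eqI:
  assumes "f \<in> Lin k V W" "g \<in> Lin k V W'" "\<And>x. x \<in> carrier V \<Longrightarrow> f x = g x"
  shows "f = g"
  using assms unfolding Lin_def by (auto intro: extensionalityI)

lemma lin_map_zero:
  assumes "module k V" "module k W" "lin_map k V W f" shows "f \<zero>\<^bsub>V\<^esub> = \<zero>\<^bsub>W\<^esub>"
proof -
  interpret V: module k V by fact
  interpret W: module k W by fact
  have "f (\<zero>\<^bsub>k\<^esub> \<odot>\<^bsub>V\<^esub> \<zero>\<^bsub>V\<^esub>) = \<zero>\<^bsub>k\<^esub> \<odot>\<^bsub>W\<^esub> f \<zero>\<^bsub>V\<^esub>"
    by (rule lin_map_smult[OF assms(3)]) auto
  then show ?thesis
    using lin_map_closed[OF assms(3)] by simp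
qed

lemma lin_map_neg:
  assumes "module k V" "module k W" "lin_map k V W f" "x \<in> carrier V"
  shows "f (\<ominus>\<^bsub>V\<^esub> x) = \<ominus>\<^bsub>W\<^esub> f x"
proof -
  interpret V: module k V by fact
  interpret W: module k W by fact
  have "f (\<ominus>\<^bsub>V\<^esub> x) \<oplus>\<^bsub>W\<^esub> f x = \<zero>\<^bsub>W\<^esub>"
    using assms lin_map_add[OF assms(3), of "\<ominus>\<^bsub>V\<^esub> x" x] lin_map_zero[OF assms(1-3)]
    by (simp add: V.l_neg)
  then show ?thesis
    using lin_map_closed[OF assms(3)] assms(4) W.minus_equality by simp
qed

lemma lin_map_minus:
  assumes "module k V" "module k W" "lin_map k V W f" "x \<in> carrier V" "y \<in> carrier V"
  shows "f (x \<ominus>\<^bsub>V\<^esub> y) = f x \<ominus>\<^bsub>W\<^esub> f y"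
proof -
  interpret V: module k V by fact
  show ?thesis
    using assms by (simp add: a_minus_def lin_map_add[OF assms(3)] lin_map_neg[OF assms(1-3)])
qed

lemma lin_map_finsum:
  assumes "module k V" "module k W" "lin_map k V W f" "finite A" "g \<in> A \<rightarrow> carrier V"
  shows "f (\<Oplus>\<^bsub>V\<^esub>i\<in>A. g i) = (\<Oplus>\<^bsub>W\<^esub>i\<in>A. f (g i))"
proof -
  interpret V: module k V by fact
  interpret W: module k W by fact
  show ?thesis
    using assms(4,5)
  proof (induction A rule: finite_induct)
    case empty
    then show ?case using lin_map_zero[OF assms(1-3)] by simp
  next
    case (insert x A)
    then have "(\<lambda>i. f (g i)) \<in> A \<rightarrow> carrier W" "f (g x) \<in> carrier W"
      using lin_map_closed[OF assms(3)] by auto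
    with insert show ?case
      by (simp add: lin_map_add[OF assms(3)])
  qed
qed

text \<open>Submodules need no separate closure under negatives, as \<open>\<ominus> x = (\<ominus> \<one>) \<odot> x\<close>.\<close>

lemma (in module) submodule_criterion:
  assumes "U \<subseteq> carrier M" "\<zero>\<^bsub>M\<^esub> \<in> U" "\<And>x y. x \<in> U \<Longrightarrow> y \<in> U \<Longrightarrow> x \<oplus>\<^bsub>M\<^esub> y \<in> U"
    and smult: "\<And>c x. c \<in> carrier R \<Longrightarrow> x \<in> U \<Longrightarrow> c \<odot>\<^bsub>M\<^esub> x \<in> U"
  shows "submodule U R M"
proof (rule submoduleI)
  fix x assume x: "x \<in> U"
  then have "\<ominus>\<^bsub>M\<^esub> x = (\<ominus> \<one>) \<odot>\<^bsub>M\<^esub> x"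
    using assms(1) by (subst smult_l_minus) auto
  also have "\<dots> \<in> U" by (rule smult[OF _ x]) auto
  finally show "\<ominus>\<^bsub>M\<^esub> x \<in> U" .
qed (use assms in auto)

text \<open>\<open>End_algebra\<close>, \<open>Apar\<close>, \<open>AHom\<close>,
  \<open>Hom_H\<close> and \<open>dilation\<close> are records obtained from another module by
  changing the carrier, the product or the action. The module laws mention only the four fields
  compared here, so they transfer.\<close>

lemma module_cong:
  assumes "module k M" "carrier N = carrier M" "add N = add M" "zero N = zero M"
    "smult N = smult M"
  shows "module k N"
proof -
  interpret module k M by fact
  show ?thesis
  proof (rule moduleI)
    show "abelian_group N"
      by (rule abelian_groupI)
        (auto simp: assms(2-) M.add.m_ac intro: M.l_neg M.a_inv_closed)
  qed (use assms(2-) in \<open>auto simp: R.is_cring smult_l_distr smult_r_distr smult_assoc1\<close>)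
qed


section \<open>Quotients\<close>

lemma quotient_simps:
  "carrier (quotient F U) = a_rcosets\<^bsub>F\<^esub> U"
  "mult (quotient F U) = rcoset_mult F U"
  "one (quotient F U) = U +>\<^bsub>F\<^esub> \<one>\<^bsub>F\<^esub>"
  "zero (quotient F U) = U"
  "add (quotient F U) = set_add F"
  "smult (quotient F U) = (\<lambda>c X. \<Union>x\<in>X. U +>\<^bsub>F\<^esub> (c \<odot>\<^bsub>F\<^esub> x))"
  by (simp_all add: quotient_def FactRing_def)

locale module_quotient = module k F for k (structure) and F (structure) +
  fixes U
  assumes submodule: "submodule U k F"
begin

abbreviation "Q \<equiv> quotient F U"

sublocale abelian_subgroup U F
  by (intro abelian_subgroupI3 additive_subgroup.intro M.abelian_group_axioms
      submodule.axioms(1)[OF submodule])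

lemma coset_closed: "x \<in> carrier F \<Longrightarrow> U +>\<^bsub>F\<^esub> x \<in> carrier Q"
  by (auto simp: quotient_simps A_RCOSETS_def')

lemma cosetE:
  assumes "X \<in> carrier Q" obtains x where "x \<in> carrier F" "X = U +>\<^bsub>F\<^esub> x"
  using assms by (auto simp: quotient_simps A_RCOSETS_def')

lemma coset_eq_iff:
  assumes "x \<in> carrier F" "y \<in> carrier F"
  shows "U +>\<^bsub>F\<^esub> x = U +>\<^bsub>F\<^esub> y \<longleftrightarrow> x \<ominus>\<^bsub>F\<^esub> y \<in> U"
proof -
  have "U +>\<^bsub>F\<^esub> x = U +>\<^bsub>F\<^esub> y \<longleftrightarrow> x \<in> U +>\<^bsub>F\<^esub> y"
    using assms a_repr_independence' a_repr_independenceD by metis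
  then show ?thesis
    using assms by (simp add: a_rcos_module a_minus_def)
qed

lemma coset_zero: "U +>\<^bsub>F\<^esub> \<zero>\<^bsub>F\<^esub> = \<zero>\<^bsub>Q\<^esub>"
  by (simp add: quotient_simps a_rcos_const)

lemma coset_add:
  "x \<in> carrier F \<Longrightarrow> y \<in> carrier F \<Longrightarrow> (U +>\<^bsub>F\<^esub> x) \<oplus>\<^bsub>Q\<^esub> (U +>\<^bsub>F\<^esub> y) = U +>\<^bsub>F\<^esub> (x \<oplus>\<^bsub>F\<^esub> y)"
  by (simp add: quotient_simps a_rcos_sum)

text \<open>The definition takes a union over all members of the coset. Two members differ by an
  element of \<open>U\<close>, which is closed under scalars, so all sets in the union
  coincide.\<close>

lemma coset_smult:
  assumes c: "c \<in> carrier k" and x: "x \<in> carrier F"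
  shows "c \<odot>\<^bsub>Q\<^esub> (U +>\<^bsub>F\<^esub> x) = U +>\<^bsub>F\<^esub> (c \<odot>\<^bsub>F\<^esub> x)"
proof -
  have "U +>\<^bsub>F\<^esub> (c \<odot>\<^bsub>F\<^esub> y) = U +>\<^bsub>F\<^esub> (c \<odot>\<^bsub>F\<^esub> x)" if y: "y \<in> U +>\<^bsub>F\<^esub> x" for y
  proof -
    have "y \<in> carrier F" using y x by (rule a_elemrcos_carrier[rotated])
    moreover have "c \<odot>\<^bsub>F\<^esub> (y \<oplus>\<^bsub>F\<^esub> \<ominus>\<^bsub>F\<^esub> x) \<in> U"
      using y x c by (intro submodule.smult_closed[OF submodule] a_rcos_module_imp)
    ultimately show ?thesis
      using c x by (subst coset_eq_iff) (simp_all add: a_minus_def smult_r_distr smult_r_minus)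
  qed
  moreover have "x \<in> U +>\<^bsub>F\<^esub> x" using x by (rule a_rcos_self)
  ultimately have "(\<Union>y\<in>U +>\<^bsub>F\<^esub> x. U +>\<^bsub>F\<^esub> (c \<odot>\<^bsub>F\<^esub> y)) = U +>\<^bsub>F\<^esub> (c \<odot>\<^bsub>F\<^esub> x)"
    by blast
  then show ?thesis by (simp only: quotient_simps)
qed

lemma quotient_module: "module k Q"
proof (rule moduleI)
  show "abelian_group Q"
  proof (rule abelian_groupI)
    fix X assume "X \<in> carrier Q"
    then obtain x where x: "x \<in> carrier F" "X = U +>\<^bsub>F\<^esub> x" by (rule cosetE)
    then show "\<exists>Y\<in>carrier Q. Y \<oplus>\<^bsub>Q\<^esub> X = \<zero>\<^bsub>Q\<^esub>"
      by (intro bexI[of _ "U +>\<^bsub>F\<^esub> (\<ominus>\<^bsub>F\<^esub> x)"]) (auto simp: coset_add coset_closed coset_zero l_neg)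
    show "\<zero>\<^bsub>Q\<^esub> \<oplus>\<^bsub>Q\<^esub> X = X"
      using x coset_add[of "\<zero>\<^bsub>F\<^esub>" x] by (simp add: coset_zero)
    fix Y assume "Y \<in> carrier Q"
    then obtain y where y: "y \<in> carrier F" "Y = U +>\<^bsub>F\<^esub> y" by (rule cosetE)
    show "X \<oplus>\<^bsub>Q\<^esub> Y \<in> carrier Q" "X \<oplus>\<^bsub>Q\<^esub> Y = Y \<oplus>\<^bsub>Q\<^esub> X"
      using x y by (simp_all add: coset_add coset_closed M.a_comm)
    fix Z assume "Z \<in> carrier Q"
    then obtain z where z: "z \<in> carrier F" "Z = U +>\<^bsub>F\<^esub> z" by (rule cosetE)
    show "X \<oplus>\<^bsub>Q\<^esub> Y \<oplus>\<^bsub>Q\<^esub> Z = X \<oplus>\<^bsub>Q\<^esub> (Y \<oplus>\<^bsub>Q\<^esub> Z)"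
      using x y z by (simp add: coset_add M.a_assoc)
  next
    show "\<zero>\<^bsub>Q\<^esub> \<in> carrier Q"
      using coset_closed[of "\<zero>\<^bsub>F\<^esub>"] by (simp add: coset_zero)
  qed
next
  fix X assume "X \<in> carrier Q"
  then obtain x where x: "x \<in> carrier F" "X = U +>\<^bsub>F\<^esub> x" by (rule cosetE)
  then show "\<one>\<^bsub>k\<^esub> \<odot>\<^bsub>Q\<^esub> X = X" by (simp add: coset_smult)
  fix a assume a: "a \<in> carrier k"
  then show "a \<odot>\<^bsub>Q\<^esub> X \<in> carrier Q" using x by (simp add: coset_smult coset_closed)
  {
    fix Y assume "Y \<in> carrier Q"
    then obtain y where "y \<in> carrier F" "Y = U +>\<^bsub>F\<^esub> y" by (rule cosetE)
    then show "a \<odot>\<^bsub>Q\<^esub> (X \<oplus>\<^bsub>Q\<^esub> Y) = a \<odot>\<^bsub>Q\<^esub> X \<oplus>\<^bsub>Q\<^esub> a \<odot>\<^bsub>Q\<^esub> Y"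
      using a x by (simp add: coset_smult coset_add smult_r_distr)
  }
  fix b assume "b \<in> carrier k"
  then show "(a \<oplus>\<^bsub>k\<^esub> b) \<odot>\<^bsub>Q\<^esub> X = a \<odot>\<^bsub>Q\<^esub> X \<oplus>\<^bsub>Q\<^esub> b \<odot>\<^bsub>Q\<^esub> X"
    "(a \<otimes>\<^bsub>k\<^esub> b) \<odot>\<^bsub>Q\<^esub> X = a \<odot>\<^bsub>Q\<^esub> (b \<odot>\<^bsub>Q\<^esub> X)"
    using a x by (simp_all add: coset_smult coset_add smult_l_distr smult_assoc1)
qed (rule R.is_cring)

lemma coset_lin_map: "lin_map k F Q (\<lambda>x. U +>\<^bsub>F\<^esub> x)"
  by (rule lin_mapI) (auto simp: coset_closed coset_add coset_smult)

lemma quotient_lift: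
  assumes "module k N" "lin_map k F N f" and vanish: "\<And>u. u \<in> U \<Longrightarrow> f u = \<zero>\<^bsub>N\<^esub>"
  obtains g where "g \<in> Lin k Q N" "\<And>x. x \<in> carrier F \<Longrightarrow> g (U +>\<^bsub>F\<^esub> x) = f x"
proof -
  interpret N: module k N by fact
  \<comment> \<open>A representative is chosen in each coset; since \<open>f\<close> kills
    \<open>U\<close>, the choice does not affect the value. The restriction makes \<open>g\<close>
    extensional, as \<open>Lin\<close> demands.\<close>
  define g where "g = (\<lambda>X\<in>carrier Q. f (SOME x. x \<in> carrier F \<and> X = U +>\<^bsub>F\<^esub> x))"
  have g: "g (U +>\<^bsub>F\<^esub> x) = f x" if x: "x \<in> carrier F" for x
  proof -
    define y where "y = (SOME y. y \<in> carrier F \<and> U +>\<^bsub>F\<^esub> x = U +>\<^bsub>F\<^esub> y)"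
    have y: "y \<in> carrier F \<and> U +>\<^bsub>F\<^esub> x = U +>\<^bsub>F\<^esub> y"
      unfolding y_def by (rule someI[of _ x]) (simp add: x)
    then have "f (x \<ominus>\<^bsub>F\<^esub> y) = \<zero>\<^bsub>N\<^esub>"
      using x coset_eq_iff vanish by auto
    then have "f x = f y"
      using x y lin_map_minus[OF module_axioms assms(1,2)] lin_map_closed[OF assms(2)]
      by (simp add: N.add.inv_solve_right' a_minus_def)
    then show ?thesis using x by (simp add: g_def y_def coset_closed)
  qed
  moreover have "g \<in> Lin k Q N"
  proof (rule LinI)
    show "lin_map k Q N g"
    proof (rule lin_mapI)
      fix X assume "X \<in> carrier Q"
      then obtain x where x: "x \<in> carrier F" "X = U +>\<^bsub>F\<^esub> x" by (rule cosetE)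
      then show "g X \<in> carrier N" by (simp add: g lin_map_closed[OF assms(2)])
      show "g (c \<odot>\<^bsub>Q\<^esub> X) = c \<odot>\<^bsub>N\<^esub> g X" if "c \<in> carrier k" for c
        using that x by (simp add: g coset_smult lin_map_smult[OF assms(2)])
      fix Y assume "Y \<in> carrier Q"
      then obtain y where "y \<in> carrier F" "Y = U +>\<^bsub>F\<^esub> y" by (rule cosetE)
      then show "g (X \<oplus>\<^bsub>Q\<^esub> Y) = g X \<oplus>\<^bsub>N\<^esub> g Y"
        using x by (simp add: g coset_add lin_map_add[OF assms(2)])
    qed
  qed (simp add: g_def)
  ultimately show ?thesis using that by blast
qed

lemma quotient_lin_eqI:
  assumes "\<And>x. x \<in> carrier F \<Longrightarrow> f (U +>\<^bsub>F\<^esub> x) = g (U +>\<^bsub>F\<^esub> x)" "X \<in> carrier Q"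
  shows "f X = g X"
  by (rule cosetE[OF assms(2)]) (simp add: assms(1))

end

lemma (in module) submodule_generated_submodule:
  assumes "X \<subseteq> carrier M" shows "submodule (submodule_generated R M X) R M"
proof (rule submodule_criterion)
  show "submodule_generated R M X \<subseteq> carrier M"
    using carrier_is_submodule assms by (auto simp: submodule_generated_def)
  show "\<zero>\<^bsub>M\<^esub> \<in> submodule_generated R M X"
    using subgroup.one_closed[OF submodule.axioms(1)] by (force simp: submodule_generated_def)
qed (simp_all add: submodule_generated_def submoduleE(4,5))

lemma submodule_generated_incl: "X \<subseteq> submodule_generated R M X"
  by (auto simp: submodule_generated_def)

lemma submodule_generated_minimal:
  "submodule U R M \<Longrightarrow> X \<subseteq> U \<Longrightarrow> submodule_generated R M X \<subseteq> U"
  by (auto simp: submodule_generated_def)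

text \<open>Serves to pass from relations to the submodule they generate: a linear map that kills
  the relations has a kernel among the submodules that are intersected.\<close>

lemma kernel_submodule:
  assumes "module k V" "module k W" "lin_map k V W f"
  shows "submodule {v \<in> carrier V. f v = \<zero>\<^bsub>W\<^esub>} k V"
proof -
  interpret V: module k V by fact
  interpret W: module k W by fact
  show ?thesis
    by (rule V.submodule_criterion)
      (auto simp: lin_map_zero[OF assms] lin_map_add[OF assms(3)] lin_map_smult[OF assms(3)])
qed


section \<open>Free modules\<close>

lemma free_module_simps:
  "carrier (free_module k X) =
    {f. (\<forall>x\<in>X. f x \<in> carrier k) \<and> (\<forall>x. x \<notin> X \<longrightarrow> f x = \<zero>\<^bsub>k\<^esub>) \<and> finite {x. f x \<noteq> \<zero>\<^bsub>k\<^esub>}}"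
  "zero (free_module k X) = (\<lambda>_. \<zero>\<^bsub>k\<^esub>)"
  "add (free_module k X) = (\<lambda>f g x. f x \<oplus>\<^bsub>k\<^esub> g x)"
  "smult (free_module k X) = (\<lambda>c f x. c \<otimes>\<^bsub>k\<^esub> f x)"
  by (simp_all add: free_module_def)

context cring
begin

lemma free_module_value_closed: "p \<in> carrier (free_module R X) \<Longrightarrow> p x \<in> carrier R"
  by (cases "x \<in> X") (auto simp: free_module_simps)

lemma free_module_closedI:
  assumes "\<And>x. p x \<in> carrier R" "finite A" "A \<subseteq> X" "\<And>x. x \<notin> A \<Longrightarrow> p x = \<zero>"
  shows "p \<in> carrier (free_module R X)"
proof -
  have "{x. p x \<noteq> \<zero>} \<subseteq> A" using assms(4) by auto
  then have "finite {x. p x \<noteq> \<zero>}" using assms(2) by (rule finite_subset)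
  moreover have "\<forall>x. x \<notin> X \<longrightarrow> p x = \<zero>" using assms(3,4) by blast
  ultimately show ?thesis
    using assms(1) by (simp add: free_module_simps)
qed

lemma free_module_supportE:
  assumes "p \<in> carrier (free_module R X)"
  obtains A where "finite A" "A \<subseteq> X" "\<And>x. x \<notin> A \<Longrightarrow> p x = \<zero>"
  using assms by (intro that[of "{x. p x \<noteq> \<zero>}"]) (auto simp: free_module_simps)

lemma free_module_module: "module R (free_module R X)"
proof (rule moduleI)
  show "abelian_group (free_module R X)"
  proof (rule abelian_groupI)
    fix p assume p: "p \<in> carrier (free_module R X)"
    note pc = free_module_value_closed[OF p]
    obtain A where A: "finite A" "A \<subseteq> X" "\<And>x. x \<notin> A \<Longrightarrow> p x = \<zero>"
      using p by (rule free_module_supportE) blast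
    show "\<zero>\<^bsub>free_module R X\<^esub> \<oplus>\<^bsub>free_module R X\<^esub> p = p"
      using pc by (simp add: free_module_simps(2-))
    show "\<exists>q\<in>carrier (free_module R X). q \<oplus>\<^bsub>free_module R X\<^esub> p = \<zero>\<^bsub>free_module R X\<^esub>"
      using A pc
      by (intro bexI[of _ "\<lambda>x. \<ominus> p x"] free_module_closedI[where A = A])
        (auto simp: free_module_simps(2-) l_neg)
    fix q assume q: "q \<in> carrier (free_module R X)"
    note qc = free_module_value_closed[OF q]
    obtain B where B: "finite B" "B \<subseteq> X" "\<And>x. x \<notin> B \<Longrightarrow> q x = \<zero>"
      using q by (rule free_module_supportE) blast
    show "p \<oplus>\<^bsub>free_module R X\<^esub> q \<in> carrier (free_module R X)"
      unfolding free_module_simps(3)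
      using A B pc qc by (intro free_module_closedI[where A = "A \<union> B"]) auto
    show "p \<oplus>\<^bsub>free_module R X\<^esub> q = q \<oplus>\<^bsub>free_module R X\<^esub> p"
      using pc qc by (simp add: free_module_simps(3) a_comm)
    fix r assume "r \<in> carrier (free_module R X)"
    from free_module_value_closed[OF this]
    show "p \<oplus>\<^bsub>free_module R X\<^esub> q \<oplus>\<^bsub>free_module R X\<^esub> r =
        p \<oplus>\<^bsub>free_module R X\<^esub> (q \<oplus>\<^bsub>free_module R X\<^esub> r)"
      using pc qc by (simp add: free_module_simps(3) a_assoc)
  qed (auto simp: free_module_simps)
next
  fix p assume p: "p \<in> carrier (free_module R X)"
  note pc = free_module_value_closed[OF p]
  show "\<one> \<odot>\<^bsub>free_module R X\<^esub> p = p"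
    using pc by (simp add: free_module_simps(4))
  obtain A where A: "finite A" "A \<subseteq> X" "\<And>x. x \<notin> A \<Longrightarrow> p x = \<zero>"
    using p by (rule free_module_supportE) blast
  fix a assume a: "a \<in> carrier R"
  then show "a \<odot>\<^bsub>free_module R X\<^esub> p \<in> carrier (free_module R X)"
    unfolding free_module_simps(4) using A pc by (intro free_module_closedI[where A = A]) auto
  {
    fix q assume "q \<in> carrier (free_module R X)"
    from free_module_value_closed[OF this]
    show "a \<odot>\<^bsub>free_module R X\<^esub> (p \<oplus>\<^bsub>free_module R X\<^esub> q) =
        a \<odot>\<^bsub>free_module R X\<^esub> p \<oplus>\<^bsub>free_module R X\<^esub> a \<odot>\<^bsub>free_module R X\<^esub> q"
      using a pc by (simp add: free_module_simps(3,4) r_distr)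
  }
  fix b assume "b \<in> carrier R"
  then show "(a \<oplus> b) \<odot>\<^bsub>free_module R X\<^esub> p =
        a \<odot>\<^bsub>free_module R X\<^esub> p \<oplus>\<^bsub>free_module R X\<^esub> b \<odot>\<^bsub>free_module R X\<^esub> p"
    "(a \<otimes> b) \<odot>\<^bsub>free_module R X\<^esub> p = a \<odot>\<^bsub>free_module R X\<^esub> (b \<odot>\<^bsub>free_module R X\<^esub> p)"
    using a pc by (simp_all add: free_module_simps(3,4) l_distr m_assoc)
qed (rule is_cring)

lemma free_gen_closed: "x \<in> X \<Longrightarrow> free_gen R x \<in> carrier (free_module R X)"
  by (rule free_module_closedI[where A = "{x}"]) (auto simp: free_gen_def)

text \<open>Induction on a finite set outside which \<open>p\<close> vanishes, clearing the value at
  one point at a time. The set may be larger than the support, so the coefficient split off may be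
  zero.\<close>

lemma free_module_induct [consumes 1, case_names zero step]:
  assumes p: "p \<in> carrier (free_module R X)"
    and zero: "P \<zero>\<^bsub>free_module R X\<^esub>"
    and step: "\<And>c x q. c \<in> carrier R \<Longrightarrow> x \<in> X \<Longrightarrow> q \<in> carrier (free_module R X) \<Longrightarrow> P q \<Longrightarrow>
      P (c \<odot>\<^bsub>free_module R X\<^esub> free_gen R x \<oplus>\<^bsub>free_module R X\<^esub> q)"
  shows "P p"
proof -
  have "P p" if "finite A" "A \<subseteq> X" "\<And>x. p x \<in> carrier R" "\<And>x. x \<notin> A \<Longrightarrow> p x = \<zero>" for A p
    using that
  proof (induction A arbitrary: p rule: finite_induct)
    case empty
    then have "p = \<zero>\<^bsub>free_module R X\<^esub>" by (auto simp: free_module_simps(2))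
    with zero show ?case by simp
  next
    case (insert x A)
    define q where "q = p(x := \<zero>)"
    have "P q"
      using insert.prems by (intro insert.IH) (auto simp: q_def)
    moreover have "q \<in> carrier (free_module R X)"
      using insert.prems insert.hyps by (intro free_module_closedI[where A = A]) (auto simp: q_def)
    ultimately have "P (p x \<odot>\<^bsub>free_module R X\<^esub> free_gen R x \<oplus>\<^bsub>free_module R X\<^esub> q)"
      using insert.prems by (intro step) auto
    also have "p x \<odot>\<^bsub>free_module R X\<^esub> free_gen R x \<oplus>\<^bsub>free_module R X\<^esub> q = p"
      using insert.prems by (auto simp: free_module_simps(3,4) q_def free_gen_def fun_eq_iff)
    finally show ?case .
  qed
  then show ?thesis
    using p free_module_value_closed[OF p] by (metis free_module_supportE)
qed

lemma free_module_lin_eq: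
  assumes "module R N" "lin_map R (free_module R X) N f" "lin_map R (free_module R X) N g"
    and gen: "\<And>x. x \<in> X \<Longrightarrow> f (free_gen R x) = g (free_gen R x)"
    and p: "p \<in> carrier (free_module R X)"
  shows "f p = g p"
  using p
proof (induction rule: free_module_induct)
  case zero
  show ?case
    using lin_map_zero[OF free_module_module assms(1,2)] lin_map_zero[OF free_module_module assms(1,3)]
    by simp
next
  case (step c x q)
  interpret F: module R "free_module R X" by (rule free_module_module)
  show ?case
    using step by (simp add: gen free_gen_closed lin_map_add[OF assms(2)] lin_map_smult[OF assms(2)]
        lin_map_add[OF assms(3)] lin_map_smult[OF assms(3)])
qed

end

definition free_extend ::
  "('k, 'y) ring_scheme \<Rightarrow> ('k, 'n, 'c) module_scheme \<Rightarrow> ('x \<Rightarrow> 'n) \<Rightarrow> ('x \<Rightarrow> 'k) \<Rightarrow> 'n"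
  where "free_extend k N f p = (\<Oplus>\<^bsub>N\<^esub>x\<in>{x. p x \<noteq> \<zero>\<^bsub>k\<^esub>}. p x \<odot>\<^bsub>N\<^esub> f x)"

context module
begin

text \<open>Allows the support to be replaced by any larger finite index set, so that
  \<open>p\<close>, \<open>q\<close> and their sum can be expanded over a common one.\<close>

lemma free_extend_eq:
  assumes "p \<in> carrier (free_module R X)" "f \<in> X \<rightarrow> carrier M"
    and "finite A" "A \<subseteq> X" "\<And>x. x \<notin> A \<Longrightarrow> p x = \<zero>"
  shows "free_extend R M f p = (\<Oplus>\<^bsub>M\<^esub>x\<in>A. p x \<odot>\<^bsub>M\<^esub> f x)"
  unfolding free_extend_def
  using assms by (intro M.add.finprod_mono_neutral_cong_left)
    (auto simp: Pi_iff subset_iff intro!: smult_l_null smult_closed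
      intro: free_module_value_closed[OF assms(1)])

lemma free_extend_lin_map:
  assumes f: "f \<in> X \<rightarrow> carrier M"
  shows "lin_map R (free_module R X) M (free_extend R M f)"
proof (rule lin_mapI)
  interpret F: module R "free_module R X" by (rule free_module_module)
  fix p assume p: "p \<in> carrier (free_module R X)"
  note pc = free_module_value_closed[OF p]
  obtain A where A: "finite A" "A \<subseteq> X" "\<And>x. x \<notin> A \<Longrightarrow> p x = \<zero>"
    using p by (rule free_module_supportE) blast
  have pf: "p x \<odot>\<^bsub>M\<^esub> f x \<in> carrier M" if "x \<in> A" for x
    using that A(2) f pc by (intro smult_closed) (auto simp: Pi_iff)
  note ep = free_extend_eq[OF p f A]
  show "free_extend R M f p \<in> carrier M"
    using pf by (simp add: ep)
  show "free_extend R M f (c \<odot>\<^bsub>free_module R X\<^esub> p) = c \<odot>\<^bsub>M\<^esub> free_extend R M f p"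
    if c: "c \<in> carrier R" for c
  proof -
    have "free_extend R M f (c \<odot>\<^bsub>free_module R X\<^esub> p) =
        (\<Oplus>\<^bsub>M\<^esub>x\<in>A. (c \<odot>\<^bsub>free_module R X\<^esub> p) x \<odot>\<^bsub>M\<^esub> f x)"
      using F.smult_closed[OF c p] c A f by (intro free_extend_eq) (auto simp: free_module_simps(4))
    also have "\<dots> = (\<Oplus>\<^bsub>M\<^esub>x\<in>A. c \<odot>\<^bsub>M\<^esub> (p x \<odot>\<^bsub>M\<^esub> f x))"
      using c pc A f by (intro M.finsum_cong') (auto simp: free_module_simps(4) smult_assoc1 Pi_def subset_iff)
    finally show ?thesis
      using c pf A by (simp add: ep finsum_smult_ldistr)
  qed
  fix q assume q: "q \<in> carrier (free_module R X)"
  note qc = free_module_value_closed[OF q]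
  obtain B where B: "finite B" "B \<subseteq> X" "\<And>x. x \<notin> B \<Longrightarrow> q x = \<zero>"
    using q by (rule free_module_supportE) blast
  have e: "free_extend R M f r = (\<Oplus>\<^bsub>M\<^esub>x\<in>A \<union> B. r x \<odot>\<^bsub>M\<^esub> f x)"
    if "r \<in> carrier (free_module R X)" "\<And>x. x \<notin> A \<union> B \<Longrightarrow> r x = \<zero>" for r
    using that A B f by (intro free_extend_eq) auto
  have fc: "f x \<in> carrier M" if "x \<in> A \<union> B" for x
    using that A B f by auto
  have "free_extend R M f (p \<oplus>\<^bsub>free_module R X\<^esub> q) =
      (\<Oplus>\<^bsub>M\<^esub>x\<in>A \<union> B. (p \<oplus>\<^bsub>free_module R X\<^esub> q) x \<odot>\<^bsub>M\<^esub> f x)"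
    using F.M.a_closed[OF p q] A B by (intro e) (auto simp: free_module_simps(3))
  also have "\<dots> = (\<Oplus>\<^bsub>M\<^esub>x\<in>A \<union> B. p x \<odot>\<^bsub>M\<^esub> f x \<oplus>\<^bsub>M\<^esub> q x \<odot>\<^bsub>M\<^esub> f x)"
    using pc qc fc by (intro M.finsum_cong') (auto simp: free_module_simps(3) smult_l_distr)
  also have "\<dots> = free_extend R M f p \<oplus>\<^bsub>M\<^esub> free_extend R M f q"
    using p q pc qc fc A B by (subst (1 2) e) (auto intro!: M.finsum_addf)
  finally show "free_extend R M f (p \<oplus>\<^bsub>free_module R X\<^esub> q) =
      free_extend R M f p \<oplus>\<^bsub>M\<^esub> free_extend R M f q" .
qed

lemma free_extend_gen:
  assumes "f \<in> X \<rightarrow> carrier M" "x \<in> X"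
  shows "free_extend R M f (free_gen R x) = f x"
proof -
  have "f x \<in> carrier M" using assms by auto
  moreover have "free_extend R M f (free_gen R x) = (\<Oplus>\<^bsub>M\<^esub>y\<in>{x}. free_gen R x y \<odot>\<^bsub>M\<^esub> f y)"
    using assms by (intro free_extend_eq free_gen_closed) (auto simp: free_gen_def)
  ultimately show ?thesis by (simp add: free_gen_def)
qed

end


section \<open>Tensor products\<close>

definition bilin ::
  "('k, 'y) ring_scheme \<Rightarrow> ('k, 'v, 'a) module_scheme \<Rightarrow> ('k, 'w, 'b) module_scheme
    \<Rightarrow> ('k, 'n, 'c) module_scheme \<Rightarrow> ('v \<Rightarrow> 'w \<Rightarrow> 'n) \<Rightarrow> bool"
  where "bilin k V W N f \<longleftrightarrow>
    (\<forall>v\<in>carrier V. lin_map k W N (f v)) \<and> (\<forall>w\<in>carrier W. lin_map k V N (\<lambda>v. f v w))"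

lemma bilinI:
  assumes "\<And>v. v \<in> carrier V \<Longrightarrow> lin_map k W N (\<lambda>w. f v w)"
    and "\<And>w. w \<in> carrier W \<Longrightarrow> lin_map k V N (\<lambda>v. f v w)"
  shows "bilin k V W N (\<lambda>v w. f v w)"
  using assms by (simp add: bilin_def)

lemma bilin_right: "bilin k V W N f \<Longrightarrow> v \<in> carrier V \<Longrightarrow> lin_map k W N (f v)"
  by (simp add: bilin_def)

lemma bilin_left: "bilin k V W N f \<Longrightarrow> w \<in> carrier W \<Longrightarrow> lin_map k V N (\<lambda>v. f v w)"
  by (simp add: bilin_def)

lemma bilin_closed:
  "bilin k V W N f \<Longrightarrow> v \<in> carrier V \<Longrightarrow> w \<in> carrier W \<Longrightarrow> f v w \<in> carrier N"
  by (rule lin_map_closed[OF bilin_right])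

lemma bilin_comp: "bilin k V W N f \<Longrightarrow> lin_map k N P g \<Longrightarrow> bilin k V W P (\<lambda>v w. g (f v w))"
  unfolding bilin_def by (auto intro: lin_map_comp)

locale tensor_product = V: module k V + W: module k W
  for k :: "('k, 'y) ring_scheme" and V :: "('k, 'v, 'a) module_scheme"
    and W :: "('k, 'w, 'b) module_scheme"
begin

abbreviation "F \<equiv> free_module k (carrier V \<times> carrier W)"
abbreviation "T \<equiv> tensor k V W"
abbreviation "rels \<equiv> tensor_relations k V W"

lemma F_module: "module k F"
  by (rule V.free_module_module)

lemma gen_closed: "v \<in> carrier V \<Longrightarrow> w \<in> carrier W \<Longrightarrow> free_gen k (v, w) \<in> carrier F"
  by (rule V.free_gen_closed) simp

lemma rels_closed: "rels \<subseteq> carrier F"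
proof -
  interpret F: module k F by (rule F_module)
  show ?thesis
    unfolding tensor_relations_def Let_def
    by (auto intro!: F.M.minus_closed F.M.a_closed F.smult_closed gen_closed
        V.M.a_closed W.M.a_closed V.smult_closed W.smult_closed)
qed

sublocale quot: module_quotient k F "submodule_generated k F rels"
  by (intro module_quotient.intro F_module module_quotient_axioms.intro
      module.submodule_generated_submodule rels_closed)

lemma tensor_eq_quotient: "T = quotient F (submodule_generated k F rels)"
  by (simp only: tensor_def Let_def)

lemma tensor_module: "module k T"
  unfolding tensor_eq_quotient by (rule quot.quotient_module)

lemma tens_eq: "tens k V W v w = submodule_generated k F rels +>\<^bsub>F\<^esub> free_gen k (v, w)"
  by (simp only: tens_def Let_def)

lemma tens_closed: "v \<in> carrier V \<Longrightarrow> w \<in> carrier W \<Longrightarrow> tens k V W v w \<in> carrier T"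
  unfolding tensor_eq_quotient tens_eq by (intro quot.coset_closed gen_closed)

text \<open>Additivity and homogeneity in each argument correspond to the four families in
  \<open>tensor_relations\<close>; a relation x - y makes the cosets of x and y equal.\<close>

lemma tens_bilin: "bilin k V W T (tens k V W)"
proof -
  let ?U = "submodule_generated k F rels"
  have eq: "?U +>\<^bsub>F\<^esub> x = ?U +>\<^bsub>F\<^esub> y"
    if "x \<ominus>\<^bsub>F\<^esub> y \<in> rels" "x \<in> carrier F" "y \<in> carrier F" for x y
    using that(1) quot.coset_eq_iff[OF that(2,3)] subsetD[OF submodule_generated_incl[of rels k F]]
    by simp
  show ?thesis
  proof (rule bilinI; rule lin_mapI)
    fix v w assume vw: "v \<in> carrier V" "w \<in> carrier W"
    then show "tens k V W v w \<in> carrier T" "tens k V W v w \<in> carrier T" by (simp_all add: tens_closed)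
    show "tens k V W v (w \<oplus>\<^bsub>W\<^esub> w') = tens k V W v w \<oplus>\<^bsub>T\<^esub> tens k V W v w'" if "w' \<in> carrier W" for w'
      unfolding tens_eq tensor_eq_quotient quot.coset_add[OF gen_closed[OF vw] gen_closed[OF vw(1) that]]
      using vw that by (intro eq quot.M.a_closed gen_closed W.M.a_closed)
        (auto simp: tensor_relations_def Let_def)
    show "tens k V W (v \<oplus>\<^bsub>V\<^esub> v') w = tens k V W v w \<oplus>\<^bsub>T\<^esub> tens k V W v' w" if "v' \<in> carrier V" for v'
      unfolding tens_eq tensor_eq_quotient quot.coset_add[OF gen_closed[OF vw] gen_closed[OF that vw(2)]]
      using vw that by (intro eq quot.M.a_closed gen_closed V.M.a_closed)
        (auto simp: tensor_relations_def Let_def)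
    fix c assume c: "c \<in> carrier k"
    show "tens k V W v (c \<odot>\<^bsub>W\<^esub> w) = c \<odot>\<^bsub>T\<^esub> tens k V W v w"
      unfolding tens_eq tensor_eq_quotient quot.coset_smult[OF c gen_closed[OF vw]]
      using vw c by (intro eq quot.smult_closed gen_closed W.smult_closed)
        (auto simp: tensor_relations_def Let_def)
    show "tens k V W (c \<odot>\<^bsub>V\<^esub> v) w = c \<odot>\<^bsub>T\<^esub> tens k V W v w"
      unfolding tens_eq tensor_eq_quotient quot.coset_smult[OF c gen_closed[OF vw]]
      using vw c by (intro eq quot.smult_closed gen_closed V.smult_closed)
        (auto simp: tensor_relations_def Let_def)
  qed
qed

text \<open>The tensor product is an image of the free module, and pure tensors are the images of
  the free generators. Most later identities are linear in a tensor and are checked through this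
  rule.\<close>

lemma tensor_lin_eqI:
  assumes "module k N" "lin_map k T N f" "lin_map k T N g"
    and pure: "\<And>v w. v \<in> carrier V \<Longrightarrow> w \<in> carrier W \<Longrightarrow> f (tens k V W v w) = g (tens k V W v w)"
    and t: "t \<in> carrier T"
  shows "f t = g t"
proof -
  let ?p = "\<lambda>x. submodule_generated k F rels +>\<^bsub>F\<^esub> x"
  have "f (?p x) = g (?p x)" if "x \<in> carrier F" for x
  proof (rule V.free_module_lin_eq[OF assms(1) _ _ _ that])
    show "lin_map k F N (\<lambda>x. f (?p x))" "lin_map k F N (\<lambda>x. g (?p x))"
      using assms(2,3) quot.coset_lin_map unfolding tensor_eq_quotient by (auto intro: lin_map_comp)
  qed (use pure in \<open>auto simp: tens_eq\<close>)
  then show ?thesis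
    using t unfolding tensor_eq_quotient by (rule quot.quotient_lin_eqI)
qed

text \<open>Bilinearity says precisely that the free extension of \<open>f\<close> kills the
  relations, so it factors through the quotient. Uniqueness combines agreement on pure tensors with
  extensionality. This makes the description in \<open>tensor_lift\<close> definite.\<close>

lemma tensor_lift_ex1:
  assumes N: "module k N" and f: "bilin k V W N f"
  shows "\<exists>!g. g \<in> Lin k T N \<and> (\<forall>v\<in>carrier V. \<forall>w\<in>carrier W. g (tens k V W v w) = f v w)"
proof (rule ex_ex1I)
  interpret N: module k N by fact
  define h where "h = free_extend k N (\<lambda>(v, w). f v w)"
  have fc: "(\<lambda>(v, w). f v w) \<in> carrier V \<times> carrier W \<rightarrow> carrier N"
    using bilin_closed[OF f] by auto
  have h: "lin_map k F N h"
    unfolding h_def by (rule N.free_extend_lin_map[OF fc])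
  have hgen: "h (free_gen k (v, w)) = f v w" if "v \<in> carrier V" "w \<in> carrier W" for v w
    unfolding h_def using that by (subst N.free_extend_gen[OF fc]) auto
  have "rels \<subseteq> {u \<in> carrier F. h u = \<zero>\<^bsub>N\<^esub>}"
  proof -
    have "h r = \<zero>\<^bsub>N\<^esub>" if "r \<in> rels" for r
    proof -
      have [simp]: "h (x \<ominus>\<^bsub>F\<^esub> y) = \<zero>\<^bsub>N\<^esub>" if "x \<in> carrier F" "y \<in> carrier F" "h x = h y" for x y
        using that lin_map_closed[OF h]
        by (simp only: lin_map_minus[OF F_module N h]) (simp add: a_minus_def N.M.r_neg)
      show ?thesis
        using that bilin_closed[OF f]
        unfolding tensor_relations_def Let_def
        by (auto simp: gen_closed hgen lin_map_add[OF h] lin_map_smult[OF h]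
            lin_map_add[OF bilin_right[OF f]] lin_map_add[OF bilin_left[OF f]]
            lin_map_smult[OF bilin_right[OF f]] lin_map_smult[OF bilin_left[OF f]])
    qed
    then show ?thesis using rels_closed by auto
  qed
  then have "submodule_generated k F rels \<subseteq> {u \<in> carrier F. h u = \<zero>\<^bsub>N\<^esub>}"
    by (intro submodule_generated_minimal kernel_submodule[OF F_module N h])
  then obtain g where "g \<in> Lin k quot.Q N"
    "\<And>x. x \<in> carrier F \<Longrightarrow> g (submodule_generated k F rels +>\<^bsub>F\<^esub> x) = h x"
    using quot.quotient_lift[OF N h] by blast
  then show "\<exists>g. g \<in> Lin k T N \<and> (\<forall>v\<in>carrier V. \<forall>w\<in>carrier W. g (tens k V W v w) = f v w)"
    unfolding tensor_eq_quotient tens_eq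
    by (intro exI[of _ g]) (auto simp: gen_closed hgen)
next
  fix g g'
  assume g: "g \<in> Lin k T N \<and> (\<forall>v\<in>carrier V. \<forall>w\<in>carrier W. g (tens k V W v w) = f v w)"
    and g': "g' \<in> Lin k T N \<and> (\<forall>v\<in>carrier V. \<forall>w\<in>carrier W. g' (tens k V W v w) = f v w)"
  show "g = g'"
  proof (rule Lin_eqI)
    show "g t = g' t" if "t \<in> carrier T" for t
      by (rule tensor_lin_eqI[OF N _ _ _ that]) (use g g' in \<open>auto dest: Lin_lin_map\<close>)
  qed (use g g' in auto)
qed

lemma
  assumes "module k N" "bilin k V W N f"
  shows tensor_lift_Lin: "tensor_lift k V W N f \<in> Lin k T N"
    and tensor_lift_tens: "v \<in> carrier V \<Longrightarrow> w \<in> carrier W \<Longrightarrow>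
      tensor_lift k V W N f (tens k V W v w) = f v w"
  using theI'[OF tensor_lift_ex1[OF assms]] unfolding tensor_lift_def by auto

lemma tensor_decomp:
  assumes "t \<in> carrier T"
  obtains n :: nat and x y where "x \<in> {..<n} \<rightarrow> carrier V" "y \<in> {..<n} \<rightarrow> carrier W"
    "t = (\<Oplus>\<^bsub>T\<^esub>i\<in>{..<n}. tens k V W (x i) (y i))"
proof -
  interpret T: module k T by (rule tensor_module)
  let ?p = "\<lambda>x. submodule_generated k F rels +>\<^bsub>F\<^esub> x"
  let ?P = "\<lambda>t. \<exists>(n::nat) x y. x \<in> {..<n} \<rightarrow> carrier V \<and> y \<in> {..<n} \<rightarrow> carrier W \<and>
      t = (\<Oplus>\<^bsub>T\<^esub>i\<in>{..<n}. tens k V W (x i) (y i))"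
  note p = quot.coset_lin_map[folded tensor_eq_quotient]
  have "?P (?p u)" if "u \<in> carrier F" for u
    using that
  proof (induction rule: V.free_module_induct)
    case zero
    then show ?case
      by (intro exI[of _ 0]) (simp add: lin_map_zero[OF F_module tensor_module p])
  next
    case (step c vw q)
    then obtain n x y where q: "x \<in> {..<n::nat} \<rightarrow> carrier V" "y \<in> {..<n} \<rightarrow> carrier W"
      "?p q = (\<Oplus>\<^bsub>T\<^esub>i\<in>{..<n}. tens k V W (x i) (y i))" by blast
    obtain v w where vw: "vw = (v, w)" "v \<in> carrier V" "w \<in> carrier W" using step by auto
    \<comment> \<open>The coefficient is absorbed into the left factor, so that only pure tensors
      without scalars remain.\<close>
    define x' where "x' = x(n := c \<odot>\<^bsub>V\<^esub> v)"
    define y' where "y' = y(n := w)"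
    have "?p (c \<odot>\<^bsub>F\<^esub> free_gen k vw \<oplus>\<^bsub>F\<^esub> q) = c \<odot>\<^bsub>T\<^esub> tens k V W v w \<oplus>\<^bsub>T\<^esub> ?p q"
      using step vw by (simp add: gen_closed lin_map_add[OF p] lin_map_smult[OF p] tens_eq)
    also have "\<dots> = tens k V W (x' n) (y' n) \<oplus>\<^bsub>T\<^esub> (\<Oplus>\<^bsub>T\<^esub>i\<in>{..<n}. tens k V W (x' i) (y' i))"
    proof -
      have "(\<Oplus>\<^bsub>T\<^esub>i\<in>{..<n}. tens k V W (x i) (y i)) = (\<Oplus>\<^bsub>T\<^esub>i\<in>{..<n}. tens k V W (x' i) (y' i))"
        using q(1,2) by (intro T.M.finsum_cong') (auto simp: x'_def y'_def intro!: tens_closed)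
      then show ?thesis
        using step vw by (simp add: q(3) x'_def y'_def lin_map_smult[OF bilin_left[OF tens_bilin]])
    qed
    also have "\<dots> = (\<Oplus>\<^bsub>T\<^esub>i\<in>{..<Suc n}. tens k V W (x' i) (y' i))"
      unfolding lessThan_Suc using q(1,2) step(1) vw
      by (subst T.M.finsum_insert) (auto simp: x'_def y'_def intro!: tens_closed)
    finally have "?p (c \<odot>\<^bsub>F\<^esub> free_gen k vw \<oplus>\<^bsub>F\<^esub> q) =
        (\<Oplus>\<^bsub>T\<^esub>i\<in>{..<Suc n}. tens k V W (x' i) (y' i))" .
    moreover have "x' \<in> {..<Suc n} \<rightarrow> carrier V" "y' \<in> {..<Suc n} \<rightarrow> carrier W"
      using q(1,2) step(1) vw by (auto simp: x'_def y'_def less_Suc_eq)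
    ultimately show ?case by blast
  qed
  moreover obtain u where "u \<in> carrier F" "t = ?p u"
    using assms unfolding tensor_eq_quotient by (rule quot.cosetE)
  ultimately have "?P t" by simp
  then show ?thesis using that by blast
qed

end

text \<open>The condition that describes the lift quantifies only over the carriers, so it is the
  same for both functions. This permits rewriting inside a Sweedler sum under membership
  assumptions.\<close>

lemma tensor_lift_cong:
  assumes "\<And>v w. v \<in> carrier V \<Longrightarrow> w \<in> carrier W \<Longrightarrow> f v w = g v w"
  shows "tensor_lift k V W N f = tensor_lift k V W N g"
proof -
  have "(g' \<in> Lin k (tensor k V W) N \<and> (\<forall>v\<in>carrier V. \<forall>w\<in>carrier W. g' (tens k V W v w) = f v w)) =
    (g' \<in> Lin k (tensor k V W) N \<and> (\<forall>v\<in>carrier V. \<forall>w\<in>carrier W. g' (tens k V W v w) = g v w))" for g'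
    using assms by auto
  then show ?thesis by (simp add: tensor_lift_def)
qed


section \<open>Sweedler calculus\<close>

lemma lin_map_finsum_pointwise:
  assumes "module k V" "module k N" "finite A" "\<And>i. i \<in> A \<Longrightarrow> lin_map k V N (\<lambda>z. g i z)"
  shows "lin_map k V N (\<lambda>z. \<Oplus>\<^bsub>N\<^esub>i\<in>A. g i z)"
proof (rule lin_mapI)
  interpret V: module k V by fact
  interpret N: module k N by fact
  have c: "g i z \<in> carrier N" if "i \<in> A" "z \<in> carrier V" for i z
    by (rule lin_map_closed[OF assms(4)]) (use that in auto)
  fix x assume x: "x \<in> carrier V"
  then show "(\<Oplus>\<^bsub>N\<^esub>i\<in>A. g i x) \<in> carrier N" using c by (intro N.M.finsum_closed) auto
  show "(\<Oplus>\<^bsub>N\<^esub>i\<in>A. g i (x \<oplus>\<^bsub>V\<^esub> y)) = (\<Oplus>\<^bsub>N\<^esub>i\<in>A. g i x) \<oplus>\<^bsub>N\<^esub> (\<Oplus>\<^bsub>N\<^esub>i\<in>A. g i y)" if y: "y \<in> carrier V" for y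
  proof -
    have "(\<Oplus>\<^bsub>N\<^esub>i\<in>A. g i (x \<oplus>\<^bsub>V\<^esub> y)) = (\<Oplus>\<^bsub>N\<^esub>i\<in>A. g i x \<oplus>\<^bsub>N\<^esub> g i y)"
      using x y c by (intro N.M.finsum_cong') (auto intro!: lin_map_add[OF assms(4)])
    then show ?thesis using x y c by (simp add: N.M.finsum_addf Pi_def)
  qed
  show "(\<Oplus>\<^bsub>N\<^esub>i\<in>A. g i (a \<odot>\<^bsub>V\<^esub> x)) = a \<odot>\<^bsub>N\<^esub> (\<Oplus>\<^bsub>N\<^esub>i\<in>A. g i x)" if a: "a \<in> carrier k" for a
  proof -
    have "(\<Oplus>\<^bsub>N\<^esub>i\<in>A. g i (a \<odot>\<^bsub>V\<^esub> x)) = (\<Oplus>\<^bsub>N\<^esub>i\<in>A. a \<odot>\<^bsub>N\<^esub> g i x)"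
      using x a c by (intro N.M.finsum_cong') (auto intro!: lin_map_smult[OF assms(4)])
    then show ?thesis using x a c assms(3) by (simp add: N.finsum_smult_ldistr Pi_def)
  qed
qed

lemma (in tensor_product) tensor_lift_lin_map:
  assumes "module k N" "bilin k V W N f" shows "lin_map k T N (tensor_lift k V W N f)"
  by (rule Lin_lin_map[OF tensor_lift_Lin[OF assms]])

lemma (in tensor_product) tensor_lift_finsum:
  assumes N: "module k N" and f: "bilin k V W N f"
    and xy: "x \<in> {..<n::nat} \<rightarrow> carrier V" "y \<in> {..<n} \<rightarrow> carrier W"
  shows "tensor_lift k V W N f (\<Oplus>\<^bsub>T\<^esub>i\<in>{..<n}. tens k V W (x i) (y i)) = (\<Oplus>\<^bsub>N\<^esub>i\<in>{..<n}. f (x i) (y i))"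
proof -
  interpret N: module k N by fact
  have "tensor_lift k V W N f (\<Oplus>\<^bsub>T\<^esub>i\<in>{..<n}. tens k V W (x i) (y i)) =
      (\<Oplus>\<^bsub>N\<^esub>i\<in>{..<n}. tensor_lift k V W N f (tens k V W (x i) (y i)))"
    using xy by (intro lin_map_finsum[OF tensor_module N tensor_lift_lin_map[OF N f]])
      (auto intro!: tens_closed)
  also have "\<dots> = (\<Oplus>\<^bsub>N\<^esub>i\<in>{..<n}. f (x i) (y i))"
    using xy by (intro N.M.finsum_cong') (auto intro!: tensor_lift_tens[OF N f] bilin_closed[OF f])
  finally show ?thesis .
qed

text \<open>With \<open>t\<close> fixed as a finite sum of pure tensors, the lift becomes a finite
  sum of values \<open>f z (x i) (y i)\<close>, each linear in \<open>z\<close>. This is what makes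
  nested Sweedler sums multilinear.\<close>

lemma (in tensor_product) tensor_lift_parameter:
  assumes N: "module k N" and Z: "module k Z" and f: "\<And>z. z \<in> carrier Z \<Longrightarrow> bilin k V W N (\<lambda>v w. f z v w)"
    and fz: "\<And>v w. v \<in> carrier V \<Longrightarrow> w \<in> carrier W \<Longrightarrow> lin_map k Z N (\<lambda>z. f z v w)"
    and t: "t \<in> carrier T"
  shows "lin_map k Z N (\<lambda>z. tensor_lift k V W N (\<lambda>v w. f z v w) t)"
proof -
  obtain n :: nat and x y where xy: "x \<in> {..<n} \<rightarrow> carrier V" "y \<in> {..<n} \<rightarrow> carrier W"
    "t = (\<Oplus>\<^bsub>T\<^esub>i\<in>{..<n}. tens k V W (x i) (y i))"
    using t by (rule tensor_decomp)
  have "lin_map k Z N (\<lambda>z. \<Oplus>\<^bsub>N\<^esub>i\<in>{..<n}. f z (x i) (y i))"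
    using xy by (intro lin_map_finsum_pointwise Z N fz) auto
  then show ?thesis
    using xy by (subst lin_map_cong[OF Z]) (auto simp: tensor_lift_finsum[OF N f])
qed

text \<open>Both sides are linear in \<open>t\<close> and agree on pure tensors. Applied to a
  coproduct, this moves a linear map into or out of a Sweedler sum.\<close>

lemma (in tensor_product) lin_map_tensor_lift:
  assumes N: "module k N" and N': "module k N'" and f: "bilin k V W N f" and g: "lin_map k N N' g"
    and t: "t \<in> carrier T"
  shows "g (tensor_lift k V W N f t) = tensor_lift k V W N' (\<lambda>v w. g (f v w)) t"
proof (rule tensor_lin_eqI[OF N' _ _ _ t])
  show "lin_map k T N' (\<lambda>t. g (tensor_lift k V W N f t))"
    by (rule lin_map_comp[OF tensor_lift_lin_map[OF N f] g])
  show "lin_map k T N' (tensor_lift k V W N' (\<lambda>v w. g (f v w)))"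
    by (rule tensor_lift_lin_map[OF N' bilin_comp[OF f g]])
qed (simp add: tensor_lift_tens[OF N f] tensor_lift_tens[OF N' bilin_comp[OF f g]])

lemma sweedler_cong:
  assumes "\<And>x y. x \<in> carrier H \<Longrightarrow> y \<in> carrier H \<Longrightarrow> t x y = t' x y"
  shows "sweedler k H N (\<lambda>x y. t x y) h = sweedler k H N (\<lambda>x y. t' x y) h"
  unfolding sweedler_def by (intro fun_cong[OF tensor_lift_cong] assms)

lemma lin_smult:
  assumes "module k N" "lin_map k V N f" "c \<in> carrier k" shows "lin_map k V N (\<lambda>x. c \<odot>\<^bsub>N\<^esub> f x)"
proof -
  interpret N: module k N by fact
  note f = assms(2)
  show ?thesis
    using assms(3) lin_map_closed[OF f]
    by (intro lin_mapI)
      (simp_all add: lin_map_add[OF f] lin_map_smult[OF f] N.smult_r_distr N.R.m_comm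
        flip: N.smult_assoc1)
qed

context k_algebra
begin

lemma k_module: "module k A"
  by (rule module_axioms)

lemma lin_mult_left: "lin_map k V A f \<Longrightarrow> b \<in> carrier A \<Longrightarrow> lin_map k V A (\<lambda>x. f x \<otimes>\<^bsub>A\<^esub> b)"
  by (auto simp: lin_map_def Pi_def l_distr smult_mult_left)

lemma lin_mult_right: "lin_map k V A f \<Longrightarrow> b \<in> carrier A \<Longrightarrow> lin_map k V A (\<lambda>x. b \<otimes>\<^bsub>A\<^esub> f x)"
  by (auto simp: lin_map_def Pi_def r_distr smult_mult_right)

end

section \<open>Calculation rules for Sweedler sums in a Hopf algebra\<close>

context hopf_algebra
begin

abbreviation "sw N t h \<equiv> sweedler k H N t h"
abbreviation (input) mult_H (infixl "\<cdot>" 70) where "x \<cdot> y \<equiv> x \<otimes>\<^bsub>H\<^esub> y"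

sublocale HH: tensor_product k H H
  by (intro tensor_product.intro k_module)

lemma H_module: "module k H"
  by (rule k_module)

lemma HH_module: "module k (tensor k H H)"
  by (rule HH.tensor_module)

sublocale HHH: tensor_product k H "tensor k H H"
  by (intro tensor_product.intro k_module HH_module)

lemma comult_closed: "h \<in> carrier H \<Longrightarrow> comult H h \<in> carrier (tensor k H H)"
  by (rule lin_map_closed[OF comult_linear])

lemma S_closed: "h \<in> carrier H \<Longrightarrow> antipode H h \<in> carrier H"
  by (rule lin_map_closed[OF antipode_linear])

lemma counit_closed: "h \<in> carrier H \<Longrightarrow> counit H h \<in> carrier k"
  by (rule ring_hom_closed[OF counit_hom])

lemma sw_lin_map:
  assumes "module k N" "bilin k H H N t" shows "lin_map k H N (sw N t)"
  unfolding sweedler_def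
  using lin_map_comp[OF comult_linear HH.tensor_lift_lin_map[OF assms]] .

lemma sw_closed:
  assumes "module k N" "bilin k H H N t" "h \<in> carrier H" shows "sw N t h \<in> carrier N"
  by (rule lin_map_closed[OF sw_lin_map]) fact+

text \<open>A variable can occur in a Sweedler sum in two ways: in the element whose coproduct is
  taken, as here, or in the summand, as in \<open>lin_sw_parameter\<close>. The two rules together
  prove the linearity of nested sums.\<close>

lemma lin_sw_argument:
  assumes "module k N" "bilin k H H N t" "lin_map k V H f" shows "lin_map k V N (\<lambda>z. sw N t (f z))"
  by (rule lin_map_comp[OF assms(3) sw_lin_map[OF assms(1,2)]])

lemma lin_sw_parameter:
  assumes "module k N" "module k Z" "h \<in> carrier H"
    and "\<And>z. z \<in> carrier Z \<Longrightarrow> bilin k H H N (\<lambda>x y. t z x y)"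
    and "\<And>x y. x \<in> carrier H \<Longrightarrow> y \<in> carrier H \<Longrightarrow> lin_map k Z N (\<lambda>z. t z x y)"
  shows "lin_map k Z N (\<lambda>z. sw N (\<lambda>x y. t z x y) h)"
  unfolding sweedler_def
  by (intro HH.tensor_lift_parameter assms comult_closed)

lemma lin_map_sw:
  assumes "module k N" "module k N'" "lin_map k N N' g" "bilin k H H N (\<lambda>x y. t x y)" "h \<in> carrier H"
  shows "g (sw N (\<lambda>x y. t x y) h) = sw N' (\<lambda>x y. g (t x y)) h"
  unfolding sweedler_def
  by (intro HH.lin_map_tensor_lift assms comult_closed)

text \<open>Exchange of independent sums. The coproduct of \<open>h\<close> is replaced by an
  arbitrary tensor, in which both sides are linear, and then by a pure tensor, where the sum over
  \<open>h\<close> is evaluated.\<close>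

lemma sw_swap:
  assumes N: "module k N" and hl: "h \<in> carrier H" "l \<in> carrier H"
    and uv: "\<And>x y. x \<in> carrier H \<Longrightarrow> y \<in> carrier H \<Longrightarrow> bilin k H H N (\<lambda>u v. t x y u v)"
    and xy: "\<And>u v. u \<in> carrier H \<Longrightarrow> v \<in> carrier H \<Longrightarrow> bilin k H H N (\<lambda>x y. t x y u v)"
  shows "sw N (\<lambda>x y. sw N (\<lambda>u v. t x y u v) l) h = sw N (\<lambda>u v. sw N (\<lambda>x y. t x y u v) h) l"
proof -
  have xyl: "lin_map k H N (\<lambda>y. t x y u v)" "lin_map k H N (\<lambda>x. t x y u v)"
    "lin_map k H N (\<lambda>v. t x y u v)" "lin_map k H N (\<lambda>u. t x y u v)"
    if "x \<in> carrier H" "y \<in> carrier H" "u \<in> carrier H" "v \<in> carrier H" for x y u v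
    using that bilin_right[OF xy] bilin_left[OF xy] bilin_right[OF uv] bilin_left[OF uv] by auto
  have b1: "bilin k H H N (\<lambda>x y. sw N (\<lambda>u v. t x y u v) l)"
    using hl by (intro bilinI lin_sw_parameter N H_module uv xyl)
  have b2: "bilin k H H N (\<lambda>u v. tensor_lift k H H N (\<lambda>x y. t x y u v) w)"
    if "w \<in> carrier (tensor k H H)" for w
    using that by (intro bilinI HH.tensor_lift_parameter N H_module xy xyl)
  have "tensor_lift k H H N (\<lambda>x y. sw N (\<lambda>u v. t x y u v) l) w =
      sw N (\<lambda>u v. tensor_lift k H H N (\<lambda>x y. t x y u v) w) l" if w: "w \<in> carrier (tensor k H H)" for w
  proof (rule HH.tensor_lin_eqI[OF N _ _ _ w])
    show "lin_map k (tensor k H H) N (tensor_lift k H H N (\<lambda>x y. sw N (\<lambda>u v. t x y u v) l))"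
      by (rule HH.tensor_lift_lin_map[OF N b1])
    show "lin_map k (tensor k H H) N (\<lambda>w. sw N (\<lambda>u v. tensor_lift k H H N (\<lambda>x y. t x y u v) w) l)"
      using hl by (intro lin_sw_parameter N HH_module b2 HH.tensor_lift_lin_map xy)
    fix x y assume "x \<in> carrier H" "y \<in> carrier H"
    then show "tensor_lift k H H N (\<lambda>x y. sw N (\<lambda>u v. t x y u v) l) (tens k H H x y) =
        sw N (\<lambda>u v. tensor_lift k H H N (\<lambda>x y. t x y u v) (tens k H H x y)) l"
      unfolding HH.tensor_lift_tens[OF N b1 \<open>x \<in> carrier H\<close> \<open>y \<in> carrier H\<close>]
      by (intro sweedler_cong) (simp add: HH.tensor_lift_tens[OF N xy])
  qed
  then show ?thesis
    using comult_closed[OF hl(1)] unfolding sweedler_def by simp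
qed

text \<open>A trilinear \<open>t\<close> induces a linear map on \<open>H\<close> \<otimes>
  (\<open>H\<close> \<otimes> \<open>H\<close>); applied to both sides of coassociativity, it yields
  the two ways of nesting the sums.\<close>

lemma sw_assoc:
  assumes N: "module k N" and h: "h \<in> carrier H"
    and l1: "\<And>y z. y \<in> carrier H \<Longrightarrow> z \<in> carrier H \<Longrightarrow> lin_map k H N (\<lambda>x. t x y z)"
    and l2: "\<And>x z. x \<in> carrier H \<Longrightarrow> z \<in> carrier H \<Longrightarrow> lin_map k H N (\<lambda>y. t x y z)"
    and l3: "\<And>x y. x \<in> carrier H \<Longrightarrow> y \<in> carrier H \<Longrightarrow> lin_map k H N (\<lambda>z. t x y z)"
  shows "sw N (\<lambda>x y. sw N (\<lambda>x1 x2. t x1 x2 y) x) h = sw N (\<lambda>x y. sw N (\<lambda>y1 y2. t x y1 y2) y) h"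
proof -
  let ?T = "tensor k H (tensor k H H)"
  let ?g = "\<lambda>x w. tensor_lift k H H N (\<lambda>y z. t x y z) w"
  let ?G = "tensor_lift k H (tensor k H H) N ?g"
  have tx: "bilin k H H N (\<lambda>y z. t x y z)" if "x \<in> carrier H" for x
    using that by (intro bilinI l2 l3)
  have g: "bilin k H (tensor k H H) N ?g"
    by (intro bilinI HH.tensor_lift_lin_map N tx HH.tensor_lift_parameter H_module l1)
  note G = HHH.tensor_lift_lin_map[OF N g]
  have ev: "?G (tens k H (tensor k H H) x (tens k H H y z)) = t x y z"
    if "x \<in> carrier H" "y \<in> carrier H" "z \<in> carrier H" for x y z
    using that by (simp add: HHH.tensor_lift_tens[OF N g] HH.tensor_lift_tens[OF N tx] HH.tens_closed)
  have "?G (sw ?T (\<lambda>x y. sw ?T (\<lambda>x1 x2. tens k H (tensor k H H) x1 (tens k H H x2 y)) x) h) =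
      ?G (sw ?T (\<lambda>x y. tens k H (tensor k H H) x (comult H y)) h)"
    by (simp only: coassoc[OF h])
  note tt = bilin_left[OF HHH.tens_bilin] bilin_right[OF HHH.tens_bilin]
    bilin_left[OF HH.tens_bilin] bilin_right[OF HH.tens_bilin] HH.tens_closed
  have b1: "bilin k H H ?T (\<lambda>x1 x2. tens k H (tensor k H H) x1 (tens k H H x2 y))"
    if "y \<in> carrier H" for y
    using that by (intro bilinI lin_map_comp[OF bilin_left[OF HH.tens_bilin] bilin_right[OF HHH.tens_bilin]] tt)
  have "?G (sw ?T (\<lambda>x y. sw ?T (\<lambda>x1 x2. tens k H (tensor k H H) x1 (tens k H H x2 y)) x) h) =
      sw N (\<lambda>x y. ?G (sw ?T (\<lambda>x1 x2. tens k H (tensor k H H) x1 (tens k H H x2 y)) x)) h"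
    by (rule lin_map_sw[OF HHH.tensor_module N G bilinI h];
        intro sw_lin_map b1 lin_sw_parameter HHH.tensor_module H_module
          lin_map_comp[OF bilin_right[OF HH.tens_bilin] bilin_right[OF HHH.tens_bilin]])
  also have "\<dots> = sw N (\<lambda>x y. sw N (\<lambda>x1 x2. t x1 x2 y) x) h"
    by (intro sweedler_cong, subst lin_map_sw[OF HHH.tensor_module N G b1])
      (auto intro!: sweedler_cong ev)
  finally have L: "sw N (\<lambda>x y. sw N (\<lambda>x1 x2. t x1 x2 y) x) h =
      ?G (sw ?T (\<lambda>x y. tens k H (tensor k H H) x (comult H y)) h)"
    by (simp only: coassoc[OF h])
  also have "\<dots> = sw N (\<lambda>x y. ?G (tens k H (tensor k H H) x (comult H y))) h"
    using h by (intro lin_map_sw[OF HHH.tensor_module N G] bilinI tt comult_closed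
        lin_map_comp[OF comult_linear bilin_right[OF HHH.tens_bilin]])
  also have "\<dots> = sw N (\<lambda>x y. sw N (\<lambda>y1 y2. t x y1 y2) y) h"
    by (intro sweedler_cong) (simp add: HHH.tensor_lift_tens[OF N g] comult_closed sweedler_def)
  finally show ?thesis .
qed

text \<open>The linear map induced by \<open>t\<close> is applied to the multiplicativity of the
  coproduct and pushed through both sums.\<close>

lemma sw_mult:
  assumes N: "module k N" and t: "bilin k H H N (\<lambda>x y. t x y)" and hl: "h \<in> carrier H" "l \<in> carrier H"
  shows "sw N (\<lambda>x y. t x y) (h \<cdot> l) =
    sw N (\<lambda>h1 h2. sw N (\<lambda>l1 l2. t (h1 \<cdot> l1) (h2 \<cdot> l2)) l) h"
proof -
  let ?T = "tensor k H H"
  let ?G = "tensor_lift k H H N (\<lambda>x y. t x y)"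
  note G = HH.tensor_lift_lin_map[OF N t]
  note ll = lin_map_comp[OF lin_mult_left[OF lin_map_id] bilin_left[OF HH.tens_bilin]]
    lin_map_comp[OF lin_mult_left[OF lin_map_id] bilin_right[OF HH.tens_bilin]]
    lin_map_comp[OF lin_mult_right[OF lin_map_id] bilin_left[OF HH.tens_bilin]]
    lin_map_comp[OF lin_mult_right[OF lin_map_id] bilin_right[OF HH.tens_bilin]]
  have b1: "bilin k H H ?T (\<lambda>l1 l2. tens k H H (h1 \<cdot> l1) (h2 \<cdot> l2))"
    if "h1 \<in> carrier H" "h2 \<in> carrier H" for h1 h2
    using that by (intro bilinI ll m_closed)
  have b2: "bilin k H H ?T (\<lambda>h1 h2. sw ?T (\<lambda>l1 l2. tens k H H (h1 \<cdot> l1) (h2 \<cdot> l2)) l)"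
    using hl by (intro bilinI lin_sw_parameter HH_module H_module b1 ll m_closed)
  have "sw N (\<lambda>x y. t x y) (h \<cdot> l) =
      ?G (sw ?T (\<lambda>h1 h2. sw ?T (\<lambda>l1 l2. tens k H H (h1 \<cdot> l1) (h2 \<cdot> l2)) l) h)"
    unfolding comult_mult[OF hl, symmetric] by (simp only: sweedler_def)
  also have "\<dots> = sw N (\<lambda>h1 h2. ?G (sw ?T (\<lambda>l1 l2. tens k H H (h1 \<cdot> l1) (h2 \<cdot> l2)) l)) h"
    by (rule lin_map_sw[OF HH_module N G b2 hl(1)])
  also have "\<dots> = sw N (\<lambda>h1 h2. sw N (\<lambda>l1 l2. t (h1 \<cdot> l1) (h2 \<cdot> l2)) l) h"
    by (intro sweedler_cong, subst lin_map_sw[OF HH_module N G b1 hl(2)])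
      (auto intro!: sweedler_cong HH.tensor_lift_tens[OF N t])
  finally show ?thesis .
qed

lemma lin_S: "lin_map k V H f \<Longrightarrow> lin_map k V H (\<lambda>x. antipode H (f x))"
  by (rule lin_map_comp[OF _ antipode_linear])

lemma lin_counit:
  assumes "module k N" "n \<in> carrier N" "lin_map k V H f"
  shows "lin_map k V N (\<lambda>x. counit H (f x) \<odot>\<^bsub>N\<^esub> n)"
proof (rule lin_map_comp[OF assms(3)])
  interpret N: module k N by fact
  show "lin_map k H N (\<lambda>x. counit H x \<odot>\<^bsub>N\<^esub> n)"
    using assms(2)
    by (intro lin_mapI) (simp_all add: counit_closed ring_hom_add[OF counit_hom] counit_smult
        N.smult_l_distr N.smult_assoc1)
qed

text \<open>The image of a Hopf axiom under a linear map \<open>g\<close>. In this form, as in the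
  three rules after it, the axiom can be applied to a factor inside a longer product or to an
  element of \<open>Hpar\<close>.\<close>

lemma counit_right_map:
  assumes N: "module k N" and g: "lin_map k H N (\<lambda>x. g x)" and h: "h \<in> carrier H"
  shows "sw N (\<lambda>x y. counit H y \<odot>\<^bsub>N\<^esub> g x) h = g h"
proof -
  have "g (sw H (\<lambda>x y. counit H y \<odot>\<^bsub>H\<^esub> x) h) = sw N (\<lambda>x y. g (counit H y \<odot>\<^bsub>H\<^esub> x)) h"
    using h by (intro lin_map_sw[OF H_module N g] bilinI lin_counit lin_smult H_module lin_map_id counit_closed)
  then show ?thesis
    using h by (simp add: counit_right lin_map_smult[OF g] counit_closed cong: sweedler_cong)
qed

lemma counit_left_map:
  assumes N: "module k N" and g: "lin_map k H N (\<lambda>x. g x)" and h: "h \<in> carrier H"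
  shows "sw N (\<lambda>x y. counit H x \<odot>\<^bsub>N\<^esub> g y) h = g h"
proof -
  have "g (sw H (\<lambda>x y. counit H x \<odot>\<^bsub>H\<^esub> y) h) = sw N (\<lambda>x y. g (counit H x \<odot>\<^bsub>H\<^esub> y)) h"
    using h by (intro lin_map_sw[OF H_module N g] bilinI lin_counit lin_smult H_module lin_map_id counit_closed)
  then show ?thesis
    using h by (simp add: counit_left lin_map_smult[OF g] counit_closed cong: sweedler_cong)
qed

lemma antipode_left_map:
  assumes N: "module k N" and g: "lin_map k H N (\<lambda>x. g x)" and h: "h \<in> carrier H"
  shows "sw N (\<lambda>x y. g (antipode H x \<cdot> y)) h = counit H h \<odot>\<^bsub>N\<^esub> g \<one>\<^bsub>H\<^esub>"
proof -
  have "g (sw H (\<lambda>x y. antipode H x \<cdot> y) h) = sw N (\<lambda>x y. g (antipode H x \<cdot> y)) h"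
    using h by (intro lin_map_sw[OF H_module N g] bilinI lin_mult_left lin_mult_right lin_S lin_map_id S_closed)
  then show ?thesis
    using h by (simp add: antipode_left lin_map_smult[OF g] counit_closed)
qed

lemma antipode_right_map:
  assumes N: "module k N" and g: "lin_map k H N (\<lambda>x. g x)" and h: "h \<in> carrier H"
  shows "sw N (\<lambda>x y. g (x \<cdot> antipode H y)) h = counit H h \<odot>\<^bsub>N\<^esub> g \<one>\<^bsub>H\<^esub>"
proof -
  have "g (sw H (\<lambda>x y. x \<cdot> antipode H y) h) = sw N (\<lambda>x y. g (x \<cdot> antipode H y)) h"
    using h by (intro lin_map_sw[OF H_module N g] bilinI lin_mult_left lin_mult_right lin_S lin_map_id S_closed)
  then show ?thesis
    using h by (simp add: antipode_right lin_map_smult[OF g] counit_closed)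
qed

end


section \<open>Algebras and their homomorphisms\<close>

lemma lin_map_plus:
  assumes "module k W" "lin_map k V W f" "lin_map k V W g"
  shows "lin_map k V W (\<lambda>x. f x \<oplus>\<^bsub>W\<^esub> g x)"
proof -
  interpret W: module k W by fact
  note fg = assms(2,3)
  show ?thesis
    using lin_map_closed[OF fg(1)] lin_map_closed[OF fg(2)]
    by (intro lin_mapI)
      (simp_all add: lin_map_add[OF fg(1)] lin_map_add[OF fg(2)] lin_map_smult[OF fg(1)]
        lin_map_smult[OF fg(2)] W.M.a_ac W.smult_r_distr)
qed

lemma lin_map_const_zero: "module k W \<Longrightarrow> lin_map k V W (\<lambda>x. \<zero>\<^bsub>W\<^esub>)"
proof -
  assume "module k W"
  then interpret W: module k W .
  show ?thesis by (intro lin_mapI) auto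
qed

section \<open>Hom spaces and endomorphism algebras\<close>

lemma Hom_module_simps:
  "carrier (Hom_module k V W) = Lin k V W"
  "zero (Hom_module k V W) = (\<lambda>x\<in>carrier V. \<zero>\<^bsub>W\<^esub>)"
  "add (Hom_module k V W) = (\<lambda>f g. \<lambda>x\<in>carrier V. f x \<oplus>\<^bsub>W\<^esub> g x)"
  "smult (Hom_module k V W) = (\<lambda>c f. \<lambda>x\<in>carrier V. c \<odot>\<^bsub>W\<^esub> f x)"
  by (simp_all add: Hom_module_def)

lemma Lin_closed: "f \<in> Lin k V W \<Longrightarrow> x \<in> carrier V \<Longrightarrow> f x \<in> carrier W"
  by (rule lin_map_closed[OF Lin_lin_map])

lemma Hom_module_module:
  assumes V: "module k V" and W: "module k W" shows "module k (Hom_module k V W)"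
proof -
  interpret V: module k V by fact
  interpret W: module k W by fact
  let ?N = "Hom_module k V W"
  have add: "f \<oplus>\<^bsub>?N\<^esub> g \<in> carrier ?N" if "f \<in> carrier ?N" "g \<in> carrier ?N" for f g
    using that unfolding Hom_module_simps by (intro Lin_restrict V lin_map_plus W Lin_lin_map)
  have smult: "c \<odot>\<^bsub>?N\<^esub> f \<in> carrier ?N" if "c \<in> carrier k" "f \<in> carrier ?N" for c f
    using that unfolding Hom_module_simps by (intro Lin_restrict V lin_smult W Lin_lin_map)
  have zero: "\<zero>\<^bsub>?N\<^esub> \<in> carrier ?N"
    unfolding Hom_module_simps by (intro Lin_restrict V lin_map_const_zero W)
  have eq: "f = g" if "f \<in> carrier ?N" "g \<in> carrier ?N" "\<And>x. x \<in> carrier V \<Longrightarrow> f x = g x" for f g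
    using that Lin_eqI unfolding Hom_module_simps by metis
  have ev: "(f \<oplus>\<^bsub>?N\<^esub> g) x = f x \<oplus>\<^bsub>W\<^esub> g x" "(c \<odot>\<^bsub>?N\<^esub> f) x = c \<odot>\<^bsub>W\<^esub> f x"
    "\<zero>\<^bsub>?N\<^esub> x = \<zero>\<^bsub>W\<^esub>" "f \<in> carrier ?N \<Longrightarrow> f x \<in> carrier W"
    if "x \<in> carrier V" for c f g x
    using that by (auto simp: Hom_module_simps Lin_closed)
  show ?thesis
  proof (rule moduleI)
    show "abelian_group ?N"
    proof (rule abelian_groupI)
      fix f assume f: "f \<in> carrier ?N"
      show "\<zero>\<^bsub>?N\<^esub> \<oplus>\<^bsub>?N\<^esub> f = f" by (rule eq) (use f in \<open>auto intro!: add zero simp: ev\<close>)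
      show "\<exists>g\<in>carrier ?N. g \<oplus>\<^bsub>?N\<^esub> f = \<zero>\<^bsub>?N\<^esub>"
      \<comment> \<open>The additive inverse is supplied as the multiple by -1, so membership comes
        from closure under scalars.\<close>
      proof (rule bexI)
        show "(\<ominus>\<^bsub>k\<^esub> \<one>\<^bsub>k\<^esub>) \<odot>\<^bsub>?N\<^esub> f \<oplus>\<^bsub>?N\<^esub> f = \<zero>\<^bsub>?N\<^esub>"
          by (rule eq) (use f in \<open>auto intro!: add smult zero simp: ev W.smult_l_minus W.M.l_neg\<close>)
      qed (use f smult in auto)
      fix g assume g: "g \<in> carrier ?N"
      show "f \<oplus>\<^bsub>?N\<^esub> g = g \<oplus>\<^bsub>?N\<^esub> f"
        by (rule eq) (use f g in \<open>auto intro!: add simp: ev W.M.a_comm\<close>)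
      fix h assume h: "h \<in> carrier ?N"
      show "f \<oplus>\<^bsub>?N\<^esub> g \<oplus>\<^bsub>?N\<^esub> h = f \<oplus>\<^bsub>?N\<^esub> (g \<oplus>\<^bsub>?N\<^esub> h)"
        by (rule eq) (use f g h in \<open>auto intro!: add simp: ev W.M.a_assoc\<close>)
    qed (rule add zero; assumption?)+
  next
    fix a f assume a: "a \<in> carrier k" and f: "f \<in> carrier ?N"
    show "a \<odot>\<^bsub>?N\<^esub> (f \<oplus>\<^bsub>?N\<^esub> g) = a \<odot>\<^bsub>?N\<^esub> f \<oplus>\<^bsub>?N\<^esub> a \<odot>\<^bsub>?N\<^esub> g" if g: "g \<in> carrier ?N" for g
      by (rule eq) (use a f g in \<open>auto intro!: add smult simp: ev W.smult_r_distr\<close>)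
    fix b assume b: "b \<in> carrier k"
    show "(a \<oplus>\<^bsub>k\<^esub> b) \<odot>\<^bsub>?N\<^esub> f = a \<odot>\<^bsub>?N\<^esub> f \<oplus>\<^bsub>?N\<^esub> b \<odot>\<^bsub>?N\<^esub> f"
      by (rule eq) (use a b f in \<open>auto intro!: add smult simp: ev W.smult_l_distr\<close>)
    show "(a \<otimes>\<^bsub>k\<^esub> b) \<odot>\<^bsub>?N\<^esub> f = a \<odot>\<^bsub>?N\<^esub> (b \<odot>\<^bsub>?N\<^esub> f)"
      by (rule eq) (use a b f in \<open>auto intro!: smult simp: ev W.smult_assoc1\<close>)
  next
    fix f assume f: "f \<in> carrier ?N"
    show "\<one>\<^bsub>k\<^esub> \<odot>\<^bsub>?N\<^esub> f = f" by (rule eq) (use f in \<open>auto intro!: smult simp: ev\<close>)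
  qed (use smult V.R.is_cring in auto)
qed

lemma End_algebra_simps:
  "carrier (End_algebra k V) = Lin k V V"
  "zero (End_algebra k V) = (\<lambda>x\<in>carrier V. \<zero>\<^bsub>V\<^esub>)"
  "add (End_algebra k V) = (\<lambda>f g. \<lambda>x\<in>carrier V. f x \<oplus>\<^bsub>V\<^esub> g x)"
  "smult (End_algebra k V) = (\<lambda>c f. \<lambda>x\<in>carrier V. c \<odot>\<^bsub>V\<^esub> f x)"
  "mult (End_algebra k V) = compose (carrier V)"
  "one (End_algebra k V) = (\<lambda>x\<in>carrier V. x)"
  by (simp_all add: End_algebra_def Hom_module_simps)

lemma k_algebraI:
  assumes k: "field k" and A: "module k A"
    and mult: "bilin k A A A (mult A)"
    and one: "\<one>\<^bsub>A\<^esub> \<in> carrier A" "\<And>x. x \<in> carrier A \<Longrightarrow> \<one>\<^bsub>A\<^esub> \<otimes>\<^bsub>A\<^esub> x = x"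
      "\<And>x. x \<in> carrier A \<Longrightarrow> x \<otimes>\<^bsub>A\<^esub> \<one>\<^bsub>A\<^esub> = x"
    and assoc: "\<And>x y z. x \<in> carrier A \<Longrightarrow> y \<in> carrier A \<Longrightarrow> z \<in> carrier A \<Longrightarrow>
      x \<otimes>\<^bsub>A\<^esub> y \<otimes>\<^bsub>A\<^esub> z = x \<otimes>\<^bsub>A\<^esub> (y \<otimes>\<^bsub>A\<^esub> z)"
  shows "k_algebra k A"
proof (intro k_algebra.intro k A ringI k_algebra_axioms.intro)
  show "abelian_group A" by (rule module.axioms(2)[OF A])
  show "Group.monoid A"
    using one assoc bilin_closed[OF mult] by (intro monoidI)
qed (use lin_map_add[OF bilin_left[OF mult]] lin_map_add[OF bilin_right[OF mult]]
    lin_map_smult[OF bilin_left[OF mult]] lin_map_smult[OF bilin_right[OF mult]] in auto)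

lemma End_algebra_k_algebra:
  assumes k: "field k" and V: "module k V" shows "k_algebra k (End_algebra k V)"
proof (rule k_algebraI[OF k])
  interpret V: module k V by fact
  let ?E = "End_algebra k V"
  show E: "module k ?E"
    by (rule module_cong[OF Hom_module_module[OF V V]]) (simp_all add: End_algebra_simps Hom_module_simps)
  have c: "f \<otimes>\<^bsub>?E\<^esub> g \<in> carrier ?E" if "f \<in> carrier ?E" "g \<in> carrier ?E" for f g
    using that unfolding End_algebra_simps compose_def
    by (intro Lin_restrict V lin_map_comp[OF Lin_lin_map Lin_lin_map])
  have eq: "f = g" if "f \<in> carrier ?E" "g \<in> carrier ?E" "\<And>x. x \<in> carrier V \<Longrightarrow> f x = g x" for f g
    using that Lin_eqI unfolding End_algebra_simps by metis

  have lin: "lin_map k V V f" if "f \<in> carrier ?E" for f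
    using that Lin_lin_map unfolding End_algebra_simps by blast
  note cl = c module_add_closed[OF E] module.smult_closed[OF E]
  have ev: "(f \<oplus>\<^bsub>?E\<^esub> g) x = f x \<oplus>\<^bsub>V\<^esub> g x" "(c \<odot>\<^bsub>?E\<^esub> f) x = c \<odot>\<^bsub>V\<^esub> f x"
    "(f \<otimes>\<^bsub>?E\<^esub> g) x = f (g x)" "\<one>\<^bsub>?E\<^esub> x = x" "f \<in> carrier ?E \<Longrightarrow> f x \<in> carrier V"
    if "x \<in> carrier V" for c f g x
    using that by (auto simp: End_algebra_simps Lin_closed compose_eq)
  show "bilin k ?E ?E ?E (mult ?E)"
  proof (rule bilinI; rule lin_mapI)
    fix f g assume f: "f \<in> carrier ?E" and g: "g \<in> carrier ?E"
    then show "f \<otimes>\<^bsub>?E\<^esub> g \<in> carrier ?E" "f \<otimes>\<^bsub>?E\<^esub> g \<in> carrier ?E" by (simp_all add: c)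
    show "f \<otimes>\<^bsub>?E\<^esub> (g \<oplus>\<^bsub>?E\<^esub> h) = f \<otimes>\<^bsub>?E\<^esub> g \<oplus>\<^bsub>?E\<^esub> f \<otimes>\<^bsub>?E\<^esub> h" if h: "h \<in> carrier ?E" for h
      by (rule eq) (use f g h in \<open>auto intro!: cl simp: ev lin_map_add[OF lin[OF f]]\<close>)
    show "(f \<oplus>\<^bsub>?E\<^esub> h) \<otimes>\<^bsub>?E\<^esub> g = f \<otimes>\<^bsub>?E\<^esub> g \<oplus>\<^bsub>?E\<^esub> h \<otimes>\<^bsub>?E\<^esub> g" if h: "h \<in> carrier ?E" for h
      by (rule eq) (use f g h in \<open>auto intro!: cl simp: ev\<close>)
    fix a assume a: "a \<in> carrier k"
    show "f \<otimes>\<^bsub>?E\<^esub> (a \<odot>\<^bsub>?E\<^esub> g) = a \<odot>\<^bsub>?E\<^esub> (f \<otimes>\<^bsub>?E\<^esub> g)"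
      by (rule eq) (use a f g in \<open>auto intro!: cl simp: ev lin_map_smult[OF lin[OF f]]\<close>)
    show "(a \<odot>\<^bsub>?E\<^esub> f) \<otimes>\<^bsub>?E\<^esub> g = a \<odot>\<^bsub>?E\<^esub> (f \<otimes>\<^bsub>?E\<^esub> g)"
      by (rule eq) (use a f g in \<open>auto intro!: cl simp: ev\<close>)
  qed
  show one: "\<one>\<^bsub>?E\<^esub> \<in> carrier ?E"
    unfolding End_algebra_simps by (intro Lin_restrict V lin_map_id)
  fix f assume f: "f \<in> carrier ?E"
  show "\<one>\<^bsub>?E\<^esub> \<otimes>\<^bsub>?E\<^esub> f = f" by (rule eq) (use f one in \<open>auto intro!: cl simp: ev\<close>)
  show "f \<otimes>\<^bsub>?E\<^esub> \<one>\<^bsub>?E\<^esub> = f" by (rule eq) (use f one in \<open>auto intro!: cl simp: ev\<close>)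
  fix g h assume g: "g \<in> carrier ?E" and h: "h \<in> carrier ?E"
  show "f \<otimes>\<^bsub>?E\<^esub> g \<otimes>\<^bsub>?E\<^esub> h = f \<otimes>\<^bsub>?E\<^esub> (g \<otimes>\<^bsub>?E\<^esub> h)"
    by (rule eq) (use f g h in \<open>auto intro!: cl simp: ev\<close>)
qed

text \<open>The variant of \<open>alg_hom\<close> without extensionality, so that identities and
  quotient projections, written as plain functions, qualify.\<close>

definition alg_map ::
  "('k, 'y) ring_scheme \<Rightarrow> ('k, 'v, 'a) module_scheme \<Rightarrow> ('k, 'w, 'b) module_scheme \<Rightarrow> ('v \<Rightarrow> 'w) \<Rightarrow> bool"
  where "alg_map k A B f \<longleftrightarrow> lin_map k A B f \<and> f \<one>\<^bsub>A\<^esub> = \<one>\<^bsub>B\<^esub> \<and>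
    (\<forall>x\<in>carrier A. \<forall>y\<in>carrier A. f (x \<otimes>\<^bsub>A\<^esub> y) = f x \<otimes>\<^bsub>B\<^esub> f y)"

lemma alg_map_lin_map: "alg_map k A B f \<Longrightarrow> lin_map k A B f"
  and alg_map_one: "alg_map k A B f \<Longrightarrow> f \<one>\<^bsub>A\<^esub> = \<one>\<^bsub>B\<^esub>"
  and alg_map_mult: "alg_map k A B f \<Longrightarrow> x \<in> carrier A \<Longrightarrow> y \<in> carrier A \<Longrightarrow>
    f (x \<otimes>\<^bsub>A\<^esub> y) = f x \<otimes>\<^bsub>B\<^esub> f y"
  by (simp_all add: alg_map_def)

lemma alg_hom_iff: "f \<in> alg_hom k A B \<longleftrightarrow> f \<in> extensional (carrier A) \<and> alg_map k A B f"
  by (auto simp: alg_hom_def alg_map_def Lin_def ring_hom_def lin_map_def)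

text \<open>Used for \<open>f\<close> the identity, where it places a generated subalgebra inside
  the algebra, and for \<open>f\<close> a projection, where it shows that quotients are generated by
  images of generators.\<close>

lemma alg_map_alg_generated:
  assumes f: "alg_map k A B f" and A: "k_algebra k A" and X: "X \<subseteq> carrier A" and x: "x \<in> alg_generated k A X"
  shows "x \<in> carrier A \<and> f x \<in> alg_generated k B (f ` X)"
proof -
  interpret A: k_algebra k A by fact
  note l = alg_map_lin_map[OF f]
  show ?thesis
    using x by induction
      (use X in \<open>auto simp: alg_map_one[OF f] alg_map_mult[OF f] lin_map_add[OF l] lin_map_smult[OF l]
        intro: alg_generated.intros\<close>)
qed

lemma alg_map_eqI:
  assumes f: "alg_map k A B f" and g: "alg_map k A B g" and A: "k_algebra k A" and X: "X \<subseteq> carrier A"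
    and eq: "\<And>x. x \<in> X \<Longrightarrow> f x = g x" and x: "x \<in> alg_generated k A X"
  shows "f x = g x"
proof -
  interpret A: k_algebra k A by fact
  note l = alg_map_lin_map[OF f] alg_map_lin_map[OF g]
  have "x \<in> carrier A \<and> f x = g x"
    using x by induction
      (use X in \<open>auto simp: alg_map_one[OF f] alg_map_mult[OF f] lin_map_add[OF l(1)] lin_map_smult[OF l(1)]
        alg_map_one[OF g] alg_map_mult[OF g] lin_map_add[OF l(2)] lin_map_smult[OF l(2)] eq\<close>)
  then show ?thesis ..
qed

lemma alg_map_kernel_ideal:
  assumes f: "alg_map k A B f" and A: "k_algebra k A" and B: "k_algebra k B"
  shows "ideal {x \<in> carrier A. f x = \<zero>\<^bsub>B\<^esub>} A"
proof -
  interpret A: k_algebra k A by fact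
  interpret B: k_algebra k B by fact
  note l = alg_map_lin_map[OF f]
  note s = kernel_submodule[OF A.k_module B.k_module l]
  show ?thesis
    by (rule idealI[OF A.ring_axioms submodule.axioms(1)[OF s]])
      (auto simp: alg_map_mult[OF f] lin_map_closed[OF l])
qed

section \<open>Quotients of algebras by ideals\<close>

locale algebra_quotient = k_algebra k A + ideal I A for k (structure) and A (structure) and I
begin

sublocale quot: module_quotient k A I
proof (intro module_quotient.intro module_quotient_axioms.intro k_module submodule.intro)
  show "submodule_axioms I k A"
  proof
    fix c x assume c: "c \<in> carrier k" and x: "x \<in> I"
    \<comment> \<open>An ideal of the ring is closed under scalars because the scalar can be moved
      onto the unit, turning the multiple into a ring product.\<close>
    then have "c \<odot>\<^bsub>A\<^esub> x = (c \<odot>\<^bsub>A\<^esub> \<one>\<^bsub>A\<^esub>) \<otimes>\<^bsub>A\<^esub> x"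
      using Icarr by (simp add: smult_mult_left)
    also have "\<dots> \<in> I" using c x by (intro I_l_closed) auto
    finally show "c \<odot>\<^bsub>A\<^esub> x \<in> I" .
  qed
qed (rule a_subgroup)

lemma coset_mult:
  "x \<in> carrier A \<Longrightarrow> y \<in> carrier A \<Longrightarrow>
    (I +>\<^bsub>A\<^esub> x) \<otimes>\<^bsub>quotient A I\<^esub> (I +>\<^bsub>A\<^esub> y) = I +>\<^bsub>A\<^esub> (x \<otimes>\<^bsub>A\<^esub> y)"
  by (simp add: quotient_simps rcoset_mult_add)

lemma coset_alg_map: "alg_map k A (quotient A I) (\<lambda>x. I +>\<^bsub>A\<^esub> x)"
  unfolding alg_map_def using quot.coset_lin_map by (auto simp: coset_mult quotient_simps(3))

lemma quotient_k_algebra: "k_algebra k (quotient A I)"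
proof (rule k_algebraI)
  show "field k" by (rule field_axioms)
  let ?Q = "quotient A I"
  show "module k ?Q" by (rule quot.quotient_module)
  note simps = coset_mult quot.coset_closed quot.coset_add quot.coset_smult quotient_simps(3)
    smult_mult_left smult_mult_right l_distr r_distr m_assoc
  show "bilin k ?Q ?Q ?Q (mult ?Q)"
  proof (rule bilinI; rule lin_mapI)
    fix X Y assume "X \<in> carrier ?Q" "Y \<in> carrier ?Q"
    then obtain x y where xy: "x \<in> carrier A" "y \<in> carrier A" "X = I +>\<^bsub>A\<^esub> x" "Y = I +>\<^bsub>A\<^esub> y"
      by (auto elim!: quot.cosetE)
    then show "X \<otimes>\<^bsub>?Q\<^esub> Y \<in> carrier ?Q" "X \<otimes>\<^bsub>?Q\<^esub> Y \<in> carrier ?Q"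
      by (simp_all add: simps)
    show "X \<otimes>\<^bsub>?Q\<^esub> (Y \<oplus>\<^bsub>?Q\<^esub> Z) = X \<otimes>\<^bsub>?Q\<^esub> Y \<oplus>\<^bsub>?Q\<^esub> X \<otimes>\<^bsub>?Q\<^esub> Z"
      "(X \<oplus>\<^bsub>?Q\<^esub> Z) \<otimes>\<^bsub>?Q\<^esub> Y = X \<otimes>\<^bsub>?Q\<^esub> Y \<oplus>\<^bsub>?Q\<^esub> Z \<otimes>\<^bsub>?Q\<^esub> Y" if "Z \<in> carrier ?Q" for Z
      using that xy by (auto elim!: quot.cosetE simp only: simps M.a_closed m_closed)
    show "X \<otimes>\<^bsub>?Q\<^esub> (c \<odot>\<^bsub>?Q\<^esub> Y) = c \<odot>\<^bsub>?Q\<^esub> (X \<otimes>\<^bsub>?Q\<^esub> Y)"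
      "(c \<odot>\<^bsub>?Q\<^esub> X) \<otimes>\<^bsub>?Q\<^esub> Y = c \<odot>\<^bsub>?Q\<^esub> (X \<otimes>\<^bsub>?Q\<^esub> Y)" if "c \<in> carrier k" for c
      using that xy by (auto simp only: simps smult_closed m_closed)
  qed
  show "\<one>\<^bsub>?Q\<^esub> \<in> carrier ?Q" by (simp add: simps)
  fix X assume "X \<in> carrier ?Q"
  then obtain x where x: "x \<in> carrier A" "X = I +>\<^bsub>A\<^esub> x" by (rule quot.cosetE)
  then show "\<one>\<^bsub>?Q\<^esub> \<otimes>\<^bsub>?Q\<^esub> X = X" "X \<otimes>\<^bsub>?Q\<^esub> \<one>\<^bsub>?Q\<^esub> = X" by (simp_all add: simps)
  fix Y Z assume "Y \<in> carrier ?Q" "Z \<in> carrier ?Q"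
  then obtain y z where "y \<in> carrier A" "Y = I +>\<^bsub>A\<^esub> y" "z \<in> carrier A" "Z = I +>\<^bsub>A\<^esub> z"
    by (auto elim!: quot.cosetE)
  with x show "X \<otimes>\<^bsub>?Q\<^esub> Y \<otimes>\<^bsub>?Q\<^esub> Z = X \<otimes>\<^bsub>?Q\<^esub> (Y \<otimes>\<^bsub>?Q\<^esub> Z)" by (simp add: simps)
qed

text \<open>The kernel of \<open>f\<close> is an ideal containing \<open>S\<close>, hence contains
  \<open>I\<close>. So checking generators suffices for a linear lift, which is multiplicative
  because products are computed on representatives.\<close>

lemma quotient_alg_lift:
  assumes B: "k_algebra k B" and f: "alg_map k A B f" and I: "I = Idl\<^bsub>A\<^esub> S"
    and vanish: "\<And>s. s \<in> S \<Longrightarrow> f s = \<zero>\<^bsub>B\<^esub>" and S: "S \<subseteq> carrier A"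
  obtains g where "g \<in> alg_hom k (quotient A I) B" "\<And>x. x \<in> carrier A \<Longrightarrow> g (I +>\<^bsub>A\<^esub> x) = f x"
proof -
  have "I \<subseteq> {x \<in> carrier A. f x = \<zero>\<^bsub>B\<^esub>}"
    unfolding I using S vanish
    by (intro genideal_minimal alg_map_kernel_ideal[OF f k_algebra_axioms B]) auto
  then obtain g where g: "g \<in> Lin k (quotient A I) B" "\<And>x. x \<in> carrier A \<Longrightarrow> g (I +>\<^bsub>A\<^esub> x) = f x"
    using quot.quotient_lift[OF k_algebra.k_module[OF B] alg_map_lin_map[OF f]] by blast
  have "alg_map k (quotient A I) B g"
    unfolding alg_map_def
  proof (intro conjI ballI)
    show "lin_map k (quotient A I) B g" by (rule Lin_lin_map[OF g(1)])
    show "g \<one>\<^bsub>quotient A I\<^esub> = \<one>\<^bsub>B\<^esub>"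
      by (simp add: quotient_simps g(2) alg_map_one[OF f])
    fix X Y assume "X \<in> carrier (quotient A I)" "Y \<in> carrier (quotient A I)"
    then obtain x y where "x \<in> carrier A" "y \<in> carrier A" "X = I +>\<^bsub>A\<^esub> x" "Y = I +>\<^bsub>A\<^esub> y"
      by (auto elim!: quot.cosetE)
    then show "g (X \<otimes>\<^bsub>quotient A I\<^esub> Y) = g X \<otimes>\<^bsub>B\<^esub> g Y"
      by (simp add: coset_mult g(2) alg_map_mult[OF f])
  qed
  then show ?thesis
    using that g by (auto simp: alg_hom_iff Lin_def)
qed

lemma quotient_generated:
  assumes "carrier A \<subseteq> alg_generated k A X" "X \<subseteq> carrier A"
  shows "carrier (quotient A I) \<subseteq> alg_generated k (quotient A I) ((\<lambda>x. I +>\<^bsub>A\<^esub> x) ` X)"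
proof
  fix Y assume "Y \<in> carrier (quotient A I)"
  then obtain y where "y \<in> carrier A" "Y = I +>\<^bsub>A\<^esub> y" by (rule quot.cosetE)
  then show "Y \<in> alg_generated k (quotient A I) ((\<lambda>x. I +>\<^bsub>A\<^esub> x) ` X)"
    using alg_map_alg_generated[OF coset_alg_map k_algebra_axioms assms(2)] assms(1) by blast
qed

end


section \<open>The free algebra and the tensor algebra\<close>

lemma free_algebra_simps:
  "carrier (free_algebra k X) = carrier (free_module k (lists X))"
  "zero (free_algebra k X) = zero (free_module k (lists X))"
  "add (free_algebra k X) = add (free_module k (lists X))"
  "smult (free_algebra k X) = smult (free_module k (lists X))"
  "mult (free_algebra k X) = (\<lambda>f g w. \<Oplus>\<^bsub>k\<^esub>i\<in>{..length w}. f (take i w) \<otimes>\<^bsub>k\<^esub> g (drop i w))"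
  "one (free_algebra k X) = free_gen k []"
  by (simp_all add: free_algebra_def)

lemma lin_map_free_algebra:
  "lin_map k (free_algebra k X) N f \<longleftrightarrow> lin_map k (free_module k (lists X)) N f"
  by (simp add: lin_map_def free_algebra_simps)

definition word_prod :: "('k, 'n, 'c) module_scheme \<Rightarrow> ('x \<Rightarrow> 'n) \<Rightarrow> 'x list \<Rightarrow> 'n"
  where "word_prod B f w = foldr (\<lambda>x b. f x \<otimes>\<^bsub>B\<^esub> b) w \<one>\<^bsub>B\<^esub>"

locale free_algebra_on = field k for k (structure) and X :: "'x set"
begin

abbreviation "FA \<equiv> free_algebra k X"
abbreviation (input) mult_FA (infixl "\<cdot>" 70) where "p \<cdot> q \<equiv> p \<otimes>\<^bsub>FA\<^esub> q"

lemma FA_module: "module k FA"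
  by (rule module_cong[OF free_module_module[of "lists X"]]) (simp_all add: free_algebra_simps)

lemma FA_value_closed: "p \<in> carrier FA \<Longrightarrow> p w \<in> carrier k"
  unfolding free_algebra_simps by (rule free_module_value_closed)

lemma FA_gen_closed: "u \<in> lists X \<Longrightarrow> free_gen k u \<in> carrier FA"
  unfolding free_algebra_simps by (rule free_gen_closed)

lemma FA_lin_eq:
  assumes "module k N" "lin_map k FA N f" "lin_map k FA N g"
    and "\<And>u. u \<in> lists X \<Longrightarrow> f (free_gen k u) = g (free_gen k u)" and "p \<in> carrier FA"
  shows "f p = g p"
  using assms free_module_lin_eq[of N "lists X" f g p] by (simp add: free_algebra_simps lin_map_free_algebra)

lemma FA_mult_closed:
  assumes p: "p \<in> carrier FA" and q: "q \<in> carrier FA" shows "p \<cdot> q \<in> carrier FA"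
proof -
  note pq = FA_value_closed[OF p] FA_value_closed[OF q]
  obtain A where A: "finite A" "A \<subseteq> lists X" "\<And>x. x \<notin> A \<Longrightarrow> p x = \<zero>"
    using p unfolding free_algebra_simps(1) by (rule free_module_supportE) blast
  obtain B where B: "finite B" "B \<subseteq> lists X" "\<And>x. x \<notin> B \<Longrightarrow> q x = \<zero>"
    using q unfolding free_algebra_simps(1) by (rule free_module_supportE) blast
  show ?thesis
    unfolding free_algebra_simps
  proof (rule free_module_closedI)
    \<comment> \<open>The support of a product lies among the concatenations of words taken from
      finite sets that contain the supports of the factors.\<close>
    show "finite ((\<lambda>(u, v). u @ v) ` (A \<times> B))" using A B by auto
    show "(\<lambda>(u, v). u @ v) ` (A \<times> B) \<subseteq> lists X" using A B by fastforce
    show "(\<Oplus>i\<in>{..length w}. p (take i w) \<otimes> q (drop i w)) \<in> carrier k" for w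
      using pq by (intro finsum_closed) auto
    fix w assume w: "w \<notin> (\<lambda>(u, v). u @ v) ` (A \<times> B)"
    have "p (take i w) \<otimes> q (drop i w) = \<zero>" for i
    \<comment> \<open>If the first part of the cut lies in \<open>A\<close>, the second cannot lie
      in \<open>B\<close>, since \<open>w\<close> is not such a concatenation; one of the two
      factors vanishes either way.\<close>
    proof (cases "take i w \<in> A")
      case True
      then have "drop i w \<notin> B" using w by (auto simp: image_iff) (metis append_take_drop_id)
      then show ?thesis using pq B by simp
    qed (use pq A in simp)
    then show "(\<Oplus>i\<in>{..length w}. p (take i w) \<otimes> q (drop i w)) = \<zero>"
      by (intro add.finprod_one_eqI)
  qed
qed

lemma FA_mult_bilin: "bilin k FA FA FA (mult FA)"
proof (rule bilinI; rule lin_mapI)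
  fix p q assume p: "p \<in> carrier FA" and q: "q \<in> carrier FA"
  then show "p \<cdot> q \<in> carrier FA" "p \<cdot> q \<in> carrier FA" by (simp_all add: FA_mult_closed)
  note pq = FA_value_closed[OF p] FA_value_closed[OF q]
  show "p \<cdot> (q \<oplus>\<^bsub>FA\<^esub> r) = p \<cdot> q \<oplus>\<^bsub>FA\<^esub> p \<cdot> r"
    "(p \<oplus>\<^bsub>FA\<^esub> r) \<cdot> q = p \<cdot> q \<oplus>\<^bsub>FA\<^esub> r \<cdot> q" if r: "r \<in> carrier FA" for r
    using pq FA_value_closed[OF r]
    by (simp_all add: free_algebra_simps free_module_simps r_distr l_distr finsum_addf Pi_def fun_eq_iff)
  fix c assume "c \<in> carrier k"
  then show "p \<cdot> (c \<odot>\<^bsub>FA\<^esub> q) = c \<odot>\<^bsub>FA\<^esub> (p \<cdot> q)"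
    "(c \<odot>\<^bsub>FA\<^esub> p) \<cdot> q = c \<odot>\<^bsub>FA\<^esub> (p \<cdot> q)"
    using pq
    by (simp_all add: free_algebra_simps free_module_simps finsum_rdistr Pi_def fun_eq_iff m_ac)
qed

text \<open>Only a cut at position \<open>length u\<close> can split a word into \<open>u\<close>
  and \<open>v\<close>, and it does so exactly for \<open>w = u @ v\<close>; every other summand is
  zero.\<close>

lemma FA_mult_gen: "free_gen k u \<cdot> free_gen k v = free_gen k (u @ v)"
proof
  fix w
  let ?f = "\<lambda>i. free_gen k u (take i w) \<otimes> free_gen k v (drop i w)"
  show "(free_gen k u \<cdot> free_gen k v) w = free_gen k (u @ v) w"
  proof (cases "w = u @ v")
    case True
    then have eq: "?f i = (if i = length u then \<one> else \<zero>)" if "i \<le> length w" for i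
    proof -
      have "take i w = u \<and> drop i w = v \<longleftrightarrow> i = length u"
        using that True by (metis append_eq_conv_conj length_take min.absorb2)
      then show ?thesis by (auto simp: free_gen_def)
    qed
    have "(\<Oplus>i\<in>{..length w}. ?f i) = (\<Oplus>i\<in>{..length w}. if length u = i then \<one> else \<zero>)"
      by (intro finsum_cong') (auto simp: eq)
    also have "\<dots> = \<one>"
      using True finsum_singleton[of "length u" "{..length w}" "\<lambda>_. \<one>"] by simp
    finally show ?thesis
      using True by (simp add: free_algebra_simps free_gen_def)
  next
    case False
    then have "?f i = \<zero>" for i
      by (auto simp: free_gen_def)
    then have "(\<Oplus>i\<in>{..length w}. ?f i) = \<zero>" by (intro add.finprod_one_eqI)
    then show ?thesis using False by (simp add: free_algebra_simps free_gen_def)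
  qed
qed

lemma FA_k_algebra: "k_algebra k FA"
proof (rule k_algebraI[OF field_axioms FA_module FA_mult_bilin])
  note lm = bilin_left[OF FA_mult_bilin] bilin_right[OF FA_mult_bilin]
  note cl = FA_mult_closed FA_gen_closed
  show one: "\<one>\<^bsub>FA\<^esub> \<in> carrier FA"
    using FA_gen_closed[of "[]"] by (simp add: free_algebra_simps)
  fix p assume p: "p \<in> carrier FA"
  show "\<one>\<^bsub>FA\<^esub> \<cdot> p = p"
    by (rule FA_lin_eq[OF FA_module lm(2)[OF one] lin_map_id _ p])
      (simp add: free_algebra_simps(6) FA_mult_gen)
  show "p \<cdot> \<one>\<^bsub>FA\<^esub> = p"
    by (rule FA_lin_eq[OF FA_module lm(1)[OF one] lin_map_id _ p])
      (simp add: free_algebra_simps(6) FA_mult_gen)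
  fix q r assume q: "q \<in> carrier FA" and r: "r \<in> carrier FA"
  \<comment> \<open>Associativity is trilinear, so it reduces to words one factor at a time:
    \<open>1\<close> frees the right factor, \<open>2\<close> the middle one, and the final argument
    the left one.\<close>
  have 1: "free_gen k u \<cdot> free_gen k v \<cdot> r = free_gen k u \<cdot> (free_gen k v \<cdot> r)"
    if "u \<in> lists X" "v \<in> lists X" for u v
    by (rule FA_lin_eq[OF FA_module _ _ _ r])
      (use that in \<open>auto intro!: lm cl lin_map_comp[OF lm(2) lm(2)] simp: FA_mult_gen simp del: in_lists_conv_set\<close>)
  have 2: "free_gen k u \<cdot> q \<cdot> r = free_gen k u \<cdot> (q \<cdot> r)" if u: "u \<in> lists X" for u
  proof (rule FA_lin_eq[OF FA_module _ _ _ q])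
    show "lin_map k FA FA (\<lambda>q. free_gen k u \<cdot> q \<cdot> r)"
      by (intro lin_map_comp[OF lm(2) lm(1)] cl r u)
    show "lin_map k FA FA (\<lambda>q. free_gen k u \<cdot> (q \<cdot> r))"
      by (intro lin_map_comp[OF lm(1) lm(2)] cl r u)
  qed (use 1 u in auto)
  show "p \<cdot> q \<cdot> r = p \<cdot> (q \<cdot> r)"
  proof (rule FA_lin_eq[OF FA_module _ _ _ p])
    show "lin_map k FA FA (\<lambda>p. p \<cdot> q \<cdot> r)"
      by (intro lin_map_comp[OF lm(1) lm(1)] q r)
    show "lin_map k FA FA (\<lambda>p. p \<cdot> (q \<cdot> r))"
      by (intro lm cl q r)
  qed (use 2 in auto)
qed

lemma FA_generated: "carrier FA \<subseteq> alg_generated k FA ((\<lambda>x. free_gen k [x]) ` X)"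
proof
  let ?G = "alg_generated k FA ((\<lambda>x. free_gen k [x]) ` X)"
  interpret FA: k_algebra k FA by (rule FA_k_algebra)
  have gen: "free_gen k u \<in> ?G" if "u \<in> lists X" for u
    using that
  proof induction
    case Nil
    show ?case using alg_generated.one[of FA k] by (simp add: free_algebra_simps)
  next
    case (Cons x u)
    then have "free_gen k [x] \<cdot> free_gen k u \<in> ?G"
      by (intro alg_generated.mult) (auto intro: alg_generated.incl)
    then show ?case by (simp add: FA_mult_gen)
  qed
  fix p assume "p \<in> carrier FA"
  then show "p \<in> ?G"
    unfolding free_algebra_simps(1)
  proof (induction rule: free_module_induct)
    \<comment> \<open>\<open>alg_generated\<close> has no clause for zero, which is produced as the
      multiple of the unit by the scalar zero.\<close>
    case zero
    have "\<zero> \<odot>\<^bsub>FA\<^esub> \<one>\<^bsub>FA\<^esub> \<in> ?G"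
      by (intro alg_generated.intros) auto
    then show ?case by (simp add: free_algebra_simps(2))
  next
    case (step c x q)
    then have "c \<odot>\<^bsub>FA\<^esub> free_gen k x \<oplus>\<^bsub>FA\<^esub> q \<in> ?G"
      by (intro alg_generated.add alg_generated.smult gen)
    then show ?case by (simp add: free_algebra_simps)
  qed
qed

lemma FA_lift:
  assumes B: "k_algebra k B" and f: "f \<in> X \<rightarrow> carrier B"
  obtains g where "alg_map k FA B g" "\<And>x. x \<in> X \<Longrightarrow> g (free_gen k [x]) = f x"
proof -
  interpret B: k_algebra k B by fact
  interpret FA: k_algebra k FA by (rule FA_k_algebra)
  define g where "g = free_extend k B (word_prod B f)"
  have wc: "word_prod B f w \<in> carrier B" if "w \<in> lists X" for w
    using that by induction (use f in \<open>auto simp: word_prod_def\<close>)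
  then have wp: "word_prod B f \<in> lists X \<rightarrow> carrier B" by auto
  have wapp: "word_prod B f (u @ v) = word_prod B f u \<otimes>\<^bsub>B\<^esub> word_prod B f v"
    if "u \<in> lists X" "v \<in> lists X" for u v
    using that(1)
  proof induction
    case Nil
    show ?case using wc[OF that(2)] by (simp add: word_prod_def)
  next
    case (Cons x u)
    have "f x \<in> carrier B" using Cons f by auto
    then show ?case
      using Cons wc[OF Cons(2)] wc[OF that(2)] by (simp add: word_prod_def B.m_assoc)
  qed
  have glin: "lin_map k FA B g"
    unfolding g_def lin_map_free_algebra by (rule B.free_extend_lin_map[OF wp])
  have ggen: "g (free_gen k u) = word_prod B f u" if "u \<in> lists X" for u
    unfolding g_def by (rule B.free_extend_gen[OF wp that])
  \<comment> \<open>Multiplicativity is settled first for a word on the left, by linearity in the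
    right factor; linearity in the left factor then gives the general case.\<close>
  have 1: "g (free_gen k u \<cdot> q) = g (free_gen k u) \<otimes>\<^bsub>B\<^esub> g q"
    if u: "u \<in> lists X" and q: "q \<in> carrier FA" for u q
  proof (rule FA_lin_eq[OF B.k_module _ _ _ q])
    show "lin_map k FA B (\<lambda>q. g (free_gen k u \<cdot> q))"
      by (intro lin_map_comp[OF bilin_right[OF FA_mult_bilin] glin] FA_gen_closed u)
    show "lin_map k FA B (\<lambda>q. g (free_gen k u) \<otimes>\<^bsub>B\<^esub> g q)"
      by (intro B.lin_mult_right glin lin_map_closed[OF glin] FA_gen_closed u)
  qed (use u in \<open>simp add: FA_mult_gen ggen wapp del: in_lists_conv_set\<close>)
  have "alg_map k FA B g"
    unfolding alg_map_def
  proof (intro conjI ballI glin)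
    show "g \<one>\<^bsub>FA\<^esub> = \<one>\<^bsub>B\<^esub>" by (simp add: free_algebra_simps ggen) (simp add: word_prod_def)
    fix p q assume p: "p \<in> carrier FA" and q: "q \<in> carrier FA"
    show "g (p \<cdot> q) = g p \<otimes>\<^bsub>B\<^esub> g q"
    proof (rule FA_lin_eq[OF B.k_module _ _ _ p])
      show "lin_map k FA B (\<lambda>p. g (p \<cdot> q))"
        by (intro lin_map_comp[OF bilin_left[OF FA_mult_bilin] glin] q)
      show "lin_map k FA B (\<lambda>p. g p \<otimes>\<^bsub>B\<^esub> g q)"
        by (intro B.lin_mult_left glin lin_map_closed[OF glin] q)
    qed (use 1 q in auto)
  qed
  moreover have "g (free_gen k [x]) = f x" if "x \<in> X" for x
    using that funcset_mem[OF f that] by (subst ggen) (auto simp: word_prod_def)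
  ultimately show ?thesis using that by blast
qed

end

section \<open>The tensor algebra as a quotient of the free algebra\<close>

locale tensor_algebra_of = module k V + field k
  for k :: "('k, 'y) ring_scheme" and V :: "('k, 'v, 'a) module_scheme"
begin

sublocale fa: free_algebra_on k "carrier V"
  by (intro free_algebra_on.intro field_axioms)

text \<open>Isolates the generators of \<open>tensor_algebra_ideal\<close>, so that they can be
  shown to lie in the free algebra and to be killed by a lift. \<open>Hpar_rels\<close> has the same
  purpose for \<open>Hpar_ideal\<close>.\<close>

definition "tensor_algebra_rels =
  (let F = free_algebra k (carrier V); e = (\<lambda>v. free_gen k [v]) in
    {e (v \<oplus>\<^bsub>V\<^esub> w) \<ominus>\<^bsub>F\<^esub> (e v \<oplus>\<^bsub>F\<^esub> e w) | v w. v \<in> carrier V \<and> w \<in> carrier V} \<union>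
    {e (c \<odot>\<^bsub>V\<^esub> v) \<ominus>\<^bsub>F\<^esub> c \<odot>\<^bsub>F\<^esub> e v | c v. c \<in> carrier k \<and> v \<in> carrier V})"

abbreviation "FA \<equiv> free_algebra k (carrier V)"
abbreviation "TA \<equiv> tensor_algebra k V"
abbreviation "\<iota> \<equiv> tensor_algebra_incl k V"

lemma tensor_algebra_ideal_eq: "tensor_algebra_ideal k V = Idl\<^bsub>FA\<^esub> tensor_algebra_rels"
  by (simp only: tensor_algebra_ideal_def tensor_algebra_rels_def Let_def)

lemma gen_closed: "v \<in> carrier V \<Longrightarrow> free_gen k [v] \<in> carrier FA"
  by (rule fa.FA_gen_closed) simp

lemma tensor_algebra_rels_closed: "tensor_algebra_rels \<subseteq> carrier FA"
proof -
  interpret FA: k_algebra k FA by (rule fa.FA_k_algebra)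
  show ?thesis
    unfolding tensor_algebra_rels_def Let_def
    by (auto intro!: FA.minus_closed FA.a_closed FA.smult_closed gen_closed)
qed

sublocale quot: algebra_quotient k FA "tensor_algebra_ideal k V"
proof -
  interpret FA: k_algebra k FA by (rule fa.FA_k_algebra)
  show "algebra_quotient k FA (tensor_algebra_ideal k V)"
    unfolding tensor_algebra_ideal_eq
    by (intro algebra_quotient.intro FA.k_algebra_axioms FA.genideal_ideal tensor_algebra_rels_closed)
qed

lemma TA_k_algebra: "k_algebra k TA"
  unfolding tensor_algebra_def by (rule quot.quotient_k_algebra)

lemma incl_closed: "v \<in> carrier V \<Longrightarrow> \<iota> v \<in> carrier TA"
  unfolding tensor_algebra_def tensor_algebra_incl_def by (intro quot.quot.coset_closed gen_closed)

lemma incl_lin_map: "lin_map k V TA \<iota>"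
proof -
  let ?I = "tensor_algebra_ideal k V"
  have eq: "?I +>\<^bsub>FA\<^esub> x = ?I +>\<^bsub>FA\<^esub> y"
    if "x \<ominus>\<^bsub>FA\<^esub> y \<in> tensor_algebra_rels" "x \<in> carrier FA" "y \<in> carrier FA" for x y
  proof -
    have "x \<ominus>\<^bsub>FA\<^esub> y \<in> ?I"
      using that(1) quot.genideal_self[OF tensor_algebra_rels_closed] unfolding tensor_algebra_ideal_eq by blast
    then show ?thesis using quot.quot.coset_eq_iff[OF that(2,3)] by simp
  qed
  show ?thesis
  proof (rule lin_mapI)
    fix v assume v: "v \<in> carrier V"
    then show "\<iota> v \<in> carrier TA" by (rule incl_closed)
    show "\<iota> (v \<oplus>\<^bsub>V\<^esub> w) = \<iota> v \<oplus>\<^bsub>TA\<^esub> \<iota> w" if w: "w \<in> carrier V" for w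
      unfolding tensor_algebra_incl_def tensor_algebra_def quot.quot.coset_add[OF gen_closed[OF v] gen_closed[OF w]]
      using v w by (intro eq quot.M.a_closed gen_closed M.a_closed) (auto simp: tensor_algebra_rels_def Let_def)
    show "\<iota> (c \<odot>\<^bsub>V\<^esub> v) = c \<odot>\<^bsub>TA\<^esub> \<iota> v" if c: "c \<in> carrier k" for c
      unfolding tensor_algebra_incl_def tensor_algebra_def quot.quot.coset_smult[OF c gen_closed[OF v]]
      using v c by (intro eq quot.smult_closed gen_closed smult_closed) (auto simp: tensor_algebra_rels_def Let_def)
  qed
qed

lemma TA_generated: "carrier TA \<subseteq> alg_generated k TA (\<iota> ` carrier V)"
proof -
  have "(\<lambda>x. tensor_algebra_ideal k V +>\<^bsub>FA\<^esub> x) ` ((\<lambda>x. free_gen k [x]) ` carrier V) = \<iota> ` carrier V"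
    by (simp add: tensor_algebra_incl_def image_image)
  then show ?thesis
    using quot.quotient_generated[OF fa.FA_generated] gen_closed unfolding tensor_algebra_def by force
qed

text \<open>The free algebra gives an algebra map for any function on letters; linearity of
  \<open>f\<close> makes it vanish on the relations.\<close>

lemma TA_lift:
  assumes B: "k_algebra k B" and f: "lin_map k V B f"
  obtains g where "g \<in> alg_hom k TA B" "\<And>v. v \<in> carrier V \<Longrightarrow> g (\<iota> v) = f v"
proof -
  interpret B: k_algebra k B by fact
  have "f \<in> carrier V \<rightarrow> carrier B" using lin_map_closed[OF f] by auto
  then obtain h where h: "alg_map k FA B h" "\<And>x. x \<in> carrier V \<Longrightarrow> h (free_gen k [x]) = f x"
    using fa.FA_lift[OF B] by blast
  note hl = alg_map_lin_map[OF h(1)]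
  have z: "h (x \<ominus>\<^bsub>FA\<^esub> y) = \<zero>\<^bsub>B\<^esub>" if "x \<in> carrier FA" "y \<in> carrier FA" "h x = h y" for x y
    using that lin_map_closed[OF hl]
    by (simp only: lin_map_minus[OF fa.FA_module B.k_module hl]) (simp add: a_minus_def B.r_neg)
  have "h r = \<zero>\<^bsub>B\<^esub>" if "r \<in> tensor_algebra_rels" for r
    using that unfolding tensor_algebra_rels_def Let_def
    by (auto intro!: z quot.M.a_closed quot.smult_closed gen_closed
        simp: lin_map_add[OF hl] lin_map_smult[OF hl] gen_closed h(2) lin_map_add[OF f] lin_map_smult[OF f])
  then obtain g where "g \<in> alg_hom k TA B"
    "\<And>x. x \<in> carrier FA \<Longrightarrow> g (tensor_algebra_ideal k V +>\<^bsub>FA\<^esub> x) = h x"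
    using quot.quotient_alg_lift[OF B h(1) tensor_algebra_ideal_eq _ tensor_algebra_rels_closed]
    unfolding tensor_algebra_def by blast
  then show ?thesis
    using that by (simp add: tensor_algebra_incl_def gen_closed h(2))
qed

end


section \<open>The universal partial representation\<close>

context hopf_algebra
begin

lemmas lin_H = lin_map_id lin_S lin_mult_left lin_mult_right

context
  fixes B :: "('a, 'n, 'z) module_scheme" and \<phi>
  assumes B: "k_algebra k B" and \<phi>: "lin_map k H B \<phi>"
begin

interpretation B: k_algebra k B by (rule B)

lemmas lin_B = lin_map_comp[OF _ \<phi>] B.lin_mult_left B.lin_mult_right

lemma rep_closed: "h \<in> carrier H \<Longrightarrow> \<phi> h \<in> carrier B"
  by (rule lin_map_closed[OF \<phi>])

lemma rep_bilin:
  assumes "h \<in> carrier H"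
  shows "bilin k H H B (\<lambda>l1 l2. \<phi> h \<otimes>\<^bsub>B\<^esub> \<phi> l1 \<otimes>\<^bsub>B\<^esub> \<phi> (antipode H l2))"
    and "bilin k H H B (\<lambda>l1 l2. \<phi> (h \<cdot> l1) \<otimes>\<^bsub>B\<^esub> \<phi> (antipode H l2))"
    and "bilin k H H B (\<lambda>h1 h2. \<phi> h1 \<otimes>\<^bsub>B\<^esub> \<phi> (antipode H h2) \<otimes>\<^bsub>B\<^esub> \<phi> h)"
    and "bilin k H H B (\<lambda>h1 h2. \<phi> h1 \<otimes>\<^bsub>B\<^esub> \<phi> (antipode H h2 \<cdot> h))"
  using assms by - (intro bilinI lin_B lin_H B.m_closed rep_closed m_closed S_closed; assumption)+

text \<open>An algebra map carries the four sides of the partial representation axioms for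
  \<open>\<phi>\<close> to those for its composite with \<open>\<phi>\<close>. It is used for the
  projection onto \<open>Hpar\<close> and for the lift of a given partial representation.\<close>

lemma rep_alg_map:
  assumes C: "k_algebra k C" and g: "alg_map k B C g" and h: "h \<in> carrier H" and l: "l \<in> carrier H"
  shows "g (sw B (\<lambda>l1 l2. \<phi> h \<otimes>\<^bsub>B\<^esub> \<phi> l1 \<otimes>\<^bsub>B\<^esub> \<phi> (antipode H l2)) l) =
      sw C (\<lambda>l1 l2. g (\<phi> h) \<otimes>\<^bsub>C\<^esub> g (\<phi> l1) \<otimes>\<^bsub>C\<^esub> g (\<phi> (antipode H l2))) l"
    and "g (sw B (\<lambda>l1 l2. \<phi> (h \<cdot> l1) \<otimes>\<^bsub>B\<^esub> \<phi> (antipode H l2)) l) =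
      sw C (\<lambda>l1 l2. g (\<phi> (h \<cdot> l1)) \<otimes>\<^bsub>C\<^esub> g (\<phi> (antipode H l2))) l"
    and "g (sw B (\<lambda>h1 h2. \<phi> h1 \<otimes>\<^bsub>B\<^esub> \<phi> (antipode H h2) \<otimes>\<^bsub>B\<^esub> \<phi> l) h) =
      sw C (\<lambda>h1 h2. g (\<phi> h1) \<otimes>\<^bsub>C\<^esub> g (\<phi> (antipode H h2)) \<otimes>\<^bsub>C\<^esub> g (\<phi> l)) h"
    and "g (sw B (\<lambda>h1 h2. \<phi> h1 \<otimes>\<^bsub>B\<^esub> \<phi> (antipode H h2 \<cdot> l)) h) =
      sw C (\<lambda>h1 h2. g (\<phi> h1) \<otimes>\<^bsub>C\<^esub> g (\<phi> (antipode H h2 \<cdot> l))) h"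
  unfolding lin_map_sw[OF B.k_module k_algebra.k_module[OF C] alg_map_lin_map[OF g] rep_bilin(1)[OF h] l]
    lin_map_sw[OF B.k_module k_algebra.k_module[OF C] alg_map_lin_map[OF g] rep_bilin(2)[OF h] l]
    lin_map_sw[OF B.k_module k_algebra.k_module[OF C] alg_map_lin_map[OF g] rep_bilin(3)[OF l] h]
    lin_map_sw[OF B.k_module k_algebra.k_module[OF C] alg_map_lin_map[OF g] rep_bilin(4)[OF l] h]
  using h l
  by (auto intro!: sweedler_cong simp: alg_map_mult[OF g] rep_closed S_closed)

end

sublocale ta: tensor_algebra_of k H
  by (intro tensor_algebra_of.intro k_module field_axioms)

abbreviation "T \<equiv> tensor_algebra k H"
abbreviation "\<iota> \<equiv> tensor_algebra_incl k H"
abbreviation "S \<equiv> antipode H"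

definition "Hpar_rels =
  {\<iota> \<one>\<^bsub>H\<^esub> \<ominus>\<^bsub>T\<^esub> \<one>\<^bsub>T\<^esub>} \<union>
  {sweedler k H T (\<lambda>l1 l2. \<iota> h \<otimes>\<^bsub>T\<^esub> \<iota> l1 \<otimes>\<^bsub>T\<^esub> \<iota> (S l2)) l
     \<ominus>\<^bsub>T\<^esub> sweedler k H T (\<lambda>l1 l2. \<iota> (h \<cdot> l1) \<otimes>\<^bsub>T\<^esub> \<iota> (S l2)) l
     | h l. h \<in> carrier H \<and> l \<in> carrier H} \<union>
  {sweedler k H T (\<lambda>h1 h2. \<iota> h1 \<otimes>\<^bsub>T\<^esub> \<iota> (S h2) \<otimes>\<^bsub>T\<^esub> \<iota> l) h
     \<ominus>\<^bsub>T\<^esub> sweedler k H T (\<lambda>h1 h2. \<iota> h1 \<otimes>\<^bsub>T\<^esub> \<iota> (S h2 \<cdot> l)) h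
     | h l. h \<in> carrier H \<and> l \<in> carrier H}"

lemma Hpar_ideal_eq: "Hpar_ideal k H = Idl\<^bsub>T\<^esub> Hpar_rels"
  by (simp only: Hpar_ideal_def Hpar_rels_def Let_def)

lemma T_k_algebra: "k_algebra k T"
  by (rule ta.TA_k_algebra)

lemma T_module: "module k T"
  by (rule k_algebra.k_module[OF T_k_algebra])

lemmas incl_lin = ta.incl_lin_map
lemmas rep_bilin_T = rep_bilin[OF T_k_algebra incl_lin]
lemmas sw_T_closed = sw_closed[OF T_module rep_bilin_T(1)] sw_closed[OF T_module rep_bilin_T(2)]
  sw_closed[OF T_module rep_bilin_T(3)] sw_closed[OF T_module rep_bilin_T(4)]

lemma Hpar_rels_closed: "Hpar_rels \<subseteq> carrier T"
proof -
  interpret T: k_algebra k T by (rule T_k_algebra)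
  show ?thesis
    unfolding Hpar_rels_def by (auto intro!: T.minus_closed ta.incl_closed sw_T_closed)
qed

sublocale pq: algebra_quotient k T "Hpar_ideal k H"
proof -
  interpret T: k_algebra k T by (rule T_k_algebra)
  show "algebra_quotient k T (Hpar_ideal k H)"
    unfolding Hpar_ideal_eq
    by (intro algebra_quotient.intro T.k_algebra_axioms T.genideal_ideal Hpar_rels_closed)
qed

abbreviation "P \<equiv> Hpar k H"
abbreviation "b \<equiv> br k H"
abbreviation (input) mult_P (infixl "\<star>" 70) where "x \<star> y \<equiv> x \<otimes>\<^bsub>P\<^esub> y"

lemma P_k_algebra: "k_algebra k P"
  unfolding Hpar_def by (rule pq.quotient_k_algebra)

sublocale P: k_algebra k P
  by (rule P_k_algebra)

lemma P_module: "module k P"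
  by (rule P.k_module)

lemma P_proj: "alg_map k T P (\<lambda>x. Hpar_ideal k H +>\<^bsub>T\<^esub> x)"
  unfolding Hpar_def by (rule pq.coset_alg_map)

lemma b_lin: "lin_map k H P b"
  using lin_map_comp[OF incl_lin alg_map_lin_map[OF P_proj]] unfolding br_def[abs_def] .

lemma b_closed: "h \<in> carrier H \<Longrightarrow> b h \<in> carrier P"
  by (rule lin_map_closed[OF b_lin])

text \<open>The source of uniqueness in the universal property, and of the induction proving that
  morphisms commute with the action of \<open>Hpar\<close>.\<close>

lemma Hpar_generated: "carrier P \<subseteq> alg_generated k P (b ` carrier H)"
proof -
  have "(\<lambda>x. Hpar_ideal k H +>\<^bsub>T\<^esub> x) ` (\<iota> ` carrier H) = b ` carrier H"
    by (simp add: br_def image_image)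
  then show ?thesis
    using pq.quotient_generated[OF ta.TA_generated] ta.incl_closed unfolding Hpar_def by force
qed

lemma br_partial_rep: "partial_rep k H P b"
proof -
  let ?p = "\<lambda>x. Hpar_ideal k H +>\<^bsub>T\<^esub> x"
  have eq: "?p x = ?p y" if "x \<ominus>\<^bsub>T\<^esub> y \<in> Hpar_rels" "x \<in> carrier T" "y \<in> carrier T" for x y
  proof -
    have "x \<ominus>\<^bsub>T\<^esub> y \<in> Hpar_ideal k H"
      using that(1) pq.genideal_self[OF Hpar_rels_closed] unfolding Hpar_ideal_eq by blast
    then show ?thesis using pq.quot.coset_eq_iff[OF that(2,3)] by simp
  qed
  note ev = rep_alg_map[OF T_k_algebra incl_lin P_k_algebra P_proj, folded br_def]
  show ?thesis
    unfolding partial_rep_def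
  proof (intro conjI ballI b_lin)
    have "?p (\<iota> \<one>\<^bsub>H\<^esub>) = ?p \<one>\<^bsub>T\<^esub>"
      by (rule eq) (auto simp: Hpar_rels_def ta.incl_closed)
    then show "b \<one>\<^bsub>H\<^esub> = \<one>\<^bsub>P\<^esub>"
      using alg_map_one[OF P_proj] by (simp add: br_def)
  next
    fix h l assume hl: "h \<in> carrier H" "l \<in> carrier H"
    have "?p (sw T (\<lambda>l1 l2. \<iota> h \<otimes>\<^bsub>T\<^esub> \<iota> l1 \<otimes>\<^bsub>T\<^esub> \<iota> (S l2)) l) =
        ?p (sw T (\<lambda>l1 l2. \<iota> (h \<cdot> l1) \<otimes>\<^bsub>T\<^esub> \<iota> (S l2)) l)"
      using hl by (intro eq sw_T_closed) (auto simp: Hpar_rels_def)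
    then show "sw P (\<lambda>l1 l2. b h \<star> b l1 \<star> b (S l2)) l = sw P (\<lambda>l1 l2. b (h \<cdot> l1) \<star> b (S l2)) l"
      unfolding ev(1)[OF hl] ev(2)[OF hl] .
    have "?p (sw T (\<lambda>h1 h2. \<iota> h1 \<otimes>\<^bsub>T\<^esub> \<iota> (S h2) \<otimes>\<^bsub>T\<^esub> \<iota> l) h) =
        ?p (sw T (\<lambda>h1 h2. \<iota> h1 \<otimes>\<^bsub>T\<^esub> \<iota> (S h2 \<cdot> l)) h)"
      using hl by (intro eq sw_T_closed) (auto simp: Hpar_rels_def)
    then show "sw P (\<lambda>h1 h2. b h1 \<star> b (S h2) \<star> b l) h = sw P (\<lambda>h1 h2. b h1 \<star> b (S h2 \<cdot> l)) h"
      unfolding ev(3)[OF hl] ev(4)[OF hl] .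
  qed
qed

text \<open>The lift to the tensor algebra kills each relation because \<open>\<pi>\<close>
  satisfies the corresponding axiom. Uniqueness holds since the elements \<open>b h\<close>
  generate. Unique existence is what gives \<open>Hpar_action\<close> a value.\<close>

lemma Hpar_universal:
  assumes B: "k_algebra k B" and \<pi>: "partial_rep k H B \<pi>"
  shows "\<exists>!\<Phi>. \<Phi> \<in> alg_hom k P B \<and> (\<forall>h\<in>carrier H. \<Phi> (b h) = \<pi> h)"
proof (rule ex_ex1I)
  interpret B: k_algebra k B by fact
  have \<pi>lin: "lin_map k H B \<pi>" using \<pi> by (simp add: partial_rep_def)
  obtain g where g: "g \<in> alg_hom k T B" "\<And>h. h \<in> carrier H \<Longrightarrow> g (\<iota> h) = \<pi> h"
    using ta.TA_lift[OF B \<pi>lin] by blast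
  have ga: "alg_map k T B g" using g(1) by (simp add: alg_hom_iff)
  note gl = alg_map_lin_map[OF ga]
  interpret T: k_algebra k T by (rule T_k_algebra)
  have z: "g (x \<ominus>\<^bsub>T\<^esub> y) = \<zero>\<^bsub>B\<^esub>" if "x \<in> carrier T" "y \<in> carrier T" "g x = g y" for x y
    using that lin_map_closed[OF gl]
    by (simp only: lin_map_minus[OF T_module B.k_module gl]) (simp add: a_minus_def B.r_neg)
  note ev = rep_alg_map[OF T_k_algebra incl_lin B ga]
  have "g s = \<zero>\<^bsub>B\<^esub>" if "s \<in> Hpar_rels" for s
  proof -
    have 1: "g (\<iota> \<one>\<^bsub>H\<^esub> \<ominus>\<^bsub>T\<^esub> \<one>\<^bsub>T\<^esub>) = \<zero>\<^bsub>B\<^esub>"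
      using \<pi> by (intro z) (auto simp: ta.incl_closed g(2) alg_map_one[OF ga] partial_rep_def)
    have 2: "g (sw T (\<lambda>l1 l2. \<iota> h \<otimes>\<^bsub>T\<^esub> \<iota> l1 \<otimes>\<^bsub>T\<^esub> \<iota> (S l2)) l \<ominus>\<^bsub>T\<^esub>
        sw T (\<lambda>l1 l2. \<iota> (h \<cdot> l1) \<otimes>\<^bsub>T\<^esub> \<iota> (S l2)) l) = \<zero>\<^bsub>B\<^esub>"
      if hl: "h \<in> carrier H" "l \<in> carrier H" for h l
      using hl \<pi> by (intro z sw_T_closed)
        (auto simp: ev g(2) S_closed partial_rep_def cong: sweedler_cong)
    have 3: "g (sw T (\<lambda>h1 h2. \<iota> h1 \<otimes>\<^bsub>T\<^esub> \<iota> (S h2) \<otimes>\<^bsub>T\<^esub> \<iota> l) h \<ominus>\<^bsub>T\<^esub>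
        sw T (\<lambda>h1 h2. \<iota> h1 \<otimes>\<^bsub>T\<^esub> \<iota> (S h2 \<cdot> l)) h) = \<zero>\<^bsub>B\<^esub>"
      if hl: "h \<in> carrier H" "l \<in> carrier H" for h l
      using hl \<pi> by (intro z sw_T_closed)
        (auto simp: ev g(2) S_closed partial_rep_def cong: sweedler_cong)
    show ?thesis
      using that 1 2 3 unfolding Hpar_rels_def by auto
  qed
  then obtain \<Phi> where "\<Phi> \<in> alg_hom k P B" "\<And>x. x \<in> carrier T \<Longrightarrow> \<Phi> (Hpar_ideal k H +>\<^bsub>T\<^esub> x) = g x"
    using pq.quotient_alg_lift[OF B ga Hpar_ideal_eq _ Hpar_rels_closed] unfolding Hpar_def by blast
  then show "\<exists>\<Phi>. \<Phi> \<in> alg_hom k P B \<and> (\<forall>h\<in>carrier H. \<Phi> (b h) = \<pi> h)"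
    by (intro exI[of _ \<Phi>]) (simp add: br_def g(2) ta.incl_closed)
next
  fix \<Phi> \<Psi>
  assume a: "\<Phi> \<in> alg_hom k P B \<and> (\<forall>h\<in>carrier H. \<Phi> (b h) = \<pi> h)"
    and b: "\<Psi> \<in> alg_hom k P B \<and> (\<forall>h\<in>carrier H. \<Psi> (b h) = \<pi> h)"
  show "\<Phi> = \<Psi>"
  proof (rule extensionalityI)
    show "\<Phi> x = \<Psi> x" if "x \<in> carrier P" for x
    proof (rule alg_map_eqI[OF _ _ P_k_algebra])
      show "x \<in> alg_generated k P (b ` carrier H)" using that Hpar_generated by blast
    qed (use a b b_closed in \<open>auto simp: alg_hom_iff\<close>)
  qed (use a b in \<open>auto simp: alg_hom_iff\<close>)
qed

end


section \<open>The algebra \<open>A\<^sub>p\<^sub>a\<^sub>r\<close>\<close>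

context hopf_algebra
begin

lemma sw_plus:
  assumes N: "module k N" and t: "bilin k H H N (\<lambda>x y. t x y)" and t': "bilin k H H N (\<lambda>x y. t' x y)"
    and h: "h \<in> carrier H"
  shows "sw N (\<lambda>x y. t x y \<oplus>\<^bsub>N\<^esub> t' x y) h = sw N (\<lambda>x y. t x y) h \<oplus>\<^bsub>N\<^esub> sw N (\<lambda>x y. t' x y) h"
proof -
  have b: "bilin k H H N (\<lambda>x y. t x y \<oplus>\<^bsub>N\<^esub> t' x y)"
    using t t' by (intro bilinI lin_map_plus N) (auto simp: bilin_def)
  note L = HH.tensor_lift_lin_map[OF N b] HH.tensor_lift_lin_map[OF N t] HH.tensor_lift_lin_map[OF N t']
  show ?thesis
    unfolding sweedler_def
    by (rule HH.tensor_lin_eqI[OF N L(1) lin_map_plus[OF N L(2,3)] _ comult_closed[OF h]])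
      (simp add: HH.tensor_lift_tens[OF N b] HH.tensor_lift_tens[OF N t] HH.tensor_lift_tens[OF N t'])
qed

text \<open>Introduction rules that reduce bilinearity, linearity in a parameter and membership of a
  nested Sweedler expression to its constituents; they discharge the side conditions of the
  calculations below.\<close>

lemmas sw_rules = bilinI lin_map_id lin_S lin_mult_left lin_mult_right
  lin_map_comp[OF _ b_lin] P.lin_mult_left P.lin_mult_right lin_sw_argument lin_sw_parameter sw_closed
  lin_counit lin_smult lin_map_plus
  P.m_closed m_closed S_closed b_closed P_module H_module counit_closed

text \<open>In Sweedler notation: S(h1 l) h2 = S(h1 l1) h2 l2 S(l3) = counit(h l1) S(l2) = counit(h)
  S(l). The map \<open>g\<close> makes the rule applicable inside a product in
  \<open>Hpar\<close>.\<close>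

lemma antipode_mult_cancel:
  assumes N: "module k N" and g: "lin_map k H N g" and h: "h \<in> carrier H" and l: "l \<in> carrier H"
  shows "sw N (\<lambda>x y. g (S (x \<cdot> l) \<cdot> y)) h = counit H h \<odot>\<^bsub>N\<^esub> g (S l)"
proof -
  interpret N: module k N by fact
  note rules = sw_rules lin_map_comp[OF _ g] N
  have gc: "g z \<in> carrier N" if "z \<in> carrier H" for z
    using lin_map_closed[OF g that] .
  have 1: "g (S (x \<cdot> l) \<cdot> y) =
      sw N (\<lambda>v q. sw N (\<lambda>u p. g (S (x \<cdot> u) \<cdot> (y \<cdot> p) \<cdot> S q)) v) l"
    if xy: "x \<in> carrier H" "y \<in> carrier H" for x y
  proof -
    \<comment> \<open>A counit of the second leg of \<open>l\<close> is inserted, to be expanded by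
      the antipode axiom as p S(q).\<close>
    have "g (S (x \<cdot> l) \<cdot> y) = sw N (\<lambda>u v. counit H v \<odot>\<^bsub>N\<^esub> g (S (x \<cdot> u) \<cdot> y)) l"
      using xy l by (intro counit_right_map[symmetric]; (intro rules)?)
    also have "\<dots> = sw N (\<lambda>u v. sw N (\<lambda>p q. g (S (x \<cdot> u) \<cdot> y \<cdot> (p \<cdot> S q))) v) l"
    proof (rule sweedler_cong)
      fix u v assume uv: "u \<in> carrier H" "v \<in> carrier H"
      have "sw N (\<lambda>p q. g (S (x \<cdot> u) \<cdot> y \<cdot> (p \<cdot> S q))) v =
          counit H v \<odot>\<^bsub>N\<^esub> g (S (x \<cdot> u) \<cdot> y \<cdot> \<one>\<^bsub>H\<^esub>)"
        using xy uv by (intro antipode_right_map[where g = "\<lambda>z. g (S (x \<cdot> u) \<cdot> y \<cdot> z)"]; (intro rules)?)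
      then show "counit H v \<odot>\<^bsub>N\<^esub> g (S (x \<cdot> u) \<cdot> y) =
          sw N (\<lambda>p q. g (S (x \<cdot> u) \<cdot> y \<cdot> (p \<cdot> S q))) v"
        using xy uv by (simp add: S_closed)
    qed
    \<comment> \<open>Coassociativity regroups the legs so that \<open>u\<close> and
      \<open>p\<close> come from the same element \<open>v\<close>, as needed to form the coproduct
      of \<open>h \<cdot> v\<close>.\<close>
    also have "\<dots> = sw N (\<lambda>v q. sw N (\<lambda>u p. g (S (x \<cdot> u) \<cdot> y \<cdot> (p \<cdot> S q))) v) l"
      using xy l by (intro sw_assoc[symmetric]; (intro rules)?)
    finally show ?thesis
      using xy by (simp add: S_closed m_assoc cong: sweedler_cong)
  qed
  have "sw N (\<lambda>x y. g (S (x \<cdot> l) \<cdot> y)) h =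
      sw N (\<lambda>x y. sw N (\<lambda>v q. sw N (\<lambda>u p. g (S (x \<cdot> u) \<cdot> (y \<cdot> p) \<cdot> S q)) v) l) h"
    by (intro sweedler_cong 1)
  also have "\<dots> =
      sw N (\<lambda>v q. sw N (\<lambda>x y. sw N (\<lambda>u p. g (S (x \<cdot> u) \<cdot> (y \<cdot> p) \<cdot> S q)) v) h) l"
    using h l by (intro sw_swap; (intro rules)?)
  \<comment> \<open>The legs x u and y p are those of \<open>h \<cdot> v\<close>; contracting the
    double sum prepares the antipode axiom for this product.\<close>
  also have "\<dots> = sw N (\<lambda>v q. sw N (\<lambda>m n. g (S m \<cdot> n \<cdot> S q)) (h \<cdot> v)) l"
    using h by (intro sweedler_cong sw_mult[symmetric, where t = "\<lambda>m n. g (S m \<cdot> n \<cdot> S _)"]; (intro rules)?)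
  also have "\<dots> = sw N (\<lambda>v q. counit H (h \<cdot> v) \<odot>\<^bsub>N\<^esub> g (\<one>\<^bsub>H\<^esub> \<cdot> S q)) l"
    using h by (intro sweedler_cong antipode_left_map[where g = "\<lambda>z. g (z \<cdot> S _)"]; (intro rules)?)
  also have "\<dots> = sw N (\<lambda>v q. counit H v \<odot>\<^bsub>N\<^esub> (counit H h \<odot>\<^bsub>N\<^esub> g (S q))) l"
    using h by (intro sweedler_cong)
      (simp add: S_closed ring_hom_mult[OF counit_hom] counit_closed gc m_comm flip: N.smult_assoc1)
  also have "\<dots> = counit H h \<odot>\<^bsub>N\<^esub> g (S l)"
    using h l by (intro counit_left_map; (intro rules)?)
  finally show ?thesis .
qed

section \<open>Relations between \<open>eps\<close> and the generators \<open>b h\<close>\<close>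

abbreviation "eps \<equiv> Hpar_eps k H"

lemma eps_eq: "eps h = sw P (\<lambda>x y. b x \<star> b (S y)) h"
  by (simp add: Hpar_eps_def)

lemma eps_lin: "lin_map k H P eps"
  unfolding eps_eq[abs_def] by (intro sw_rules)

lemma eps_closed: "h \<in> carrier H \<Longrightarrow> eps h \<in> carrier P"
  by (rule lin_map_closed[OF eps_lin])

lemma br_left:
  "h \<in> carrier H \<Longrightarrow> l \<in> carrier H \<Longrightarrow>
    sw P (\<lambda>l1 l2. b h \<star> b l1 \<star> b (S l2)) l = sw P (\<lambda>l1 l2. b (h \<cdot> l1) \<star> b (S l2)) l"
  using br_partial_rep by (simp add: partial_rep_def)

text \<open>The second axiom of a partial representation, once right multiplication by
  \<open>b l\<close> has been moved inside the sum defining \<open>eps h\<close>.\<close>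

lemma eps_mult_br:
  assumes h: "h \<in> carrier H" and l: "l \<in> carrier H"
  shows "eps h \<star> b l = sw P (\<lambda>x y. b x \<star> b (S y \<cdot> l)) h"
proof -
  have "eps h \<star> b l = sw P (\<lambda>x y. b x \<star> b (S y) \<star> b l) h"
    unfolding eps_eq using h l by (intro lin_map_sw[where g = "\<lambda>z. z \<star> b l"]; (intro sw_rules)?)
  then show ?thesis
    using br_partial_rep h l by (simp add: partial_rep_def)
qed

text \<open>Expanding eps(h1) gives [h1] [S(h2) h3 l]; the antipode and counit axioms remove the
  last two legs. Note that the product \<open>[h][l]\<close> remains, not the class of the product h
  l.\<close>

lemma eps_br_collapse:
  assumes h: "h \<in> carrier H" and l: "l \<in> carrier H"
  shows "sw P (\<lambda>x y. eps x \<star> b (y \<cdot> l)) h = b h \<star> b l"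
proof -
  have "sw P (\<lambda>x y. eps x \<star> b (y \<cdot> l)) h =
      sw P (\<lambda>x y. sw P (\<lambda>u v. b u \<star> b (S v \<cdot> (y \<cdot> l))) x) h"
    using l by (intro sweedler_cong eps_mult_br m_closed)
  also have "\<dots> = sw P (\<lambda>u x. sw P (\<lambda>v y. b u \<star> b (S v \<cdot> (y \<cdot> l))) x) h"
    using h l by (intro sw_assoc; (intro sw_rules)?)
  also have "\<dots> = sw P (\<lambda>u x. sw P (\<lambda>v y. b u \<star> b (S v \<cdot> y \<cdot> l)) x) h"
    using l by (intro sweedler_cong) (simp add: S_closed m_assoc)
  also have "\<dots> = sw P (\<lambda>u x. counit H x \<odot>\<^bsub>P\<^esub> (b u \<star> b (\<one>\<^bsub>H\<^esub> \<cdot> l))) h"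
    using l by (intro sweedler_cong antipode_left_map[where g = "\<lambda>z. b _ \<star> b (z \<cdot> l)"]; (intro sw_rules)?)
  also have "\<dots> = sw P (\<lambda>u x. counit H x \<odot>\<^bsub>P\<^esub> (b u \<star> b l)) h"
    using l by simp
  also have "\<dots> = b h \<star> b l"
    using h l by (intro counit_right_map; (intro sw_rules)?)
  finally show ?thesis .
qed

text \<open>Starting from the right: eps(h1 l) [h2] = [h1 l1] [S(h2 l2) h3] = [h l1] [S(l2)] by the
  antipode cancellation, and the first axiom splits [h l1] into [h] [l1].\<close>

lemma br_mult_eps:
  assumes h: "h \<in> carrier H" and l: "l \<in> carrier H"
  shows "b h \<star> eps l = sw P (\<lambda>x y. eps (x \<cdot> l) \<star> b y) h"
proof -
  have "sw P (\<lambda>x y. eps (x \<cdot> l) \<star> b y) h =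
      sw P (\<lambda>x y. sw P (\<lambda>u v. b u \<star> b (S v \<cdot> y)) (x \<cdot> l)) h"
    using l by (intro sweedler_cong eps_mult_br m_closed)
  also have "\<dots> = sw P (\<lambda>x y. sw P (\<lambda>x1 x2. sw P (\<lambda>l1 l2.
      b (x1 \<cdot> l1) \<star> b (S (x2 \<cdot> l2) \<cdot> y)) l) x) h"
    using l by (intro sweedler_cong sw_mult; (intro sw_rules)?)
  also have "\<dots> = sw P (\<lambda>x1 x. sw P (\<lambda>x2 y. sw P (\<lambda>l1 l2.
      b (x1 \<cdot> l1) \<star> b (S (x2 \<cdot> l2) \<cdot> y)) l) x) h"
    using h l by (intro sw_assoc; (intro sw_rules)?)
  \<comment> \<open>The sums over \<open>x\<close> and \<open>l\<close> are exchanged, which puts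
    the legs \<open>x2\<close> and \<open>y\<close> of \<open>x\<close> innermost, where they cancel
    against the antipode.\<close>
  also have "\<dots> = sw P (\<lambda>x1 x. sw P (\<lambda>l1 l2. sw P (\<lambda>x2 y.
      b (x1 \<cdot> l1) \<star> b (S (x2 \<cdot> l2) \<cdot> y)) x) l) h"
    using l by (intro sweedler_cong sw_swap; (intro sw_rules)?)
  also have "\<dots> = sw P (\<lambda>x1 x. sw P (\<lambda>l1 l2.
      counit H x \<odot>\<^bsub>P\<^esub> (b (x1 \<cdot> l1) \<star> b (S l2))) l) h"
    by (intro sweedler_cong antipode_mult_cancel[where g = "\<lambda>z. b _ \<star> b z"]; (intro sw_rules)?)
  also have "\<dots> = sw P (\<lambda>l1 l2. sw P (\<lambda>x1 x.
      counit H x \<odot>\<^bsub>P\<^esub> (b (x1 \<cdot> l1) \<star> b (S l2))) h) l"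
    using h l by (intro sw_swap; (intro sw_rules)?)
  also have "\<dots> = sw P (\<lambda>l1 l2. b (h \<cdot> l1) \<star> b (S l2)) l"
    using h by (intro sweedler_cong counit_right_map; (intro sw_rules)?)
  also have "\<dots> = sw P (\<lambda>l1 l2. b h \<star> b l1 \<star> b (S l2)) l"
    using h l by (rule br_left[symmetric])
  also have "\<dots> = sw P (\<lambda>l1 l2. b h \<star> (b l1 \<star> b (S l2))) l"
    using h by (intro sweedler_cong P.m_assoc b_closed S_closed)
  also have "\<dots> = b h \<star> eps l"
    unfolding eps_eq using h l by (intro lin_map_sw[where g = "\<lambda>z. b h \<star> z", symmetric]; (intro sw_rules)?)
  finally show ?thesis by simp
qed

section \<open>\<open>Apar\<close> as a subspace of \<open>Hpar\<close> and its action of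
  \<open>H\<close>\<close>

abbreviation "A \<equiv> Apar k H"

lemma Apar_simps:
  "carrier A = alg_generated k P (eps ` carrier H)" "add A = add P" "zero A = zero P" "smult A = smult P"
  "mult A = mult P" "one A = one P"
  "act A h a = sw P (\<lambda>h1 h2. b h1 \<star> a \<star> b (S h2)) h"
  by (simp_all add: Apar_def with_action_def)

lemma Apar_incl: "a \<in> carrier A \<Longrightarrow> a \<in> carrier P"
proof -
  have "alg_map k P P (\<lambda>x. x)" by (simp add: alg_map_def lin_map_id)
  then show "a \<in> carrier A \<Longrightarrow> a \<in> carrier P"
    unfolding Apar_simps using eps_closed
    by (intro conjunct1[OF alg_map_alg_generated[OF _ P_k_algebra]]) auto
qed

text \<open>Zero belongs to the generated set as the multiple of the unit by the scalar zero; the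
  action field of \<open>Apar\<close> is irrelevant to the module laws.\<close>

lemma Apar_module: "module k A"
proof (rule module_cong)
  have "submodule (carrier A) k P"
  proof (rule P.submodule_criterion)
    have "\<zero>\<^bsub>k\<^esub> \<odot>\<^bsub>P\<^esub> \<one>\<^bsub>P\<^esub> \<in> carrier A"
      unfolding Apar_simps by (intro alg_generated.intros) auto
    then show "\<zero>\<^bsub>P\<^esub> \<in> carrier A" by simp
  qed (auto simp: Apar_incl, auto simp: Apar_simps intro: alg_generated.intros)
  then show "module k (P\<lparr>carrier := carrier A\<rparr>)"
    by (rule submodule.submodule_is_module[OF _ P_module])
qed (simp_all add: Apar_simps)

lemma Apar_incl_lin: "lin_map k A P (\<lambda>a. a)"
  by (intro lin_mapI) (auto simp: Apar_incl Apar_simps(2-))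

lemma lin_map_Apar:
  assumes "lin_map k V P f" "\<And>x. x \<in> carrier V \<Longrightarrow> f x \<in> carrier A" shows "lin_map k V A f"
  using assms by (simp add: lin_map_def Apar_simps(2-) Pi_def)

text \<open>Sweedler sums are formed with values in \<open>Hpar\<close>, and as definite
  descriptions they do not visibly stay in \<open>Apar\<close>. The sum formed in
  \<open>Apar\<close> does, and the linear inclusion maps it to the one formed in
  \<open>Hpar\<close>.\<close>

lemma sw_Apar:
  assumes "bilin k H H P (\<lambda>x y. t x y)" "\<And>x y. x \<in> carrier H \<Longrightarrow> y \<in> carrier H \<Longrightarrow> t x y \<in> carrier A"
    and h: "h \<in> carrier H"
  shows "sw P (\<lambda>x y. t x y) h \<in> carrier A"
proof -
  have b: "bilin k H H A (\<lambda>x y. t x y)"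
    using assms(1,2) by (intro bilinI lin_map_Apar) (auto simp: bilin_def)
  then have "sw A (\<lambda>x y. t x y) h \<in> carrier A"
    using h by (intro sw_closed Apar_module)
  then show ?thesis
    using lin_map_sw[OF Apar_module P_module Apar_incl_lin b h] by simp
qed

text \<open>\<open>f\<close> is linear into \<open>Hpar\<close>, where the products with
  \<open>b y\<close> live, while its values are required to lie in \<open>Apar\<close>. Only the
  existence of some \<open>f\<close> for each \<open>a\<close> is used, not a dependence on
  \<open>a\<close>.\<close>

definition moves_left :: "('c list \<Rightarrow> 'a) set set \<Rightarrow> ('c \<Rightarrow> ('c list \<Rightarrow> 'a) set set) \<Rightarrow> bool"
  where "moves_left a f \<longleftrightarrow> lin_map k H P f \<and> (\<forall>h\<in>carrier H. f h \<in> carrier A) \<and>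
    (\<forall>h\<in>carrier H. b h \<star> a = sw P (\<lambda>x y. f x \<star> b y) h)"

text \<open>The unit is moved by the counit times the unit, and \<open>eps l\<close> by h -> eps(h
  l) through \<open>br_mult_eps\<close>. Sums and scalar multiples are taken pointwise, and a
  product is moved by the convolution f(h1) f'(h2).\<close>

lemma moves_left_ex:
  assumes "a \<in> carrier A" shows "\<exists>f. moves_left a f"
  using assms unfolding Apar_simps(1)
proof induction
  case one
  have "moves_left \<one>\<^bsub>P\<^esub> (\<lambda>h. counit H h \<odot>\<^bsub>P\<^esub> \<one>\<^bsub>P\<^esub>)"
    unfolding moves_left_def
  proof (intro conjI ballI)
    show "lin_map k H P (\<lambda>h. counit H h \<odot>\<^bsub>P\<^esub> \<one>\<^bsub>P\<^esub>)" by (intro sw_rules P.one_closed)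
    fix h assume h: "h \<in> carrier H"
    then show "counit H h \<odot>\<^bsub>P\<^esub> \<one>\<^bsub>P\<^esub> \<in> carrier A"
      unfolding Apar_simps by (intro alg_generated.intros counit_closed)
    have "sw P (\<lambda>x y. counit H x \<odot>\<^bsub>P\<^esub> \<one>\<^bsub>P\<^esub> \<star> b y) h = sw P (\<lambda>x y. counit H x \<odot>\<^bsub>P\<^esub> b y) h"
      by (intro sweedler_cong) (simp add: P.smult_mult_left counit_closed b_closed)
    also have "\<dots> = b h" using h by (intro counit_left_map; (intro sw_rules)?)
    finally show "b h \<star> \<one>\<^bsub>P\<^esub> = sw P (\<lambda>x y. counit H x \<odot>\<^bsub>P\<^esub> \<one>\<^bsub>P\<^esub> \<star> b y) h"
      using h by (simp add: b_closed)
  qed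
  then show ?case by blast
next
  case (incl a)
  then obtain l where l: "l \<in> carrier H" "a = eps l" by auto
  have "moves_left a (\<lambda>h. eps (h \<cdot> l))"
    unfolding moves_left_def
    using l by (intro conjI ballI lin_map_comp[OF _ eps_lin] sw_rules)
      (auto simp: Apar_simps br_mult_eps intro: alg_generated.incl)
  then show ?case by blast
next
  case (add a a')
  then obtain f f' where f: "moves_left a f" and f': "moves_left a' f'" by blast
  note r = sw_rules lin_map_comp[of k _ H _ P f] lin_map_comp[of k _ H _ P f']
  have ac: "a \<in> carrier P" "a' \<in> carrier P"
    using add Apar_incl by (simp_all add: Apar_simps)
  have fl: "lin_map k H P f" "lin_map k H P f'" using f f' by (simp_all add: moves_left_def)
  have "moves_left (a \<oplus>\<^bsub>P\<^esub> a') (\<lambda>h. f h \<oplus>\<^bsub>P\<^esub> f' h)"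
    unfolding moves_left_def
  proof (intro conjI ballI)
    show "lin_map k H P (\<lambda>h. f h \<oplus>\<^bsub>P\<^esub> f' h)" using fl by (intro lin_map_plus P_module)
    fix h assume h: "h \<in> carrier H"
    then show "f h \<oplus>\<^bsub>P\<^esub> f' h \<in> carrier A"
      using f f' by (auto simp: moves_left_def Apar_simps intro: alg_generated.add)
    have "b h \<star> (a \<oplus>\<^bsub>P\<^esub> a') = b h \<star> a \<oplus>\<^bsub>P\<^esub> b h \<star> a'"
      using ac h by (simp add: P.r_distr b_closed)
    also have "\<dots> = sw P (\<lambda>x y. f x \<star> b y) h \<oplus>\<^bsub>P\<^esub> sw P (\<lambda>x y. f' x \<star> b y) h"
      using f f' h by (simp add: moves_left_def)
    also have "\<dots> = sw P (\<lambda>x y. f x \<star> b y \<oplus>\<^bsub>P\<^esub> f' x \<star> b y) h"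
      using h fl by (intro sw_plus[symmetric]; (intro sw_rules lin_map_closed[OF fl(1)] lin_map_closed[OF fl(2)])?)
    also have "\<dots> = sw P (\<lambda>x y. (f x \<oplus>\<^bsub>P\<^esub> f' x) \<star> b y) h"
      using lin_map_closed[OF fl(1)] lin_map_closed[OF fl(2)]
      by (intro sweedler_cong) (simp add: P.l_distr b_closed)
    finally show "b h \<star> (a \<oplus>\<^bsub>P\<^esub> a') = sw P (\<lambda>x y. (f x \<oplus>\<^bsub>P\<^esub> f' x) \<star> b y) h" .
  qed
  then show ?case by blast
next
  case (smult c a)
  then obtain f where f: "moves_left a f" by blast
  have ac: "a \<in> carrier P"
    using smult Apar_incl by (simp add: Apar_simps)
  have fl: "lin_map k H P f" using f by (simp add: moves_left_def)
  note fc = lin_map_closed[OF fl]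
  have "moves_left (c \<odot>\<^bsub>P\<^esub> a) (\<lambda>h. c \<odot>\<^bsub>P\<^esub> f h)"
    unfolding moves_left_def
  proof (intro conjI ballI)
    show "lin_map k H P (\<lambda>h. c \<odot>\<^bsub>P\<^esub> f h)" using fl smult by (intro lin_smult P_module)
    fix h assume h: "h \<in> carrier H"
    then show "c \<odot>\<^bsub>P\<^esub> f h \<in> carrier A"
      using f smult by (auto simp: moves_left_def Apar_simps intro: alg_generated.smult)
    have "b h \<star> (c \<odot>\<^bsub>P\<^esub> a) = c \<odot>\<^bsub>P\<^esub> sw P (\<lambda>x y. f x \<star> b y) h"
      using f ac h smult by (simp add: P.smult_mult_right b_closed moves_left_def)
    also have "\<dots> = sw P (\<lambda>x y. c \<odot>\<^bsub>P\<^esub> (f x \<star> b y)) h"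
      using h fl smult by (intro lin_map_sw[where g = "\<lambda>z. c \<odot>\<^bsub>P\<^esub> z"]; (intro sw_rules fc)?)
    also have "\<dots> = sw P (\<lambda>x y. (c \<odot>\<^bsub>P\<^esub> f x) \<star> b y) h"
      using smult by (intro sweedler_cong) (simp add: P.smult_mult_left b_closed fc)
    finally show "b h \<star> (c \<odot>\<^bsub>P\<^esub> a) = sw P (\<lambda>x y. c \<odot>\<^bsub>P\<^esub> f x \<star> b y) h" .
  qed
  then show ?case by blast
next
  case (mult a a')
  then obtain f f' where f: "moves_left a f" and f': "moves_left a' f'" by blast
  have ac: "a \<in> carrier P" "a' \<in> carrier P"
    using mult Apar_incl by (simp_all add: Apar_simps)
  have fl: "lin_map k H P f" "lin_map k H P f'" using f f' by (simp_all add: moves_left_def)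
  note fc = lin_map_closed[OF fl(1)] lin_map_closed[OF fl(2)]
  \<comment> \<open>Moving \<open>[h]\<close> past \<open>a\<close> and then past \<open>a'\<close>
    gives [h] a a' = f(h1) [h2] a' = f(h1) f'(h2) [h3], whose coefficient is the convolution
    product.\<close>
  have "moves_left (a \<star> a') (\<lambda>h. sw P (\<lambda>x y. f x \<star> f' y) h)"
    unfolding moves_left_def
  proof (intro conjI ballI)
    show "lin_map k H P (\<lambda>h. sw P (\<lambda>x y. f x \<star> f' y) h)"
      using fl by (intro sw_lin_map; (intro sw_rules fc)?)
    fix h assume h: "h \<in> carrier H"
    then show "sw P (\<lambda>x y. f x \<star> f' y) h \<in> carrier A"
      using f f' fl
      by (intro sw_Apar bilinI P.lin_mult_left P.lin_mult_right fc)
        (auto simp: moves_left_def Apar_simps intro: alg_generated.mult)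
    have "b h \<star> (a \<star> a') = sw P (\<lambda>x y. f x \<star> b y) h \<star> a'"
      using f ac h by (simp add: b_closed moves_left_def flip: P.m_assoc)
    also have "\<dots> = sw P (\<lambda>x y. f x \<star> b y \<star> a') h"
      using h fl ac by (intro lin_map_sw[where g = "\<lambda>z. z \<star> a'"]; (intro sw_rules fc)?)
    also have "\<dots> = sw P (\<lambda>x y. f x \<star> sw P (\<lambda>u v. f' u \<star> b v) y) h"
      using f' ac by (intro sweedler_cong) (simp add: P.m_assoc b_closed fc moves_left_def)
    also have "\<dots> = sw P (\<lambda>x y. sw P (\<lambda>u v. f x \<star> (f' u \<star> b v)) y) h"
      using fl by (intro sweedler_cong lin_map_sw[where g = "\<lambda>z. f _ \<star> z"]; (intro sw_rules fc)?)
    also have "\<dots> = sw P (\<lambda>w v. sw P (\<lambda>x u. f x \<star> (f' u \<star> b v)) w) h"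
      using h fl by (intro sw_assoc[symmetric]; (intro sw_rules fc)?)
    also have "\<dots> = sw P (\<lambda>w v. sw P (\<lambda>x u. f x \<star> f' u \<star> b v) w) h"
      by (intro sweedler_cong) (simp add: P.m_assoc b_closed fc)
    also have "\<dots> = sw P (\<lambda>w v. sw P (\<lambda>x u. f x \<star> f' u) w \<star> b v) h"
      using fl by (intro sweedler_cong lin_map_sw[where g = "\<lambda>z. z \<star> b _", symmetric]; (intro sw_rules fc)?)
    finally show "b h \<star> (a \<star> a') = sw P (\<lambda>w v. sw P (\<lambda>x u. f x \<star> f' u) w \<star> b v) h" .
  qed
  then show ?case by blast
qed

text \<open>Replacing [h1] a by f(h1) [h2] leaves [h2] [S(h3)] at the end, which is the sum defining
  \<open>eps\<close> at the second leg.\<close>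

lemma Apar_act_moves_left:
  assumes f: "moves_left a f" and a: "a \<in> carrier A" and h: "h \<in> carrier H"
  shows "act A h a = sw P (\<lambda>x y. f x \<star> eps y) h"
proof -
  have fl: "lin_map k H P f" using f by (simp add: moves_left_def)
  note fc = lin_map_closed[OF fl]
  have "act A h a = sw P (\<lambda>x y. sw P (\<lambda>u v. f u \<star> b v) x \<star> b (S y)) h"
    unfolding Apar_simps using f by (intro sweedler_cong) (simp add: moves_left_def)
  also have "\<dots> = sw P (\<lambda>x y. sw P (\<lambda>u v. f u \<star> b v \<star> b (S y)) x) h"
    using fl by (intro sweedler_cong lin_map_sw[where g = "\<lambda>z. z \<star> b (S _)"]; (intro sw_rules fc)?)
  also have "\<dots> = sw P (\<lambda>u x. sw P (\<lambda>v y. f u \<star> b v \<star> b (S y)) x) h"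
    using h fl by (intro sw_assoc; (intro sw_rules fc)?)
  also have "\<dots> = sw P (\<lambda>u x. sw P (\<lambda>v y. f u \<star> (b v \<star> b (S y))) x) h"
    by (intro sweedler_cong) (simp add: P.m_assoc fc b_closed S_closed)
  also have "\<dots> = sw P (\<lambda>u x. f u \<star> eps x) h"
    unfolding eps_eq using fl
    by (intro sweedler_cong lin_map_sw[where g = "\<lambda>z. f _ \<star> z", symmetric]; (intro sw_rules fc)?)
  finally show ?thesis .
qed

text \<open>The form [h1] a [S(h2)] does not show membership in \<open>Apar\<close>, as single
  \<open>[h]\<close> need not belong to it; the form f(h1) eps(h2) has both factors there.\<close>

lemma Apar_act_closed:
  assumes a: "a \<in> carrier A" and h: "h \<in> carrier H" shows "act A h a \<in> carrier A"
proof -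
  obtain f where f: "moves_left a f" using moves_left_ex[OF a] ..
  then have fl: "lin_map k H P f" by (simp add: moves_left_def)
  show ?thesis
    unfolding Apar_act_moves_left[OF f a h] using f h fl
    by (intro sw_Apar bilinI P.lin_mult_left P.lin_mult_right eps_lin eps_closed lin_map_closed[OF fl])
      (auto simp: moves_left_def Apar_simps intro: alg_generated.intros)
qed

lemma Apar_act_bilin: "bilin k H A A (act A)"
  unfolding bilin_def
proof (intro conjI ballI)
  fix h assume h: "h \<in> carrier H"
  then show "lin_map k A A (act A h)"
    unfolding Apar_simps(7)[abs_def]
    by (intro lin_map_Apar Apar_act_closed[unfolded Apar_simps(7)])
      (intro sw_rules Apar_module Apar_incl_lin Apar_incl)
next
  fix a assume a: "a \<in> carrier A"
  then show "lin_map k H A (\<lambda>h. act A h a)"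
    unfolding Apar_simps(7)[abs_def]
    by (intro lin_map_Apar Apar_act_closed[unfolded Apar_simps(7)])
      (intro sw_rules Apar_incl)
qed

text \<open>After writing the action as f(h1) eps(h2), the tail eps(h2) [h3 l] collapses to [h2]
  [l], and f(h1) [h2] is [h] a by the choice of \<open>f\<close>.\<close>

lemma Apar_act_br:
  assumes a: "a \<in> carrier A" and h: "h \<in> carrier H" and l: "l \<in> carrier H"
  shows "sw P (\<lambda>x y. act A x a \<star> b (y \<cdot> l)) h = b h \<star> a \<star> b l"
proof -
  obtain f where f: "moves_left a f" using moves_left_ex[OF a] ..
  then have fl: "lin_map k H P f" by (simp add: moves_left_def)
  note fc = lin_map_closed[OF fl]
  note r = sw_rules fc eps_closed lin_map_comp[OF _ eps_lin]
  have "sw P (\<lambda>x y. act A x a \<star> b (y \<cdot> l)) h =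
      sw P (\<lambda>x y. sw P (\<lambda>u v. f u \<star> eps v) x \<star> b (y \<cdot> l)) h"
    by (intro sweedler_cong) (simp add: Apar_act_moves_left[OF f a])
  also have "\<dots> = sw P (\<lambda>x y. sw P (\<lambda>u v. f u \<star> eps v \<star> b (y \<cdot> l)) x) h"
    using fl l by (intro sweedler_cong lin_map_sw[where g = "\<lambda>z. z \<star> b (_ \<cdot> l)"]; (intro r)?)
  also have "\<dots> = sw P (\<lambda>u x. sw P (\<lambda>v y. f u \<star> eps v \<star> b (y \<cdot> l)) x) h"
    using h l fl by (intro sw_assoc; (intro r)?)
  also have "\<dots> = sw P (\<lambda>u x. sw P (\<lambda>v y. f u \<star> (eps v \<star> b (y \<cdot> l))) x) h"
    using l by (intro sweedler_cong) (simp add: P.m_assoc fc b_closed eps_closed)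
  also have "\<dots> = sw P (\<lambda>u x. f u \<star> sw P (\<lambda>v y. eps v \<star> b (y \<cdot> l)) x) h"
    using fl l by (intro sweedler_cong lin_map_sw[where g = "\<lambda>z. f _ \<star> z", symmetric]; (intro r)?)
  also have "\<dots> = sw P (\<lambda>u x. f u \<star> b x \<star> b l) h"
    using l by (intro sweedler_cong) (simp add: eps_br_collapse P.m_assoc fc b_closed)
  also have "\<dots> = sw P (\<lambda>u x. f u \<star> b x) h \<star> b l"
    using h fl l by (intro lin_map_sw[where g = "\<lambda>z. z \<star> b l", symmetric]; (intro r)?)
  also have "\<dots> = b h \<star> a \<star> b l"
    using f h by (simp add: moves_left_def)
  finally show ?thesis .
qed

end


section \<open>Partial and global modules\<close>

lemma act_hom_Lin: "f \<in> act_hom k H M N \<Longrightarrow> f \<in> Lin k M N"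
  by (simp add: act_hom_def)

lemma act_hom_lin_map: "f \<in> act_hom k H M N \<Longrightarrow> lin_map k M N f"
  by (simp add: act_hom_def Lin_def)

lemma act_hom_act:
  "f \<in> act_hom k H M N \<Longrightarrow> h \<in> carrier H \<Longrightarrow> m \<in> carrier M \<Longrightarrow> f (act M h m) = act N h (f m)"
  by (simp add: act_hom_def)

lemma compose_Lin:
  assumes "module k V" "f \<in> Lin k V W" "g \<in> Lin k W N"
  shows "compose (carrier V) g f \<in> Lin k V N"
  unfolding compose_def by (intro Lin_restrict lin_map_comp[OF Lin_lin_map[OF assms(2)] Lin_lin_map[OF assms(3)]] assms(1))

context hopf_algebra
begin

lemma global_moduleI:
  assumes M: "module k M" and act: "bilin k H M M (act M)"
    and one: "\<And>m. m \<in> carrier M \<Longrightarrow> act M \<one>\<^bsub>H\<^esub> m = m"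
    and mult: "\<And>h l m. h \<in> carrier H \<Longrightarrow> l \<in> carrier H \<Longrightarrow> m \<in> carrier M \<Longrightarrow>
      act M (h \<cdot> l) m = act M h (act M l m)"
  shows "global_module k H M"
proof -
  let ?\<pi> = "\<lambda>h\<in>carrier H. \<lambda>m\<in>carrier M. act M h m"
  have Lin: "(\<lambda>m\<in>carrier M. act M h m) \<in> Lin k M M" if "h \<in> carrier H" for h
    using that by (intro Lin_restrict M bilin_right[OF act])
  have "alg_map k H (End_algebra k M) ?\<pi>"
    unfolding alg_map_def
  proof (intro conjI ballI lin_mapI)
    fix h assume h: "h \<in> carrier H"
    then show "?\<pi> h \<in> carrier (End_algebra k M)" by (simp add: End_algebra_simps Lin)
    fix l assume l: "l \<in> carrier H"
    show "?\<pi> (h \<oplus>\<^bsub>H\<^esub> l) = ?\<pi> h \<oplus>\<^bsub>End_algebra k M\<^esub> ?\<pi> l"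
      using h l by (auto simp: End_algebra_simps lin_map_add[OF bilin_left[OF act]])
    show "?\<pi> (h \<cdot> l) = ?\<pi> h \<otimes>\<^bsub>End_algebra k M\<^esub> ?\<pi> l"
      using h l by (auto simp: End_algebra_simps compose_def mult bilin_closed[OF act])
  qed (auto simp: End_algebra_simps lin_map_smult[OF bilin_left[OF act]] one)
  then show ?thesis
    using M by (simp add: global_module_def alg_hom_iff)
qed

end

section \<open>A fixed partial module and its \<open>Hpar\<close>-action\<close>

locale partial_module_over = hopf_algebra k H
  for k :: "('k, 'y) ring_scheme" (structure) and H :: "('k, 'h, 'z) hopf_scheme" (structure) +
  fixes M :: "('k, 'h, 'm) hmod"
  assumes partial_module: "partial_module k H M"
begin

lemma M_module: "module k M"
  using partial_module by (simp add: partial_module_def)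

sublocale M: module k M
  by (rule M_module)

lemma End_k_algebra: "k_algebra k (End_algebra k M)"
  by (rule End_algebra_k_algebra[OF field_axioms M_module])

lemma partial_rep_act: "partial_rep k H (End_algebra k M) (\<lambda>h. \<lambda>m\<in>carrier M. act M h m)"
  using partial_module by (simp add: partial_module_def)

text \<open>Linearity in \<open>h\<close> is found by evaluating the representation at
  \<open>m\<close>, a linear map on endomorphisms; linearity in \<open>m\<close> is that of the
  endomorphism with its restriction removed.\<close>

lemma act_bilin: "bilin k H M M (act M)"
proof -
  have l: "lin_map k H (End_algebra k M) (\<lambda>h. \<lambda>m\<in>carrier M. act M h m)"
    using partial_rep_act by (simp add: partial_rep_def)
  show ?thesis
    unfolding bilin_def
  proof (intro conjI ballI)
    fix h assume "h \<in> carrier H"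
    then have "(\<lambda>m\<in>carrier M. act M h m) \<in> Lin k M M"
      using lin_map_closed[OF l] by (simp add: End_algebra_simps)
    then have "lin_map k M M (\<lambda>m\<in>carrier M. act M h m)" by (rule Lin_lin_map)
    then show "lin_map k M M (act M h)"
      by (rule iffD1[OF lin_map_cong[OF M_module], rotated]) simp
  next
    fix m assume m: "m \<in> carrier M"
    have "lin_map k (End_algebra k M) M (\<lambda>f. f m)"
      using m by (intro lin_mapI) (auto simp: End_algebra_simps Lin_closed)
    from lin_map_comp[OF l this] m show "lin_map k H M (\<lambda>h. act M h m)" by simp
  qed
qed

lemma act_closed: "h \<in> carrier H \<Longrightarrow> m \<in> carrier M \<Longrightarrow> act M h m \<in> carrier M"
  by (rule bilin_closed[OF act_bilin])

abbreviation "\<Phi> \<equiv> Hpar_action k H M"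

lemma \<Phi>_alg_hom: "\<Phi> \<in> alg_hom k P (End_algebra k M)"
  and \<Phi>_br_restrict: "h \<in> carrier H \<Longrightarrow> \<Phi> (b h) = (\<lambda>m\<in>carrier M. act M h m)"
  using theI'[OF Hpar_universal[OF End_k_algebra partial_rep_act]] unfolding Hpar_action_def by auto

lemma \<Phi>_alg_map: "alg_map k P (End_algebra k M) \<Phi>"
  using \<Phi>_alg_hom by (simp add: alg_hom_iff)

lemma \<Phi>_bilin: "bilin k P M M \<Phi>"
  unfolding bilin_def
proof (intro conjI ballI)
  note l = alg_map_lin_map[OF \<Phi>_alg_map]
  show "lin_map k M M (\<Phi> a)" if "a \<in> carrier P" for a
    using lin_map_closed[OF l that] by (simp add: End_algebra_simps Lin_def)
  show "lin_map k P M (\<lambda>a. \<Phi> a m)" if "m \<in> carrier M" for m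
  proof (rule lin_map_comp[OF l])
    show "lin_map k (End_algebra k M) M (\<lambda>f. f m)"
      using that by (intro lin_mapI) (auto simp: End_algebra_simps Lin_closed)
  qed
qed

lemma \<Phi>_closed: "a \<in> carrier P \<Longrightarrow> m \<in> carrier M \<Longrightarrow> \<Phi> a m \<in> carrier M"
  by (rule bilin_closed[OF \<Phi>_bilin])

lemma \<Phi>_br: "h \<in> carrier H \<Longrightarrow> m \<in> carrier M \<Longrightarrow> \<Phi> (b h) m = act M h m"
  by (simp add: \<Phi>_br_restrict)

lemma \<Phi>_one: "m \<in> carrier M \<Longrightarrow> \<Phi> \<one>\<^bsub>P\<^esub> m = m"
  by (simp add: alg_map_one[OF \<Phi>_alg_map] End_algebra_simps)

lemma \<Phi>_mult:
  "a \<in> carrier P \<Longrightarrow> c \<in> carrier P \<Longrightarrow> m \<in> carrier M \<Longrightarrow> \<Phi> (a \<star> c) m = \<Phi> a (\<Phi> c m)"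
  by (simp add: alg_map_mult[OF \<Phi>_alg_map] End_algebra_simps compose_eq)

lemma \<Phi>_Apar_bilin: "bilin k A M M \<Phi>"
  by (intro bilinI bilin_right[OF \<Phi>_bilin] lin_map_comp[OF Apar_incl_lin bilin_left[OF \<Phi>_bilin]] Apar_incl)

text \<open>The identity \<open>Apar_act_br\<close> evaluated at \<open>m\<close>. It is the
  equivariance, on pure tensors, of the map sending a \<otimes> l to a acting on l \<bullet> m, the
  image of a single generator of the dilation.\<close>

lemma act_Apar_action:
  assumes a: "a \<in> carrier A" and h: "h \<in> carrier H" and l: "l \<in> carrier H" and m: "m \<in> carrier M"
  shows "sw M (\<lambda>x y. \<Phi> (act A x a) (act M (y \<cdot> l) m)) h = act M h (\<Phi> a (act M l m))"
proof -
  note ac = Apar_incl[OF a]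
  have "act M h (\<Phi> a (act M l m)) = \<Phi> (b h \<star> a \<star> b l) m"
    using ac h l m by (simp add: \<Phi>_mult \<Phi>_br \<Phi>_closed b_closed act_closed)
  also have "\<dots> = \<Phi> (sw P (\<lambda>x y. act A x a \<star> b (y \<cdot> l)) h) m"
    using a h l by (simp add: Apar_act_br)
  also have "\<dots> = sw M (\<lambda>x y. \<Phi> (act A x a \<star> b (y \<cdot> l)) m) h"
    using a h l m
    by (intro lin_map_sw[OF P_module M_module bilin_left[OF \<Phi>_bilin]] bilinI P.lin_mult_left P.lin_mult_right
        lin_map_comp[OF bilin_left[OF Apar_act_bilin] Apar_incl_lin] lin_map_comp[OF _ b_lin] lin_mult_left
        lin_map_id b_closed m_closed Apar_incl Apar_act_closed)
  also have "\<dots> = sw M (\<lambda>x y. \<Phi> (act A x a) (act M (y \<cdot> l) m)) h"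
    using a l m by (intro sweedler_cong) (simp add: \<Phi>_mult \<Phi>_br Apar_incl Apar_act_closed b_closed)
  finally show ?thesis by simp
qed

end

lemma (in hopf_algebra) act_hom_Hpar_action:
  assumes M: "partial_module k H M" and N: "partial_module k H N" and f: "f \<in> act_hom k H M N"
    and a: "a \<in> carrier P" and m: "m \<in> carrier M"
  shows "f (Hpar_action k H M a m) = Hpar_action k H N a (f m)"
proof -
  interpret M: partial_module_over k H M
    by (intro partial_module_over.intro partial_module_over_axioms.intro hopf_algebra_axioms M)
  interpret N: partial_module_over k H N
    by (intro partial_module_over.intro partial_module_over_axioms.intro hopf_algebra_axioms N)
  note fl = act_hom_lin_map[OF f]
  note fc = lin_map_closed[OF fl]
  have sub: "b ` carrier H \<subseteq> carrier P" using b_closed by auto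
  have "a \<in> alg_generated k P (b ` carrier H)" using a Hpar_generated by blast
  \<comment> \<open>The claim is for all \<open>m\<close> at once, since the product case applies
    the hypothesis for \<open>x\<close> at the element obtained by acting with
    \<open>y\<close>.\<close>
  then have "a \<in> carrier P \<and> (\<forall>m\<in>carrier M. f (M.\<Phi> a m) = N.\<Phi> a (f m))"
  proof induction
    case one
    then show ?case using fc by (simp add: M.\<Phi>_one N.\<Phi>_one)
  next
    case (incl x)
    then show ?case using fc by (auto simp: M.\<Phi>_br N.\<Phi>_br b_closed act_hom_act[OF f])
  next
    case (add x y)
    then show ?case
      using fc by (auto simp: lin_map_add[OF bilin_left[OF M.\<Phi>_bilin]] lin_map_add[OF bilin_left[OF N.\<Phi>_bilin]]
          lin_map_add[OF fl] M.\<Phi>_closed)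
  next
    case (smult c x)
    then show ?case
      using fc by (auto simp: lin_map_smult[OF bilin_left[OF M.\<Phi>_bilin]] lin_map_smult[OF bilin_left[OF N.\<Phi>_bilin]]
          lin_map_smult[OF fl] M.\<Phi>_closed)
  next
    case (mult x y)
    then show ?case using fc by (auto simp: M.\<Phi>_mult N.\<Phi>_mult M.\<Phi>_closed)
  qed
  then show ?thesis using m by blast
qed


section \<open>The functor \<open>{A\<^sub>p\<^sub>a\<^sub>r, -}\<close>\<close>

context hopf_algebra
begin

sublocale AH: tensor_product k A H
  by (intro tensor_product.intro Apar_module H_module)

abbreviation "AT \<equiv> Apar_tensor_H k H"
abbreviation "TAH \<equiv> tensor k A H"
abbreviation "tAH \<equiv> tens k A H"

lemma AT_simps:
  "carrier AT = carrier TAH" "add AT = add TAH" "zero AT = zero TAH" "smult AT = smult TAH"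
  by (simp_all add: Apar_tensor_H_def with_action_def Let_def)

lemma AT_act:
  "act AT h = tensor_lift k A H TAH (\<lambda>a l. sw TAH (\<lambda>h1 h2. tAH (act A h1 a) (h2 \<cdot> l)) h)"
  by (simp add: Apar_tensor_H_def with_action_def Let_def)

lemma AT_module: "module k AT"
  by (rule module_cong[OF AH.tensor_module]) (simp_all add: AT_simps)

lemma lin_map_AT: "lin_map k AT N f \<longleftrightarrow> lin_map k TAH N f"
  by (simp add: lin_map_def AT_simps)

lemma lin_map_into_AT: "lin_map k N AT f \<longleftrightarrow> lin_map k N TAH f"
  by (simp add: lin_map_def AT_simps)

lemma Lin_AT: "Lin k AT N = Lin k TAH N"
  by (simp add: Lin_def lin_map_AT AT_simps)

lemmas lin_tAH = lin_map_comp[OF _ bilin_left[OF AH.tens_bilin]] lin_map_comp[OF _ bilin_right[OF AH.tens_bilin]]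

lemma tAH_act_bilin:
  assumes "a \<in> carrier A" "l \<in> carrier H"
  shows "bilin k H H TAH (\<lambda>h1 h2. tAH (act A h1 a) (h2 \<cdot> l))"
  using assms by (intro bilinI lin_tAH lin_mult_left lin_map_id bilin_left[OF Apar_act_bilin] m_closed Apar_act_closed)

lemma AT_act_bilin:
  assumes "h \<in> carrier H"
  shows "bilin k A H TAH (\<lambda>a l. sw TAH (\<lambda>h1 h2. tAH (act A h1 a) (h2 \<cdot> l)) h)"
  using assms
  by (intro bilinI lin_sw_parameter AH.tensor_module H_module Apar_module tAH_act_bilin lin_tAH lin_mult_right
      lin_map_id bilin_right[OF Apar_act_bilin] m_closed Apar_act_closed)

lemma AT_act_lin: "h \<in> carrier H \<Longrightarrow> lin_map k AT AT (act AT h)"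
  unfolding AT_act lin_map_AT lin_map_into_AT
  by (intro AH.tensor_lift_lin_map AH.tensor_module AT_act_bilin)

lemma AT_act_tens:
  assumes "h \<in> carrier H" "a \<in> carrier A" "l \<in> carrier H"
  shows "act AT h (tAH a l) = sw TAH (\<lambda>h1 h2. tAH (act A h1 a) (h2 \<cdot> l)) h"
  unfolding AT_act using assms by (simp add: AH.tensor_lift_tens[OF AH.tensor_module AT_act_bilin])

lemma tAH_closed: "a \<in> carrier A \<Longrightarrow> l \<in> carrier H \<Longrightarrow> tAH a l \<in> carrier AT"
  by (simp add: AT_simps AH.tens_closed)

end

context partial_module_over
begin

abbreviation "E \<equiv> AHom k H M"

lemma AHom_simps:
  "carrier E = act_hom k H AT M" "add E = add (Hom_module k AT M)" "zero E = zero (Hom_module k AT M)"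
  "smult E = smult (Hom_module k AT M)"
  "act E h' f = tensor_lift k A H M (\<lambda>a h. f (tAH a (h \<cdot> h')))"
  by (simp_all add: AHom_def with_action_def)

text \<open>Both sides of the equivariance condition are linear in the tensor, so pure tensors
  suffice; there the action on \<open>AT\<close> is an explicit Sweedler sum.\<close>

lemma act_homI:
  assumes "f \<in> Lin k AT M"
    and "\<And>h a l. h \<in> carrier H \<Longrightarrow> a \<in> carrier A \<Longrightarrow> l \<in> carrier H \<Longrightarrow>
      f (act AT h (tAH a l)) = act M h (f (tAH a l))"
  shows "f \<in> act_hom k H AT M"
  unfolding act_hom_def
proof (intro CollectI conjI ballI assms(1))
  fix h t assume h: "h \<in> carrier H" and t: "t \<in> carrier AT"
  note f = Lin_lin_map[OF assms(1)]
  show "f (act AT h t) = act M h (f t)"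
  proof (rule AH.tensor_lin_eqI[OF M_module])
    show "lin_map k TAH M (\<lambda>t. f (act AT h t))" "lin_map k TAH M (\<lambda>t. act M h (f t))"
      using lin_map_comp[OF AT_act_lin[OF h] f] lin_map_comp[OF f bilin_right[OF act_bilin h]]
      by (simp_all add: lin_map_AT)
  qed (use assms(2) h t in \<open>auto simp: AT_simps\<close>)
qed

lemma AHom_eqI:
  assumes "f \<in> act_hom k H AT M" "g \<in> act_hom k H AT M"
    and "\<And>a l. a \<in> carrier A \<Longrightarrow> l \<in> carrier H \<Longrightarrow> f (tAH a l) = g (tAH a l)"
  shows "f = g"
proof (rule Lin_eqI[OF assms(1,2)[THEN act_hom_Lin]])
  fix t assume "t \<in> carrier AT"
  then show "f t = g t"
    using assms(1,2)[THEN act_hom_lin_map]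
    by - (rule AH.tensor_lin_eqI[OF M_module, where f = f and g = g];
        simp add: assms(3) lin_map_AT AT_simps)
qed

lemma AHom_closed: "f \<in> act_hom k H AT M \<Longrightarrow> t \<in> carrier AT \<Longrightarrow> f t \<in> carrier M"
  by (rule lin_map_closed[OF act_hom_lin_map])

lemma AHom_eval:
  assumes "t \<in> carrier AT"
  shows "(f \<oplus>\<^bsub>E\<^esub> g) t = f t \<oplus>\<^bsub>M\<^esub> g t" "(c \<odot>\<^bsub>E\<^esub> f) t = c \<odot>\<^bsub>M\<^esub> f t" "\<zero>\<^bsub>E\<^esub> t = \<zero>\<^bsub>M\<^esub>"
  using assms by (simp_all add: AHom_simps Hom_module_simps)

lemma AHom_module: "module k E"
proof (rule module_cong)
  let ?N = "Hom_module k AT M"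
  interpret N: module k ?N by (rule Hom_module_module[OF AT_module M_module])
  have ac: "act AT h t \<in> carrier AT" if "h \<in> carrier H" "t \<in> carrier AT" for h t
    using lin_map_closed[OF AT_act_lin] that .
  note al = bilin_right[OF act_bilin]
  have "submodule (carrier E) k ?N"
  proof (rule N.submodule_criterion)
    show "carrier E \<subseteq> carrier ?N" by (auto simp: AHom_simps Hom_module_simps act_hom_Lin)
    have "\<zero>\<^bsub>?N\<^esub> \<in> carrier ?N" by simp
    then show "\<zero>\<^bsub>?N\<^esub> \<in> carrier E"
      by (auto simp: AHom_simps Hom_module_simps act_hom_def ac lin_map_zero[OF M_module M_module al])
    fix f assume f: "f \<in> carrier E"
    then have fN: "f \<in> carrier ?N" by (simp add: AHom_simps Hom_module_simps act_hom_Lin)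
    show "c \<odot>\<^bsub>?N\<^esub> f \<in> carrier E" if c: "c \<in> carrier k" for c
      using N.smult_closed[OF c fN] f c AHom_closed
      by (auto simp: AHom_simps Hom_module_simps act_hom_def ac lin_map_smult[OF al])
    fix g assume g: "g \<in> carrier E"
    then have gN: "g \<in> carrier ?N" by (simp add: AHom_simps Hom_module_simps act_hom_Lin)
    show "f \<oplus>\<^bsub>?N\<^esub> g \<in> carrier E"
      using N.M.a_closed[OF fN gN] f g AHom_closed
      by (auto simp: AHom_simps Hom_module_simps act_hom_def ac lin_map_add[OF al])
  qed
  then show "module k (?N\<lparr>carrier := carrier E\<rparr>)"
    by (rule submodule.submodule_is_module) (rule N.module_axioms)
qed (simp_all add: AHom_simps)

lemma AHom_act_bilin_tens:
  assumes "f \<in> act_hom k H AT M" "h' \<in> carrier H"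
  shows "bilin k A H M (\<lambda>a h. f (tAH a (h \<cdot> h')))"
proof -
  note f = act_hom_lin_map[OF assms(1), unfolded lin_map_AT]
  show ?thesis
    using assms(2) by (intro bilinI lin_map_comp[OF _ f] lin_tAH lin_map_id lin_mult_left m_closed)
qed

lemma AHom_act_tens:
  assumes "f \<in> act_hom k H AT M" "h' \<in> carrier H" "a \<in> carrier A" "l \<in> carrier H"
  shows "act E h' f (tAH a l) = f (tAH a (l \<cdot> h'))"
  unfolding AHom_simps using assms by (simp add: AH.tensor_lift_tens[OF M_module AHom_act_bilin_tens])

text \<open>Right translation by \<open>h'\<close> on the second factor commutes with the action of
  \<open>H\<close>, which multiplies that factor from the left: (h2 l) h' = h2 (l h').\<close>

lemma AHom_act_closed:
  assumes f: "f \<in> act_hom k H AT M" and h': "h' \<in> carrier H"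
  shows "act E h' f \<in> act_hom k H AT M"
proof (rule act_homI)
  have L: "act E h' f \<in> Lin k TAH M"
    unfolding AHom_simps by (rule AH.tensor_lift_Lin[OF M_module AHom_act_bilin_tens[OF f h']])
  then show "act E h' f \<in> Lin k AT M" by (simp add: Lin_AT)
  note fl = act_hom_lin_map[OF f, unfolded lin_map_AT]
  fix h a l assume hal: "h \<in> carrier H" "a \<in> carrier A" "l \<in> carrier H"
  have "act E h' f (act AT h (tAH a l)) = sw M (\<lambda>x y. act E h' f (tAH (act A x a) (y \<cdot> l))) h"
    using hal by (simp add: AT_act_tens lin_map_sw[OF AH.tensor_module M_module Lin_lin_map[OF L] tAH_act_bilin])
  also have "\<dots> = sw M (\<lambda>x y. f (tAH (act A x a) (y \<cdot> (l \<cdot> h')))) h"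
    using hal h' by (intro sweedler_cong) (simp add: AHom_act_tens[OF f] Apar_act_closed m_assoc)
  also have "\<dots> = f (act AT h (tAH a (l \<cdot> h')))"
    using hal h' by (simp add: AT_act_tens lin_map_sw[OF AH.tensor_module M_module fl tAH_act_bilin])
  also have "\<dots> = act M h (act E h' f (tAH a l))"
    using hal h' by (simp add: act_hom_act[OF f] tAH_closed AHom_act_tens[OF f])
  finally show "act E h' f (act AT h (tAH a l)) = act M h (act E h' f (tAH a l))" .
qed

lemma AHom_global_module: "global_module k H E"
proof (rule global_moduleI[OF AHom_module])
  note cl = module_closed[OF AHom_module, unfolded AHom_simps(1)] AHom_act_closed
  note tl = bilin_right[OF AH.tens_bilin]
  show "bilin k H E E (act E)"
    unfolding bilin_def
  proof (intro conjI ballI lin_mapI; (unfold AHom_simps(1))?)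
    fix f h assume f: "f \<in> act_hom k H AT M" and h: "h \<in> carrier H"
    note fl = act_hom_lin_map[OF f, unfolded lin_map_AT]
    show "act E h f \<in> act_hom k H AT M" "act E h f \<in> act_hom k H AT M"
      using f h by (simp_all add: AHom_act_closed)
    show "act E h (f \<oplus>\<^bsub>E\<^esub> g) = act E h f \<oplus>\<^bsub>E\<^esub> act E h g" if g: "g \<in> act_hom k H AT M" for g
      by (rule AHom_eqI) (use f g h in \<open>simp_all add: cl AHom_act_tens AHom_eval tAH_closed\<close>)
    show "act E (h \<oplus>\<^bsub>H\<^esub> l) f = act E h f \<oplus>\<^bsub>E\<^esub> act E l f" if l: "l \<in> carrier H" for l
      by (rule AHom_eqI) (use f h l in \<open>simp_all add: cl AHom_act_tens AHom_eval tAH_closed r_distr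
          lin_map_add[OF tl] lin_map_add[OF fl] AH.tens_closed\<close>)
    fix c assume c: "c \<in> carrier k"
    show "act E h (c \<odot>\<^bsub>E\<^esub> f) = c \<odot>\<^bsub>E\<^esub> act E h f"
      by (rule AHom_eqI) (use f h c in \<open>simp_all add: cl AHom_act_tens AHom_eval tAH_closed\<close>)
    show "act E (c \<odot>\<^bsub>H\<^esub> h) f = c \<odot>\<^bsub>E\<^esub> act E h f"
      by (rule AHom_eqI) (use f h c in \<open>simp_all add: cl AHom_act_tens AHom_eval tAH_closed smult_mult_right
          lin_map_smult[OF tl] lin_map_smult[OF fl] AH.tens_closed\<close>)
  qed
  fix f assume "f \<in> carrier E"
  then have f: "f \<in> act_hom k H AT M" by (simp add: AHom_simps)
  show "act E \<one>\<^bsub>H\<^esub> f = f"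
    by (rule AHom_eqI) (use f in \<open>simp_all add: AHom_act_closed AHom_act_tens\<close>)
  fix h l assume hl: "h \<in> carrier H" "l \<in> carrier H"
  show "act E (h \<cdot> l) f = act E h (act E l f)"
    by (rule AHom_eqI) (use f hl in \<open>simp_all add: AHom_act_closed AHom_act_tens m_assoc\<close>)
qed

end


section \<open>The standard dilation\<close>

context partial_module_over
begin

abbreviation "HM \<equiv> Hom_H k H M"
abbreviation "D \<equiv> dilation k H M"

text \<open>The explicit form of the generator h \<rightharpoonup> \<phi>(m) of the dilation, as a
  function of \<open>l\<close>; it replaces the translated \<open>dil_phi\<close> in all
  calculations.\<close>

definition dil_gen :: "'h \<Rightarrow> 'm \<Rightarrow> 'h \<Rightarrow> 'm"
  where "dil_gen h m = (\<lambda>l\<in>carrier H. act M (l \<cdot> h) m)"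

lemma HM_simps:
  "carrier HM = Lin k H M" "add HM = add (Hom_module k H M)" "zero HM = zero (Hom_module k H M)"
  "smult HM = smult (Hom_module k H M)" "act HM h f = (\<lambda>l\<in>carrier H. f (l \<cdot> h))"
  by (simp_all add: Hom_H_def with_action_def Hom_module_simps)

lemma D_simps:
  "add D = add HM" "zero D = zero HM" "smult D = smult HM" "act D = act HM"
  by (simp_all add: dilation_def)

lemma HM_eval:
  assumes "l \<in> carrier H"
  shows "(f \<oplus>\<^bsub>HM\<^esub> g) l = f l \<oplus>\<^bsub>M\<^esub> g l" "(c \<odot>\<^bsub>HM\<^esub> f) l = c \<odot>\<^bsub>M\<^esub> f l" "\<zero>\<^bsub>HM\<^esub> l = \<zero>\<^bsub>M\<^esub>"
    "act HM h f l = f (l \<cdot> h)"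
  using assms by (simp_all add: HM_simps Hom_module_simps)

lemma HM_module: "module k HM"
  by (rule module_cong[OF Hom_module_module[OF H_module M_module]])
    (simp_all add: HM_simps Hom_module_simps)

lemma HM_eqI:
  "f \<in> carrier HM \<Longrightarrow> g \<in> carrier HM \<Longrightarrow> (\<And>l. l \<in> carrier H \<Longrightarrow> f l = g l) \<Longrightarrow> f = g"
  unfolding HM_simps by (rule Lin_eqI)

lemma HM_lin_map: "f \<in> carrier HM \<Longrightarrow> lin_map k H M f"
  unfolding HM_simps by (rule Lin_lin_map)

lemma HM_closed: "f \<in> carrier HM \<Longrightarrow> l \<in> carrier H \<Longrightarrow> f l \<in> carrier M"
  by (rule lin_map_closed[OF HM_lin_map])

lemma HM_act_closed:
  assumes f: "f \<in> carrier HM" and h: "h \<in> carrier H" shows "act HM h f \<in> carrier HM"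
  using h unfolding HM_simps
  by (intro Lin_restrict H_module lin_map_comp[OF _ HM_lin_map[OF f]] lin_mult_left lin_map_id)

lemma dil_gen_closed:
  assumes "h \<in> carrier H" "m \<in> carrier M" shows "dil_gen h m \<in> carrier HM"
  unfolding HM_simps dil_gen_def using assms
  by (intro Lin_restrict H_module lin_map_comp[OF _ bilin_left[OF act_bilin]] lin_mult_left lin_map_id)

lemma dil_gen_eval: "l \<in> carrier H \<Longrightarrow> dil_gen h m l = act M (l \<cdot> h) m"
  by (simp add: dil_gen_def)

lemma dil_sum_eq: 
  assumes "h \<in> {..<n} \<rightarrow> carrier H" "m \<in> {..<n} \<rightarrow> carrier M"
  shows "dil_sum k H M n h m = (\<Oplus>\<^bsub>HM\<^esub>i\<in>{..<n}. dil_gen (h i) (m i))"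
proof -
  interpret HM: module k HM by (rule HM_module)
  show ?thesis
    unfolding dil_sum_def
  proof (rule HM.M.finsum_cong')
    show "(\<lambda>i. dil_gen (h i) (m i)) \<in> {..<n} \<rightarrow> carrier HM" using assms by (auto intro!: dil_gen_closed)
    show "act HM (h i) (dil_phi H M (m i)) = dil_gen (h i) (m i)" if "i \<in> {..<n}" for i
    proof -
      have "h i \<in> carrier H" using assms that by auto
      then show ?thesis by (auto simp: HM_simps dil_phi_def dil_gen_def)
    qed
  qed simp
qed

lemma dil_sum_closed:
  assumes "h \<in> {..<n} \<rightarrow> carrier H" "m \<in> {..<n} \<rightarrow> carrier M"
  shows "dil_sum k H M n h m \<in> carrier HM"
proof -
  interpret HM: module k HM by (rule HM_module)
  show ?thesis
    unfolding dil_sum_eq[OF assms] using assms by (intro HM.M.finsum_closed) (auto intro!: dil_gen_closed)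
qed

lemma dil_sum_eval:
  assumes "h \<in> {..<n} \<rightarrow> carrier H" "m \<in> {..<n} \<rightarrow> carrier M" and l: "l \<in> carrier H"
  shows "dil_sum k H M n h m l = (\<Oplus>\<^bsub>M\<^esub>i\<in>{..<n}. act M (l \<cdot> h i) (m i))"
proof -
  have "lin_map k HM M (\<lambda>f. f l)"
    using l by (intro lin_mapI) (auto simp: HM_eval HM_closed)
  then have "dil_sum k H M n h m l = (\<Oplus>\<^bsub>M\<^esub>i\<in>{..<n}. dil_gen (h i) (m i) l)"
    unfolding dil_sum_eq[OF assms(1,2)] using assms
    by (intro lin_map_finsum[OF HM_module M_module]) (auto intro!: dil_gen_closed)
  then show ?thesis using l by (simp add: dil_gen_eval)
qed

lemma D_carrier:
  "carrier D = {dil_sum k H M n h m | n h m. h \<in> {..<n} \<rightarrow> carrier H \<and> m \<in> {..<n} \<rightarrow> carrier M}"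
  by (simp add: dilation_def)

lemma D_HM: "x \<in> carrier D \<Longrightarrow> x \<in> carrier HM"
  by (auto simp: D_carrier dil_sum_closed)

lemma D_zero: "\<zero>\<^bsub>HM\<^esub> \<in> carrier D"
proof -
  interpret HM: module k HM by (rule HM_module)
  \<comment> \<open>The index set is empty, so the two families are never evaluated and constant
    ones serve as witnesses.\<close>
  have "dil_sum k H M 0 (\<lambda>_. \<one>\<^bsub>H\<^esub>) (\<lambda>_. \<zero>\<^bsub>M\<^esub>) = \<zero>\<^bsub>HM\<^esub>"
    by (simp add: dil_sum_eq)
  then show ?thesis
    unfolding D_carrier
    by (intro CollectI exI[of _ "0::nat"] exI[of _ "\<lambda>_. \<one>\<^bsub>H\<^esub>"] exI[of _ "\<lambda>_. \<zero>\<^bsub>M\<^esub>"]) simp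
qed

lemma dil_sum_Suc:
  assumes "h \<in> {..<Suc n} \<rightarrow> carrier H" "m \<in> {..<Suc n} \<rightarrow> carrier M"
  shows "dil_sum k H M (Suc n) h m = dil_gen (h n) (m n) \<oplus>\<^bsub>HM\<^esub> dil_sum k H M n h m"
proof -
  interpret HM: module k HM by (rule HM_module)
  have s: "h \<in> {..<n} \<rightarrow> carrier H" "m \<in> {..<n} \<rightarrow> carrier M" "h n \<in> carrier H" "m n \<in> carrier M"
    using assms by (auto simp: Pi_iff)
  have "finsum HM (\<lambda>i. dil_gen (h i) (m i)) (insert n {..<n}) =
      dil_gen (h n) (m n) \<oplus>\<^bsub>HM\<^esub> (\<Oplus>\<^bsub>HM\<^esub>i\<in>{..<n}. dil_gen (h i) (m i))"
    using s by (intro HM.M.finsum_insert) (auto intro!: dil_gen_closed)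
  then show ?thesis
    by (simp add: dil_sum_eq[OF assms] dil_sum_eq[OF s(1,2)] lessThan_Suc)
qed

lemma D_step:
  assumes h: "h \<in> carrier H" and m: "m \<in> carrier M" and x: "x \<in> carrier D"
  shows "dil_gen h m \<oplus>\<^bsub>HM\<^esub> x \<in> carrier D"
proof -
  interpret HM: module k HM by (rule HM_module)
  obtain n h' m' where x: "x = dil_sum k H M n h' m'" "h' \<in> {..<n} \<rightarrow> carrier H" "m' \<in> {..<n} \<rightarrow> carrier M"
    using x by (auto simp: D_carrier)
  \<comment> \<open>The new generator takes index n, the first one outside \<open>{..<n}\<close>, so
    the old sum is unaffected by the update.\<close>
  let ?h = "h'(n := h)" and ?m = "m'(n := m)"
  have c: "?h \<in> {..<Suc n} \<rightarrow> carrier H" "?m \<in> {..<Suc n} \<rightarrow> carrier M"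
    using x h m by (auto simp: Pi_iff less_Suc_eq)
  have c': "?h \<in> {..<n} \<rightarrow> carrier H" "?m \<in> {..<n} \<rightarrow> carrier M"
    using x(2,3) by (auto simp: Pi_iff)
  have "dil_sum k H M n ?h ?m = x"
    unfolding x(1) dil_sum_eq[OF c'] dil_sum_eq[OF x(2,3)]
    using x(2,3) by (intro HM.M.finsum_cong') (auto intro!: dil_gen_closed)
  then have "dil_gen h m \<oplus>\<^bsub>HM\<^esub> x = dil_sum k H M (Suc n) ?h ?m"
    unfolding dil_sum_Suc[OF c] by simp
  then show ?thesis
    unfolding D_carrier using c by blast
qed

text \<open>Peels off the summand with the last index. The families of \<open>h\<close> and
  \<open>m\<close> then disappear from later arguments, which treat one generator at a time.\<close>

lemma D_induct [consumes 1, case_names zero step]: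
  assumes x: "x \<in> carrier D" and zero: "Q \<zero>\<^bsub>HM\<^esub>"
    and step: "\<And>h m y. h \<in> carrier H \<Longrightarrow> m \<in> carrier M \<Longrightarrow> y \<in> carrier D \<Longrightarrow> Q y \<Longrightarrow>
      Q (dil_gen h m \<oplus>\<^bsub>HM\<^esub> y)"
  shows "Q x"
proof -
  interpret HM: module k HM by (rule HM_module)
  obtain n h m where "x = dil_sum k H M n h m" "h \<in> {..<n} \<rightarrow> carrier H" "m \<in> {..<n} \<rightarrow> carrier M"
    using x by (auto simp: D_carrier)
  then show ?thesis
  proof (induction n arbitrary: x)
    case 0
    then show ?case using zero by (simp add: dil_sum_eq)
  next
    case (Suc n)
    have s: "h \<in> {..<n} \<rightarrow> carrier H" "m \<in> {..<n} \<rightarrow> carrier M" "h n \<in> carrier H" "m n \<in> carrier M"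
      using Suc.prems(2,3) by (auto simp: Pi_iff)
    have "dil_sum k H M n h m \<in> carrier D" using s(1,2) by (auto simp: D_carrier)
    then show ?case
      unfolding Suc.prems(1) dil_sum_Suc[OF Suc.prems(2,3)]
      using s Suc.IH by (intro step) auto
  qed
qed

lemma D_submodule: "submodule (carrier D) k HM"
proof -
  interpret HM: module k HM by (rule HM_module)
  show ?thesis
  proof (rule HM.submodule_criterion)
    show "carrier D \<subseteq> carrier HM" using D_HM by auto
    show "\<zero>\<^bsub>HM\<^esub> \<in> carrier D" by (rule D_zero)
    fix x assume "x \<in> carrier D"
    then show "x \<oplus>\<^bsub>HM\<^esub> y \<in> carrier D" if "y \<in> carrier D" for y
    proof (induction rule: D_induct)
      case (step h m x)
      then have "dil_gen h m \<oplus>\<^bsub>HM\<^esub> (x \<oplus>\<^bsub>HM\<^esub> y) \<in> carrier D" by (intro D_step)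
      then show ?case using step that by (simp add: HM.M.a_assoc dil_gen_closed D_HM)
    qed (use that D_HM in simp)
    show "c \<odot>\<^bsub>HM\<^esub> x \<in> carrier D" if c: "c \<in> carrier k" for c
      using \<open>x \<in> carrier D\<close>
    proof (induction rule: D_induct)
      case (step h m x)
      \<comment> \<open>The scalar passes from the generator into the module element, because the
        partial action is linear in it; so no scalars are needed in \<open>dil_sum\<close>.\<close>
      have "dil_gen h (c \<odot>\<^bsub>M\<^esub> m) = c \<odot>\<^bsub>HM\<^esub> dil_gen h m"
        by (rule HM_eqI) (use step c in \<open>simp_all add: dil_gen_closed dil_gen_eval HM_eval
            lin_map_smult[OF bilin_right[OF act_bilin]]\<close>)
      moreover have "dil_gen h (c \<odot>\<^bsub>M\<^esub> m) \<oplus>\<^bsub>HM\<^esub> (c \<odot>\<^bsub>HM\<^esub> x) \<in> carrier D"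
        using step c by (intro D_step) auto
      ultimately show ?case using step c by (simp add: HM.smult_r_distr dil_gen_closed D_HM)
    qed (use c D_zero in simp)
  qed
qed

lemma D_module: "module k D"
  by (rule module_cong[OF submodule.submodule_is_module[OF D_submodule HM_module]])
    (simp_all add: D_simps)

lemma D_act_closed:
  assumes "x \<in> carrier D" and h: "h \<in> carrier H" shows "act HM h x \<in> carrier D"
  using assms(1)
proof (induction rule: D_induct)
  case zero
  have "act HM h \<zero>\<^bsub>HM\<^esub> = \<zero>\<^bsub>HM\<^esub>"
    by (rule HM_eqI) (use h module_zero_closed[OF HM_module] in \<open>simp_all add: HM_act_closed HM_eval\<close>)
  then show ?case using D_zero by simp
next
  case (step h' m x)
  interpret HM: module k HM by (rule HM_module)
  \<comment> \<open>Translating a generator by \<open>h\<close> gives another generator, with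
    \<open>h'\<close> replaced by \<open>h \<cdot> h'\<close>, by associativity in
    \<open>H\<close>.\<close>
  have "act HM h (dil_gen h' m \<oplus>\<^bsub>HM\<^esub> x) = dil_gen (h \<cdot> h') m \<oplus>\<^bsub>HM\<^esub> act HM h x"
    by (rule HM_eqI) (use h step in \<open>simp_all add: HM_act_closed HM_eval dil_gen_closed D_HM
        dil_gen_eval m_assoc\<close>)
  moreover have "dil_gen (h \<cdot> h') m \<oplus>\<^bsub>HM\<^esub> act HM h x \<in> carrier D"
    using h step by (intro D_step) auto
  ultimately show ?case by simp
qed

lemma D_global_module: "global_module k H D"
proof (rule global_moduleI[OF D_module])
  interpret HM: module k HM by (rule HM_module)
  note cl = HM_act_closed D_HM
  show "bilin k H D D (act D)"
    unfolding bilin_def D_simps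
  proof (intro conjI ballI lin_mapI; (unfold D_simps)?)
    fix x h assume x: "x \<in> carrier D" and h: "h \<in> carrier H"
    note xl = HM_lin_map[OF D_HM[OF x]]
    show "act HM h x \<in> carrier D" "act HM h x \<in> carrier D" using x h by (simp_all add: D_act_closed)
    show "act HM h (x \<oplus>\<^bsub>HM\<^esub> y) = act HM h x \<oplus>\<^bsub>HM\<^esub> act HM h y" if y: "y \<in> carrier D" for y
      by (rule HM_eqI) (use x y h in \<open>simp_all add: cl HM_eval\<close>)
    show "act HM (h \<oplus>\<^bsub>H\<^esub> l) x = act HM h x \<oplus>\<^bsub>HM\<^esub> act HM l x" if l: "l \<in> carrier H" for l
      by (rule HM_eqI) (use x l h in \<open>simp_all add: cl HM_eval r_distr lin_map_add[OF xl]\<close>)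
    fix c assume c: "c \<in> carrier k"
    show "act HM h (c \<odot>\<^bsub>HM\<^esub> x) = c \<odot>\<^bsub>HM\<^esub> act HM h x"
      by (rule HM_eqI) (use x c h in \<open>simp_all add: cl HM_eval\<close>)
    show "act HM (c \<odot>\<^bsub>H\<^esub> h) x = c \<odot>\<^bsub>HM\<^esub> act HM h x"
      by (rule HM_eqI) (use x c h in \<open>simp_all add: cl HM_eval smult_mult_right lin_map_smult[OF xl]\<close>)
  qed
  fix x assume x: "x \<in> carrier D"
  show "act D \<one>\<^bsub>H\<^esub> x = x"
    unfolding D_simps by (rule HM_eqI) (use x in \<open>simp_all add: cl HM_eval\<close>)
  fix h l assume hl: "h \<in> carrier H" "l \<in> carrier H"
  show "act D (h \<cdot> l) x = act D h (act D l x)"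
    unfolding D_simps by (rule HM_eqI) (use x hl in \<open>simp_all add: cl HM_eval m_assoc\<close>)
qed

end

section \<open>The transformation\<close>

context partial_module_over
begin

definition "\<Xi> = (\<lambda>x\<in>carrier D. tensor_lift k A H M (\<lambda>a l. \<Phi> a (x l)))"

lemma \<Xi>_bilin:
  assumes "x \<in> carrier D" shows "bilin k A H M (\<lambda>a l. \<Phi> a (x l))"
  using HM_lin_map[OF D_HM[OF assms]] HM_closed[OF D_HM[OF assms]]
  by (intro bilinI bilin_left[OF \<Phi>_Apar_bilin] lin_map_comp[OF _ bilin_right[OF \<Phi>_Apar_bilin]])

lemma \<Xi>_Lin: "x \<in> carrier D \<Longrightarrow> \<Xi> x \<in> Lin k TAH M"
  by (simp add: \<Xi>_def AH.tensor_lift_Lin[OF M_module \<Xi>_bilin])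

lemma \<Xi>_tens:
  "x \<in> carrier D \<Longrightarrow> a \<in> carrier A \<Longrightarrow> l \<in> carrier H \<Longrightarrow> \<Xi> x (tAH a l) = \<Phi> a (x l)"
  by (simp add: \<Xi>_def AH.tensor_lift_tens[OF M_module \<Xi>_bilin])

text \<open>Both sides are additive in \<open>x\<close>, which reduces the claim from elements of
  the dilation to its generators, where it is \<open>act_Apar_action\<close>.\<close>

lemma act_Apar_action_dilation:
  assumes a: "a \<in> carrier A" and h: "h \<in> carrier H" and l: "l \<in> carrier H" and x: "x \<in> carrier D"
  shows "sw M (\<lambda>u v. \<Phi> (act A u a) (x (v \<cdot> l))) h = act M h (\<Phi> a (x l))"
  using x
proof (induction rule: D_induct)
  have b: "bilin k H H M (\<lambda>u v. \<Phi> (act A u a) (y (v \<cdot> l)))" if y: "y \<in> carrier HM" for y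
    using a l
    by (intro HM_closed[OF y] bilinI lin_map_comp[OF bilin_left[OF Apar_act_bilin] bilin_left[OF \<Phi>_Apar_bilin]]
        lin_map_comp[OF lin_map_comp[OF _ HM_lin_map[OF y]] bilin_right[OF \<Phi>_Apar_bilin]]
        lin_mult_left lin_map_id m_closed Apar_act_closed)
  note pc = \<Phi>_closed[OF Apar_incl]
  note pa = lin_map_add[OF bilin_right[OF \<Phi>_Apar_bilin]]
  interpret HM: module k HM by (rule HM_module)
  {
    case zero
    have z: "\<Phi> c \<zero>\<^bsub>M\<^esub> = \<zero>\<^bsub>M\<^esub>" if "c \<in> carrier A" for c
      by (rule lin_map_zero[OF M_module M_module bilin_right[OF \<Phi>_Apar_bilin that]])
    \<comment> \<open>The summand is zero, so it may be multiplied by the scalar zero; taking this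
      scalar out shows that the whole Sweedler sum vanishes.\<close>
    have "sw M (\<lambda>u v. \<Phi> (act A u a) (\<zero>\<^bsub>HM\<^esub> (v \<cdot> l))) h = sw M (\<lambda>u v. \<zero>\<^bsub>k\<^esub> \<odot>\<^bsub>M\<^esub> \<Phi> (act A u a) (\<zero>\<^bsub>HM\<^esub> (v \<cdot> l))) h"
      using a l by (intro sweedler_cong) (simp add: HM_eval z Apar_act_closed)
    also have "\<dots> = \<zero>\<^bsub>k\<^esub> \<odot>\<^bsub>M\<^esub> sw M (\<lambda>u v. \<Phi> (act A u a) (\<zero>\<^bsub>HM\<^esub> (v \<cdot> l))) h"
      using h by (intro lin_map_sw[symmetric, OF M_module M_module lin_smult[OF M_module lin_map_id]] b) auto
    also have "\<dots> = \<zero>\<^bsub>M\<^esub>"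
      using h b by (intro M.smult_l_null sw_closed M_module) auto
    finally show ?case
      using a h l by (simp add: HM_eval z lin_map_zero[OF M_module M_module bilin_right[OF act_bilin]])
  next
    case (step h' m y)
    note y = D_HM[OF step(3)]
    have g: "dil_gen h' m \<in> carrier HM" using step by (simp add: dil_gen_closed)
    have "sw M (\<lambda>u v. \<Phi> (act A u a) ((dil_gen h' m \<oplus>\<^bsub>HM\<^esub> y) (v \<cdot> l))) h =
        sw M (\<lambda>u v. \<Phi> (act A u a) (dil_gen h' m (v \<cdot> l)) \<oplus>\<^bsub>M\<^esub> \<Phi> (act A u a) (y (v \<cdot> l))) h"
      using a l g y by (intro sweedler_cong) (simp add: HM_eval pa Apar_act_closed HM_closed)
    also have "\<dots> = sw M (\<lambda>u v. \<Phi> (act A u a) (dil_gen h' m (v \<cdot> l))) h \<oplus>\<^bsub>M\<^esub>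
        sw M (\<lambda>u v. \<Phi> (act A u a) (y (v \<cdot> l))) h"
      using h g y by (intro sw_plus M_module b)
    \<comment> \<open>At v l the generator is the action of (v l) h' = v (l h'), so the
      single-generator identity is used with \<open>l \<cdot> h'\<close> in place of
      \<open>l\<close>.\<close>
    also have "sw M (\<lambda>u v. \<Phi> (act A u a) (dil_gen h' m (v \<cdot> l))) h =
        sw M (\<lambda>u v. \<Phi> (act A u a) (act M (v \<cdot> (l \<cdot> h')) m)) h"
      using l step by (intro sweedler_cong) (simp add: dil_gen_eval m_assoc)
    also have "\<dots> = act M h (\<Phi> a (dil_gen h' m l))"
      using a h l step by (simp add: act_Apar_action dil_gen_eval)
    finally show ?case
      using a h l g y step by (simp add: HM_eval pa pc HM_closed lin_map_add[OF bilin_right[OF act_bilin]])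
  }
qed

lemma \<Xi>_closed:
  assumes x: "x \<in> carrier D" shows "\<Xi> x \<in> act_hom k H AT M"
proof (rule act_homI)
  show "\<Xi> x \<in> Lin k AT M" using \<Xi>_Lin[OF x] by (simp add: Lin_AT)
  fix h a l assume "h \<in> carrier H" "a \<in> carrier A" "l \<in> carrier H"
  then show "\<Xi> x (act AT h (tAH a l)) = act M h (\<Xi> x (tAH a l))"
    using x by (simp add: AT_act_tens lin_map_sw[OF AH.tensor_module M_module Lin_lin_map[OF \<Xi>_Lin] tAH_act_bilin]
        \<Xi>_tens act_Apar_action_dilation Apar_act_closed cong: sweedler_cong)
qed

text \<open>Each equation holds in \<open>AHom\<close> and is compared on pure tensors, where
  \<open>\<Xi> x\<close> has the value \<open>\<Phi> a (x l)\<close>. For the action of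
  \<open>h\<close> both sides become \<open>\<Phi> a (x (l \<cdot> h))\<close>.\<close>

lemma \<Xi>_act_hom: "\<Xi> \<in> act_hom k H D E"
  unfolding act_hom_def
proof (intro CollectI conjI ballI LinI lin_mapI)
  interpret HM: module k HM by (rule HM_module)
  note Dcl = module_closed[OF D_module, unfolded D_simps]
  note cl = \<Xi>_closed Dcl D_act_closed module_closed[OF AHom_module, unfolded AHom_simps(1)] AHom_act_closed
  note ev = \<Xi>_tens AHom_eval tAH_closed HM_eval HM_closed D_HM AHom_act_tens
  show "\<Xi> \<in> extensional (carrier D)" by (simp add: \<Xi>_def)
  fix x assume x: "x \<in> carrier D"
  then show "\<Xi> x \<in> carrier E" by (simp add: AHom_simps(1) \<Xi>_closed)
  show "\<Xi> (x \<oplus>\<^bsub>D\<^esub> y) = \<Xi> x \<oplus>\<^bsub>E\<^esub> \<Xi> y" if y: "y \<in> carrier D" for y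
    unfolding D_simps
    by (rule AHom_eqI) (use x y in \<open>simp_all add: cl ev lin_map_add[OF bilin_right[OF \<Phi>_Apar_bilin]]\<close>)
  show "\<Xi> (c \<odot>\<^bsub>D\<^esub> x) = c \<odot>\<^bsub>E\<^esub> \<Xi> x" if c: "c \<in> carrier k" for c
    unfolding D_simps
    by (rule AHom_eqI) (use x c in \<open>simp_all add: cl ev lin_map_smult[OF bilin_right[OF \<Phi>_Apar_bilin]]\<close>)
  show "\<Xi> (act D h x) = act E h (\<Xi> x)" if h: "h \<in> carrier H" for h
    unfolding D_simps
    by (rule AHom_eqI) (use x h in \<open>simp_all add: cl ev\<close>)
qed

lemma \<Xi>_inj: "inj_on \<Xi> (carrier D)"
proof (rule inj_onI)
  fix x y assume x: "x \<in> carrier D" and y: "y \<in> carrier D" and eq: "\<Xi> x = \<Xi> y"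
  have one: "\<one>\<^bsub>P\<^esub> \<in> carrier A" by (simp add: Apar_simps alg_generated.one)
  show "x = y"
  proof (rule HM_eqI[OF D_HM[OF x] D_HM[OF y]])
    fix l assume l: "l \<in> carrier H"
    have "\<Xi> x (tAH \<one>\<^bsub>P\<^esub> l) = \<Xi> y (tAH \<one>\<^bsub>P\<^esub> l)" using eq by simp
    then show "x l = y l"
      using x y l one by (simp add: \<Xi>_tens \<Phi>_one HM_closed D_HM)
  qed
qed

lemma \<Xi>_dil_sum:
  assumes "h \<in> {..<n} \<rightarrow> carrier H" "m \<in> {..<n} \<rightarrow> carrier M" "a \<in> carrier A" "l \<in> carrier H"
  shows "\<Xi> (dil_sum k H M n h m) (tAH a l) = \<Phi> a (\<Oplus>\<^bsub>M\<^esub>i\<in>{..<n}. act M (l \<cdot> h i) (m i))"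
proof -
  have "dil_sum k H M n h m \<in> carrier D" using assms by (auto simp: D_carrier)
  then show ?thesis using assms by (simp add: \<Xi>_tens dil_sum_eval)
qed

end

section \<open>The maps induced by a morphism of partial modules, and naturality\<close>

locale partial_module_hom = M: partial_module_over k H M + N: partial_module_over k H N
  for k :: "('k, 'y) ring_scheme" (structure) and H :: "('k, 'h, 'z) hopf_scheme" (structure)
    and M :: "('k, 'h, 'm) hmod" and N :: "('k, 'h, 'n) hmod" +
  fixes f :: "'m \<Rightarrow> 'n"
  assumes hom: "f \<in> act_hom k H M N"
begin

lemmas f_lin = act_hom_lin_map[OF hom]
lemmas f_closed = lin_map_closed[OF f_lin]

lemma AHom_map_eval:
  assumes "g \<in> act_hom k H M.AT M" "t \<in> carrier M.AT"
  shows "AHom_map k H M N f g t = f (g t)"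
  using assms by (simp add: AHom_map_def M.AHom_simps compose_eq)

lemma AHom_map_closed:
  assumes g: "g \<in> act_hom k H M.AT M" shows "AHom_map k H M N f g \<in> act_hom k H M.AT N"
proof (rule N.act_homI)
  have "AHom_map k H M N f g = compose (carrier M.AT) f g"
    using g by (simp add: AHom_map_def M.AHom_simps)
  then show "AHom_map k H M N f g \<in> Lin k M.AT N"
    using compose_Lin[OF M.AT_module act_hom_Lin[OF g] act_hom_Lin[OF hom]] by simp
  fix h a l assume "h \<in> carrier H" "a \<in> carrier M.A" "l \<in> carrier H"
  then show "AHom_map k H M N f g (act M.AT h (M.tAH a l)) = act N h (AHom_map k H M N f g (M.tAH a l))"
    using g by (simp add: AHom_map_eval M.tAH_closed lin_map_closed[OF M.AT_act_lin] act_hom_act[OF g]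
        act_hom_act[OF hom] M.AHom_closed)
qed

lemma AHom_map_act_hom: "AHom_map k H M N f \<in> act_hom k H M.E N.E"
  unfolding act_hom_def
proof (intro CollectI conjI ballI LinI lin_mapI; (unfold M.AHom_simps(1) N.AHom_simps(1))?)
  show "AHom_map k H M N f \<in> extensional (act_hom k H M.AT M)"
    by (simp add: AHom_map_def M.AHom_simps(1))
  note cl = AHom_map_closed module_closed[OF M.AHom_module, unfolded M.AHom_simps(1)]
    module_closed[OF N.AHom_module, unfolded N.AHom_simps(1)] M.AHom_act_closed N.AHom_act_closed
  note ev = AHom_map_eval M.AHom_eval N.AHom_eval M.tAH_closed M.AHom_closed M.AHom_act_tens N.AHom_act_tens
  fix g assume g: "g \<in> act_hom k H M.AT M"
  then show "AHom_map k H M N f g \<in> act_hom k H M.AT N" by (rule AHom_map_closed)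
  show "AHom_map k H M N f (g \<oplus>\<^bsub>M.E\<^esub> g') = AHom_map k H M N f g \<oplus>\<^bsub>N.E\<^esub> AHom_map k H M N f g'"
    if g': "g' \<in> act_hom k H M.AT M" for g'
    by (rule N.AHom_eqI) (use g g' in \<open>simp_all add: cl ev lin_map_add[OF f_lin]\<close>)
  show "AHom_map k H M N f (c \<odot>\<^bsub>M.E\<^esub> g) = c \<odot>\<^bsub>N.E\<^esub> AHom_map k H M N f g" if c: "c \<in> carrier k" for c
    by (rule N.AHom_eqI) (use g c in \<open>simp_all add: cl ev lin_map_smult[OF f_lin]\<close>)
  show "AHom_map k H M N f (act M.E h g) = act N.E h (AHom_map k H M N f g)" if h: "h \<in> carrier H" for h
    by (rule N.AHom_eqI) (use g h in \<open>simp_all add: cl ev\<close>)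
qed

text \<open>At each \<open>l\<close> the morphism passes through the finite sum and commutes with
  the partial action in every summand.\<close>

lemma dil_sum_map:
  assumes h: "h \<in> {..<n} \<rightarrow> carrier H" and m: "m \<in> {..<n} \<rightarrow> carrier M"
  shows "dil_sum k H N n h (\<lambda>i. f (m i)) = compose (carrier H) f (dil_sum k H M n h m)"
proof (rule N.HM_eqI)
  have fm: "(\<lambda>i. f (m i)) \<in> {..<n} \<rightarrow> carrier N" using m f_closed by auto
  show "dil_sum k H N n h (\<lambda>i. f (m i)) \<in> carrier N.HM"
    by (rule N.dil_sum_closed[OF h fm])
  show "compose (carrier H) f (dil_sum k H M n h m) \<in> carrier N.HM"
    unfolding N.HM_simps using M.dil_sum_closed[OF h m]
    by (intro compose_Lin[OF M.H_module _ act_hom_Lin[OF hom]]) (simp add: M.HM_simps)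
  fix l assume l: "l \<in> carrier H"
  have c: "act M (l \<otimes>\<^bsub>H\<^esub> h i) (m i) \<in> carrier M" if "i < n" for i
    using that h m l by (intro M.act_closed) auto
  have "f (dil_sum k H M n h m l) = (\<Oplus>\<^bsub>N\<^esub>i\<in>{..<n}. f (act M (l \<otimes>\<^bsub>H\<^esub> h i) (m i)))"
    unfolding M.dil_sum_eval[OF h m l]
    using c by (intro lin_map_finsum[OF M.M_module N.M_module f_lin]) auto
  also have "\<dots> = (\<Oplus>\<^bsub>N\<^esub>i\<in>{..<n}. act N (l \<otimes>\<^bsub>H\<^esub> h i) (f (m i)))"
    using h m l f_closed
    by (intro N.M.M.finsum_cong') (auto simp: act_hom_act[OF hom] Pi_iff intro!: N.act_closed)
  also have "\<dots> = dil_sum k H N n h (\<lambda>i. f (m i)) l"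
    by (rule N.dil_sum_eval[OF h fm l, symmetric])
  finally show "dil_sum k H N n h (\<lambda>i. f (m i)) l = compose (carrier H) f (dil_sum k H M n h m) l"
    using l by (simp add: compose_eq)
qed

text \<open>Every representation of \<open>x\<close> yields the same candidate, the composite of
  \<open>f\<close> with \<open>x\<close>. This proves the description definite and replaces it by a
  formula free of representations.\<close>

lemma dilation_map_eq:
  assumes x: "x \<in> carrier M.D" shows "dilation_map k H M N f x = compose (carrier H) f x"
proof -
  have "(THE y. \<exists>n. \<exists>h\<in>{..<n} \<rightarrow> carrier H. \<exists>m\<in>{..<n} \<rightarrow> carrier M.
      x = dil_sum k H M n h m \<and> y = dil_sum k H N n h (\<lambda>i. f (m i))) = compose (carrier H) f x"
    using x by (intro the_equality) (auto simp: M.D_carrier dil_sum_map)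
  then show ?thesis using x by (simp add: dilation_map_def)
qed

lemma dilation_map_eval: "x \<in> carrier M.D \<Longrightarrow> l \<in> carrier H \<Longrightarrow> dilation_map k H M N f x l = f (x l)"
  by (simp add: dilation_map_eq compose_eq)

lemma dilation_map_closed:
  assumes x: "x \<in> carrier M.D" shows "dilation_map k H M N f x \<in> carrier N.D"
proof -
  obtain n h m where x': "x = dil_sum k H M n h m" "h \<in> {..<n} \<rightarrow> carrier H" "m \<in> {..<n} \<rightarrow> carrier M"
    using x by (auto simp: M.D_carrier)
  have fm: "(\<lambda>i. f (m i)) \<in> {..<n} \<rightarrow> carrier N" using x'(3) f_closed by auto
  have "dilation_map k H M N f x = dil_sum k H N n h (\<lambda>i. f (m i))"
    by (simp only: dilation_map_eq[OF x] dil_sum_map[OF x'(2,3)] flip: x'(1))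
  then show ?thesis
    unfolding N.D_carrier using x'(2) fm by blast
qed

lemma dilation_map_act_hom: "dilation_map k H M N f \<in> act_hom k H M.D N.D"
  unfolding act_hom_def
proof (intro CollectI conjI ballI LinI lin_mapI)
  note Dcl = module_closed[OF M.D_module, unfolded M.D_simps] module_closed[OF N.D_module, unfolded N.D_simps]
  note cl = N.D_HM dilation_map_closed Dcl M.D_act_closed N.D_act_closed
  note ev = dilation_map_eval M.HM_eval N.HM_eval M.HM_closed M.D_HM
  show "dilation_map k H M N f \<in> extensional (carrier M.D)" by (simp add: dilation_map_def)
  fix x assume x: "x \<in> carrier M.D"
  then show "dilation_map k H M N f x \<in> carrier N.D" by (rule dilation_map_closed)
  show "dilation_map k H M N f (x \<oplus>\<^bsub>M.D\<^esub> y) = dilation_map k H M N f x \<oplus>\<^bsub>N.D\<^esub> dilation_map k H M N f y"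
    if y: "y \<in> carrier M.D" for y
    unfolding M.D_simps N.D_simps
    by (rule N.HM_eqI) (use x y in \<open>simp_all add: cl ev lin_map_add[OF f_lin]\<close>)
  show "dilation_map k H M N f (c \<odot>\<^bsub>M.D\<^esub> x) = c \<odot>\<^bsub>N.D\<^esub> dilation_map k H M N f x" if c: "c \<in> carrier k" for c
    unfolding M.D_simps N.D_simps
    by (rule N.HM_eqI) (use x c in \<open>simp_all add: cl ev lin_map_smult[OF f_lin]\<close>)
  show "dilation_map k H M N f (act M.D h x) = act N.D h (dilation_map k H M N f x)" if h: "h \<in> carrier H" for h
    unfolding M.D_simps N.D_simps
    by (rule N.HM_eqI) (use x h in \<open>simp_all add: cl ev\<close>)
qed

lemma \<Xi>_natural:
  assumes x: "x \<in> carrier M.D"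
  shows "N.\<Xi> (dilation_map k H M N f x) = AHom_map k H M N f (M.\<Xi> x)"
proof (rule N.AHom_eqI)
  show "N.\<Xi> (dilation_map k H M N f x) \<in> act_hom k H M.AT N"
    by (intro N.\<Xi>_closed dilation_map_closed x)
  show "AHom_map k H M N f (M.\<Xi> x) \<in> act_hom k H M.AT N"
    by (intro AHom_map_closed M.\<Xi>_closed x)
  fix a l assume "a \<in> carrier M.A" "l \<in> carrier H"
  then show "N.\<Xi> (dilation_map k H M N f x) (M.tAH a l) = AHom_map k H M N f (M.\<Xi> x) (M.tAH a l)"
    using x by (simp add: N.\<Xi>_tens dilation_map_closed dilation_map_eval AHom_map_eval M.\<Xi>_closed M.tAH_closed
        M.\<Xi>_tens M.act_hom_Hpar_action[OF M.partial_module N.partial_module hom] M.Apar_incl M.HM_closed M.D_HM)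
qed

end

section \<open>Functoriality of both constructions and the natural transformation\<close>

context hopf_algebra
begin

lemma partial_module_overI: "partial_module k H M \<Longrightarrow> partial_module_over k H M"
  by (intro partial_module_over.intro partial_module_over_axioms.intro hopf_algebra_axioms)

lemma partial_module_homI:
  "partial_module k H M \<Longrightarrow> partial_module k H N \<Longrightarrow> f \<in> act_hom k H M N \<Longrightarrow>
    partial_module_hom k H M N f"
  by (intro partial_module_hom.intro partial_module_hom_axioms.intro partial_module_overI)

lemma act_hom_id: "partial_module k H M \<Longrightarrow> (\<lambda>m\<in>carrier M. m) \<in> act_hom k H M M"
proof -
  assume "partial_module k H M"
  then interpret M: partial_module_over k H M by (rule partial_module_overI)
  show ?thesis
    by (simp add: act_hom_def Lin_restrict M.M_module lin_map_id M.act_closed)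
qed

lemma act_hom_compose:
  assumes "partial_module k H M" "f \<in> act_hom k H M N" "g \<in> act_hom k H N Q"
  shows "compose (carrier M) g f \<in> act_hom k H M Q"
proof -
  interpret M: partial_module_over k H M using assms(1) by (rule partial_module_overI)
  show ?thesis
    using compose_Lin[OF M.M_module act_hom_Lin[OF assms(2)] act_hom_Lin[OF assms(3)]]
    by (simp add: act_hom_def[of k H M Q] compose_eq M.act_closed act_hom_act[OF assms(2)]
        act_hom_act[OF assms(3)] lin_map_closed[OF act_hom_lin_map[OF assms(2)]])
qed

lemma dilation_functor: "functor_PMod_Mod k H (dilation k H) (dilation_map k H)"
  unfolding functor_PMod_Mod_def
proof (intro conjI allI impI ballI)
  fix M :: "('a, 'c, 'm) hmod" assume M: "partial_module k H M"
  interpret M: partial_module_over k H M using M by (rule partial_module_overI)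
  show "global_module k H (dilation k H M)" by (rule M.D_global_module)
  \<comment> \<open>The restricted identity is itself a morphism, so the evaluation rules for
    induced maps apply to it and the identity law becomes pointwise.\<close>
  interpret I: partial_module_hom k H M M "\<lambda>m\<in>carrier M. m"
    using M M act_hom_id[OF M] by (rule partial_module_homI)
  show "dilation_map k H M M (\<lambda>m\<in>carrier M. m) = (\<lambda>x\<in>carrier (dilation k H M). x)"
  proof (rule extensionalityI)
    fix x assume x: "x \<in> carrier M.D"
    have "dilation_map k H M M (\<lambda>m\<in>carrier M. m) x = x"
      by (rule M.HM_eqI)
        (use x in \<open>simp_all add: I.dilation_map_eval I.dilation_map_closed M.HM_closed M.D_HM\<close>)
    then show "dilation_map k H M M (\<lambda>m\<in>carrier M. m) x = (\<lambda>x\<in>carrier M.D. x) x"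
      using x by simp
  qed (auto simp: dilation_map_def)
  fix N :: "('a, 'c, 'm) hmod" assume N: "partial_module k H N"
  interpret N: partial_module_over k H N using N by (rule partial_module_overI)
  fix f assume f: "f \<in> act_hom k H M N"
  interpret f: partial_module_hom k H M N f using M N f by (rule partial_module_homI)
  show "dilation_map k H M N f \<in> act_hom k H (dilation k H M) (dilation k H N)"
    by (rule f.dilation_map_act_hom)
  fix Q :: "('a, 'c, 'm) hmod" assume Q: "partial_module k H Q"
  interpret Q: partial_module_over k H Q using Q by (rule partial_module_overI)
  fix g assume g: "g \<in> act_hom k H N Q"
  interpret g: partial_module_hom k H N Q g using N Q g by (rule partial_module_homI)
  interpret gf: partial_module_hom k H M Q "compose (carrier M) g f"
    using M Q act_hom_compose[OF M f g] by (rule partial_module_homI)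
  show "dilation_map k H M Q (compose (carrier M) g f) =
      compose (carrier (dilation k H M)) (dilation_map k H N Q g) (dilation_map k H M N f)"
  proof (rule extensionalityI)
    fix x assume x: "x \<in> carrier M.D"
    have "dilation_map k H M Q (compose (carrier M) g f) x = dilation_map k H N Q g (dilation_map k H M N f x)"
      by (rule Q.HM_eqI)
        (use x in \<open>simp_all add: gf.dilation_map_eval gf.dilation_map_closed f.dilation_map_eval
          f.dilation_map_closed g.dilation_map_eval g.dilation_map_closed M.HM_closed M.D_HM Q.D_HM compose_eq\<close>)
    then show "dilation_map k H M Q (compose (carrier M) g f) x =
        compose (carrier M.D) (dilation_map k H N Q g) (dilation_map k H M N f) x"
      using x by (simp add: compose_eq)
  qed (auto simp: dilation_map_def compose_def)
qed

lemma AHom_functor: "functor_PMod_Mod k H (AHom k H) (AHom_map k H)"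
  unfolding functor_PMod_Mod_def
proof (intro conjI allI impI ballI)
  fix M :: "('a, 'c, 'm) hmod" assume M: "partial_module k H M"
  interpret M: partial_module_over k H M using M by (rule partial_module_overI)
  show "global_module k H (AHom k H M)" by (rule M.AHom_global_module)
  interpret I: partial_module_hom k H M M "\<lambda>m\<in>carrier M. m"
    using M M act_hom_id[OF M] by (rule partial_module_homI)
  show "AHom_map k H M M (\<lambda>m\<in>carrier M. m) = (\<lambda>x\<in>carrier (AHom k H M). x)"
  proof (rule extensionalityI)
    fix x assume "x \<in> carrier M.E"
    then have x: "x \<in> act_hom k H AT M" by (simp add: M.AHom_simps)
    have "AHom_map k H M M (\<lambda>m\<in>carrier M. m) x = x"
      by (rule M.AHom_eqI)
        (use x in \<open>simp_all add: I.AHom_map_eval I.AHom_map_closed M.AHom_closed tAH_closed\<close>)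
    then show "AHom_map k H M M (\<lambda>m\<in>carrier M. m) x = (\<lambda>x\<in>carrier M.E. x) x"
      using x by (simp add: M.AHom_simps)
  qed (auto simp: AHom_map_def)
  fix N :: "('a, 'c, 'm) hmod" assume N: "partial_module k H N"
  interpret N: partial_module_over k H N using N by (rule partial_module_overI)
  fix f assume f: "f \<in> act_hom k H M N"
  interpret f: partial_module_hom k H M N f using M N f by (rule partial_module_homI)
  show "AHom_map k H M N f \<in> act_hom k H (AHom k H M) (AHom k H N)"
    by (rule f.AHom_map_act_hom)
  fix Q :: "('a, 'c, 'm) hmod" assume Q: "partial_module k H Q"
  interpret Q: partial_module_over k H Q using Q by (rule partial_module_overI)
  fix g assume g: "g \<in> act_hom k H N Q"
  interpret g: partial_module_hom k H N Q g using N Q g by (rule partial_module_homI)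
  interpret gf: partial_module_hom k H M Q "compose (carrier M) g f"
    using M Q act_hom_compose[OF M f g] by (rule partial_module_homI)
  show "AHom_map k H M Q (compose (carrier M) g f) =
      compose (carrier (AHom k H M)) (AHom_map k H N Q g) (AHom_map k H M N f)"
  proof (rule extensionalityI)
    fix x assume "x \<in> carrier M.E"
    then have x: "x \<in> act_hom k H AT M" by (simp add: M.AHom_simps)
    have "AHom_map k H M Q (compose (carrier M) g f) x = AHom_map k H N Q g (AHom_map k H M N f x)"
      by (rule Q.AHom_eqI)
        (use x in \<open>simp_all add: gf.AHom_map_eval gf.AHom_map_closed f.AHom_map_eval
          f.AHom_map_closed g.AHom_map_eval g.AHom_map_closed M.AHom_closed tAH_closed compose_eq\<close>)
    then show "AHom_map k H M Q (compose (carrier M) g f) x =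
        compose (carrier M.E) (AHom_map k H N Q g) (AHom_map k H M N f) x"
      using x by (simp add: compose_eq M.AHom_simps)
  qed (auto simp: AHom_map_def compose_def)
qed

lemma \<Xi>_natural_transformation:
  "natural_transformation k H (dilation k H) (dilation_map k H) (AHom k H) (AHom_map k H)
    (partial_module_over.\<Xi> k H)"
  unfolding natural_transformation_def
proof (intro conjI allI impI ballI dilation_functor AHom_functor)
  fix M :: "('a, 'c, 'm) hmod" assume M: "partial_module k H M"
  interpret M: partial_module_over k H M using M by (rule partial_module_overI)
  show "M.\<Xi> \<in> act_hom k H (dilation k H M) (AHom k H M)" by (rule M.\<Xi>_act_hom)
  fix N :: "('a, 'c, 'm) hmod" assume N: "partial_module k H N"
  interpret N: partial_module_over k H N using N by (rule partial_module_overI)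
  fix f assume f: "f \<in> act_hom k H M N"
  interpret f: partial_module_hom k H M N f using M N f by (rule partial_module_homI)
  show "compose (carrier (dilation k H M)) N.\<Xi> (dilation_map k H M N f) =
      compose (carrier (dilation k H M)) (AHom_map k H M N f) M.\<Xi>"
    by (auto simp: compose_def f.\<Xi>_natural)
qed

end

theorem proposition4p3:
  fixes k :: "'k ring" and H :: "('k, 'h) hopf"
  assumes "hopf_algebra k H"
    and "bij_betw (antipode H) (carrier H) (carrier H)"
  shows "\<exists>\<Xi> :: ('k, 'h, 'm) hmod \<Rightarrow> ('h \<Rightarrow> 'm) \<Rightarrow> (('h list \<Rightarrow> 'k) set set \<times> 'h \<Rightarrow> 'k) set \<Rightarrow> 'm.
    natural_transformation k H (dilation k H) (dilation_map k H) (AHom k H) (AHom_map k H) \<Xi> \<and>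
    (\<forall>M. partial_module k H M \<longrightarrow>
      inj_on (\<Xi> M) (carrier (dilation k H M)) \<and>
      (\<forall>n. \<forall>h\<in>{..<n} \<rightarrow> carrier H. \<forall>m\<in>{..<n} \<rightarrow> carrier M.
        \<forall>a\<in>carrier (Apar k H). \<forall>l\<in>carrier H.
          \<Xi> M (dil_sum k H M n h m) (tens k (Apar k H) H a l) =
          Hpar_action k H M a (\<Oplus>\<^bsub>M\<^esub>i\<in>{..<n}. act M (l \<otimes>\<^bsub>H\<^esub> h i) (m i))))"
proof (intro exI conjI allI impI ballI)
  interpret hopf_algebra k H by fact
  \<comment> \<open>The witness is the locale constant taken as a function of the module: its
    definition makes sense for every record, and its properties are invoked for partial
    modules.\<close>
  show "natural_transformation k H (dilation k H) (dilation_map k H) (AHom k H) (AHom_map k H)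
      (partial_module_over.\<Xi> k H)"
    by (rule \<Xi>_natural_transformation)
  fix M :: "('k, 'h, 'm) hmod" assume "partial_module k H M"
  then interpret M: partial_module_over k H M by (rule partial_module_overI)
  show "inj_on M.\<Xi> (carrier (dilation k H M))" by (rule M.\<Xi>_inj)
  fix n :: nat and h m a l
  assume "h \<in> {..<n} \<rightarrow> carrier H" "m \<in> {..<n} \<rightarrow> carrier M" "a \<in> carrier (Apar k H)" "l \<in> carrier H"
  then show "M.\<Xi> (dil_sum k H M n h m) (tens k (Apar k H) H a l) =
      Hpar_action k H M a (\<Oplus>\<^bsub>M\<^esub>i\<in>{..<n}. act M (l \<otimes>\<^bsub>H\<^esub> h i) (m i))"
    by (rule M.\<Xi>_dil_sum)
qed

end
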